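(* Let $k$ be a field of characteristic $p>0$ and $A=\bigoplus_{n\ge 0}A_n$ a connected noetherian graded commutative $k$-algebra. Let $d\ge 1$, and suppose that $A$ is a finitely generated module over $A(d)$, the subalgebra of $A$ generated by $A_d$. Then there are a finite field extension $K/k$ and a filter-regular system of parameters $x_1,\ldots,x_n$ for $A_K=K\otimes_k A$ with $|x_i|=d$ for every $i$.
   Context: Connected noetherian means that $A_0=k$ and $A$ is finitely generated as a $k$-algebra. Elements are always understood to be homogeneous, $|x|$ denotes the degree of $x$, and $A_+$ is the ideal of elements of positive degree. A system of parameters for such an algebra $A$ over $k$ is a sequence $h_1,\ldots,h_n\in A_+$ of algebraically independent homogeneous elements such that $A$ is a finitely generated module over $k[h_1,\ldots,h_n]$ (so $n$ is the Krull dimension of $A$; $n=0$ is allowed). A sequence $h_1,\ldots,h_n\in A_+$ is filter-regular if for each $1\le i\le n$ the annihilator of $h_i$ in $A/(h_1,\ldots,h_{i-1})$ has bounded degree (i.e. is a finite-dimensional $k$-vector space). For $A_K$ the same definitions are used over the field $K$. *)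

theory Defs
  imports "HOL-Algebra.Generated_Rings" "HOL-Algebra.Free_Abelian_Groups" "HOL-Algebra.Algebraic_Closure"
begin

section \<open>Graded commutative algebras\<close>

text \<open>
  A \<open>k\<close>-algebra is a ring with a compatible \<open>k\<close>-module structure, carried by one record of type
  \<open>module\<close>. Commutativity is meant in the graded sense, so the underlying ring need not be
  commutative and the library's locale \<open>algebra\<close> does not apply. No condition \<open>x \<otimes> x = \<zero>\<close> is
  imposed on elements of odd degree; outside characteristic 2 it follows from the sign rule.
\<close>

locale graded_commutative_algebra =
  module k A + k: field k + A: ring A
  for k :: "('a, 'm) ring_scheme" and A :: "('a, 'b, 'n) module_scheme" and G :: "nat \<Rightarrow> 'b set" +
  assumes smult_mult_left:
      "\<lbrakk> a \<in> carrier k; x \<in> carrier A; y \<in> carrier A \<rbrakk>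
        \<Longrightarrow> a \<odot>\<^bsub>A\<^esub> (x \<otimes>\<^bsub>A\<^esub> y) = (a \<odot>\<^bsub>A\<^esub> x) \<otimes>\<^bsub>A\<^esub> y"
    and smult_mult_right:
      "\<lbrakk> a \<in> carrier k; x \<in> carrier A; y \<in> carrier A \<rbrakk>
        \<Longrightarrow> a \<odot>\<^bsub>A\<^esub> (x \<otimes>\<^bsub>A\<^esub> y) = x \<otimes>\<^bsub>A\<^esub> (a \<odot>\<^bsub>A\<^esub> y)"
    and component_submodule: "submodule (G n) k A"
    and direct_sum:
      "x \<in> carrier A \<Longrightarrow>
        \<exists>!c. (\<forall>n. c n \<in> G n) \<and> finite {n. c n \<noteq> \<zero>\<^bsub>A\<^esub>} \<and> x = finsum A c {n. c n \<noteq> \<zero>\<^bsub>A\<^esub>}"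
    and one_degree: "\<one>\<^bsub>A\<^esub> \<in> G 0"
    and mult_degree: "\<lbrakk> x \<in> G m; y \<in> G n \<rbrakk> \<Longrightarrow> x \<otimes>\<^bsub>A\<^esub> y \<in> G (m + n)"
    and graded_commute:
      "\<lbrakk> x \<in> G m; y \<in> G n \<rbrakk>
        \<Longrightarrow> x \<otimes>\<^bsub>A\<^esub> y = (if odd (m * n) then \<ominus>\<^bsub>A\<^esub> (y \<otimes>\<^bsub>A\<^esub> x) else y \<otimes>\<^bsub>A\<^esub> x)"

definition generated_subalgebra ::
    "('a, 'm) ring_scheme \<Rightarrow> ('a, 'b, 'n) module_scheme \<Rightarrow> 'b set \<Rightarrow> 'b set"
  where "generated_subalgebra k A S = generate_ring A ((\<lambda>a. a \<odot>\<^bsub>A\<^esub> \<one>\<^bsub>A\<^esub>) ` carrier k \<union> S)"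

definition finitely_generated_algebra ::
    "('a, 'm) ring_scheme \<Rightarrow> ('a, 'b, 'n) module_scheme \<Rightarrow> bool"
  where "finitely_generated_algebra k A \<longleftrightarrow>
    (\<exists>S. finite S \<and> S \<subseteq> carrier A \<and> generated_subalgebra k A S = carrier A)"

definition finitely_generated_over :: "('b, 'n) ring_scheme \<Rightarrow> 'b set \<Rightarrow> bool"
  \<comment> \<open>\<open>A\<close> is finitely generated as a left module over its subring \<open>B\<close>\<close>
  where "finitely_generated_over A B \<longleftrightarrow>
    (\<exists>F. finite F \<and> F \<subseteq> carrier A \<and>
      (\<forall>x \<in> carrier A. \<exists>b \<in> F \<rightarrow> B. x = finsum A (\<lambda>f. b f \<otimes>\<^bsub>A\<^esub> f) F))"

locale connected_noetherian_algebra = graded_commutative_algebra k A G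
  for k :: "('a, 'm) ring_scheme" and A :: "('a, 'b, 'n) module_scheme" and G :: "nat \<Rightarrow> 'b set" +
  assumes connected: "bij_betw (\<lambda>a. a \<odot>\<^bsub>A\<^esub> \<one>\<^bsub>A\<^esub>) (carrier k) (G 0)"
    and noetherian: "finitely_generated_algebra k A"

text \<open>The additive order of \<open>\<one>\<close>; \<open>ord\<close> is 0 for elements of infinite order.\<close>

definition characteristic :: "('a, 'm) ring_scheme \<Rightarrow> nat"
  where "characteristic k = group.ord (add_monoid k) \<one>\<^bsub>k\<^esub>"


section \<open>Systems of parameters and filter-regular sequences\<close>

definition monomial_eval :: "('b, 'n) ring_scheme \<Rightarrow> 'b list \<Rightarrow> nat list \<Rightarrow> 'b"
  where "monomial_eval A hs es = foldr (\<lambda>(h, e) m. (h [^]\<^bsub>A\<^esub> e) \<otimes>\<^bsub>A\<^esub> m) (zip hs es) \<one>\<^bsub>A\<^esub>"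

text \<open>
  The ordered monomials in \<open>hs\<close> are linearly independent over \<open>k\<close>. For homogeneous \<open>hs\<close> this forces
  the members of \<open>hs\<close> to commute: if one of them had odd degree and the characteristic were
  not 2, its square would vanish.
\<close>

definition algebraically_independent ::
    "('a, 'm) ring_scheme \<Rightarrow> ('a, 'b, 'n) module_scheme \<Rightarrow> 'b list \<Rightarrow> bool"
  where "algebraically_independent k A hs \<longleftrightarrow>
    (\<forall>E c. finite E \<and> E \<subseteq> {es. length es = length hs} \<and> c \<in> E \<rightarrow> carrier k \<and>
        finsum A (\<lambda>es. c es \<odot>\<^bsub>A\<^esub> monomial_eval A hs es) E = \<zero>\<^bsub>A\<^esub>
      \<longrightarrow> (\<forall>es \<in> E. c es = \<zero>\<^bsub>k\<^esub>))"

definition homogeneous_positive :: "(nat \<Rightarrow> 'b set) \<Rightarrow> 'b set"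
  where "homogeneous_positive G = (\<Union>n \<in> {0<..}. G n)"

definition system_of_parameters ::
    "('a, 'm) ring_scheme \<Rightarrow> ('a, 'b, 'n) module_scheme \<Rightarrow> (nat \<Rightarrow> 'b set) \<Rightarrow> 'b list \<Rightarrow> bool"
  where "system_of_parameters k A G hs \<longleftrightarrow>
    set hs \<subseteq> homogeneous_positive G \<and>
    algebraically_independent k A hs \<and>
    finitely_generated_over A (generated_subalgebra k A (set hs))"

definition annihilator :: "('b, 'n) ring_scheme \<Rightarrow> 'b \<Rightarrow> 'b set"
  where "annihilator R a = {y \<in> carrier R. a \<otimes>\<^bsub>R\<^esub> y = \<zero>\<^bsub>R\<^esub>}"

definition quotient_grading ::
    "('b, 'n) ring_scheme \<Rightarrow> (nat \<Rightarrow> 'b set) \<Rightarrow> 'b set \<Rightarrow> nat \<Rightarrow> 'b set set"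
  where "quotient_grading A G I n = (\<lambda>x. I +>\<^bsub>A\<^esub> x) ` G n"

definition bounded_degree :: "('b, 'n) ring_scheme \<Rightarrow> (nat \<Rightarrow> 'b set) \<Rightarrow> 'b set \<Rightarrow> bool"
  \<comment> \<open>meant for subgroups \<open>S\<close> generated by their homogeneous elements\<close>
  where "bounded_degree R G S \<longleftrightarrow> (\<exists>N. \<forall>n > N. S \<inter> G n \<subseteq> {\<zero>\<^bsub>R\<^esub>})"

text \<open>
  Ideals generated by homogeneous elements, and annihilators of homogeneous elements, are the
  same on the left, on the right and two-sided. Lists are indexed from 0.
\<close>

definition filter_regular :: "('b, 'n) ring_scheme \<Rightarrow> (nat \<Rightarrow> 'b set) \<Rightarrow> 'b list \<Rightarrow> bool"
  where "filter_regular A G hs \<longleftrightarrow>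
    set hs \<subseteq> homogeneous_positive G \<and>
    (\<forall>i < length hs.
      let I = Idl\<^bsub>A\<^esub> (set (take i hs)) in
        bounded_degree (A Quot I) (quotient_grading A G I)
          (annihilator (A Quot I) (I +>\<^bsub>A\<^esub> (hs ! i))))"


section \<open>Finite field extensions and extension of scalars\<close>

definition finite_field_extension ::
    "('a, 'm) ring_scheme \<Rightarrow> ('a \<Rightarrow> 'c) \<Rightarrow> ('c, 'l) ring_scheme \<Rightarrow> bool"
  where "finite_field_extension k \<iota> K \<longleftrightarrow>
    field k \<and> field K \<and> \<iota> \<in> ring_hom k K \<and>
    ring.finite_dimension K (\<iota> ` carrier k) (carrier K)"

text \<open>
  \<open>K \<otimes>\<^sub>k A\<close> is the free abelian group on \<open>K \<times> A\<close> modulo the subgroup generated by the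
  bilinearity relations, where \<open>K\<close> is a \<open>k\<close>-algebra via \<open>\<iota>\<close>. Its elements are cosets; products
  and scalar multiples are induced from operations on formal sums of pairs.
\<close>

abbreviation tensor_free ::
    "('c, 'l) ring_scheme \<Rightarrow> ('a, 'b, 'n) module_scheme \<Rightarrow> (('c \<times> 'b) \<Rightarrow>\<^sub>0 int) monoid"
  where "tensor_free K A \<equiv> free_Abelian_group (carrier K \<times> carrier A)"

definition tensor_relators ::
    "('a, 'm) ring_scheme \<Rightarrow> ('a \<Rightarrow> 'c) \<Rightarrow> ('c, 'l) ring_scheme \<Rightarrow> ('a, 'b, 'n) module_scheme
      \<Rightarrow> (('c \<times> 'b) \<Rightarrow>\<^sub>0 int) set"
  where "tensor_relators k \<iota> K A =
    {frag_of (c \<oplus>\<^bsub>K\<^esub> c', x) - frag_of (c, x) - frag_of (c', x) | c c' x.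
       c \<in> carrier K \<and> c' \<in> carrier K \<and> x \<in> carrier A} \<union>
    {frag_of (c, x \<oplus>\<^bsub>A\<^esub> x') - frag_of (c, x) - frag_of (c, x') | c x x'.
       c \<in> carrier K \<and> x \<in> carrier A \<and> x' \<in> carrier A} \<union>
    {frag_of (c \<otimes>\<^bsub>K\<^esub> \<iota> a, x) - frag_of (c, a \<odot>\<^bsub>A\<^esub> x) | c a x.
       c \<in> carrier K \<and> a \<in> carrier k \<and> x \<in> carrier A}"

definition tensor_kernel ::
    "('a, 'm) ring_scheme \<Rightarrow> ('a \<Rightarrow> 'c) \<Rightarrow> ('c, 'l) ring_scheme \<Rightarrow> ('a, 'b, 'n) module_scheme
      \<Rightarrow> (('c \<times> 'b) \<Rightarrow>\<^sub>0 int) set"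
  where "tensor_kernel k \<iota> K A = generate (tensor_free K A) (tensor_relators k \<iota> K A)"

definition tensor_class ::
    "('a, 'm) ring_scheme \<Rightarrow> ('a \<Rightarrow> 'c) \<Rightarrow> ('c, 'l) ring_scheme \<Rightarrow> ('a, 'b, 'n) module_scheme
      \<Rightarrow> (('c \<times> 'b) \<Rightarrow>\<^sub>0 int) \<Rightarrow> (('c \<times> 'b) \<Rightarrow>\<^sub>0 int) set"
  where "tensor_class k \<iota> K A u = tensor_kernel k \<iota> K A #>\<^bsub>tensor_free K A\<^esub> u"

definition formal_mult ::
    "('c, 'l) ring_scheme \<Rightarrow> ('a, 'b, 'n) module_scheme
      \<Rightarrow> (('c \<times> 'b) \<Rightarrow>\<^sub>0 int) \<Rightarrow> (('c \<times> 'b) \<Rightarrow>\<^sub>0 int) \<Rightarrow> (('c \<times> 'b) \<Rightarrow>\<^sub>0 int)"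
  where "formal_mult K A u v =
    frag_extend (\<lambda>(c, x). frag_extend (\<lambda>(c', y). frag_of (c \<otimes>\<^bsub>K\<^esub> c', x \<otimes>\<^bsub>A\<^esub> y)) v) u"

definition formal_smult ::
    "('c, 'l) ring_scheme \<Rightarrow> 'c \<Rightarrow> (('c \<times> 'b) \<Rightarrow>\<^sub>0 int) \<Rightarrow> (('c \<times> 'b) \<Rightarrow>\<^sub>0 int)"
  where "formal_smult K a u = frag_extend (\<lambda>(c, x). frag_of (a \<otimes>\<^bsub>K\<^esub> c, x)) u"

definition base_change ::
    "('a, 'm) ring_scheme \<Rightarrow> ('a \<Rightarrow> 'c) \<Rightarrow> ('c, 'l) ring_scheme \<Rightarrow> ('a, 'b, 'n) module_scheme
      \<Rightarrow> ('c, (('c \<times> 'b) \<Rightarrow>\<^sub>0 int) set) module"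
  where "base_change k \<iota> K A =
    \<lparr> carrier = carrier (tensor_free K A Mod tensor_kernel k \<iota> K A),
      monoid.mult = (\<lambda>U V. \<Union>u \<in> U. \<Union>v \<in> V. tensor_class k \<iota> K A (formal_mult K A u v)),
      monoid.one = tensor_class k \<iota> K A (frag_of (\<one>\<^bsub>K\<^esub>, \<one>\<^bsub>A\<^esub>)),
      ring.zero = \<one>\<^bsub>tensor_free K A Mod tensor_kernel k \<iota> K A\<^esub>,
      ring.add = (\<otimes>\<^bsub>tensor_free K A Mod tensor_kernel k \<iota> K A\<^esub>),
      module.smult = (\<lambda>a U. \<Union>u \<in> U. tensor_class k \<iota> K A (formal_smult K a u)) \<rparr>"

text \<open>The image of \<open>K \<otimes>\<^sub>k A\<^sub>n\<close>; \<open>K\<close> sits in degree 0.\<close>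

definition base_change_grading ::
    "('a, 'm) ring_scheme \<Rightarrow> ('a \<Rightarrow> 'c) \<Rightarrow> ('c, 'l) ring_scheme \<Rightarrow> ('a, 'b, 'n) module_scheme
      \<Rightarrow> (nat \<Rightarrow> 'b set) \<Rightarrow> nat \<Rightarrow> (('c \<times> 'b) \<Rightarrow>\<^sub>0 int) set set"
  where "base_change_grading k \<iota> K A G n =
    tensor_class k \<iota> K A ` carrier (free_Abelian_group (carrier K \<times> G n))"

text \<open>
  A type large enough to carry the algebraic closure of a field with elements in \<open>'a\<close>. Every
  finite extension of such a field embeds in that closure, so an existential quantifier over
  finite extensions loses nothing by ranging over fields with elements in this type.
\<close>

type_synonym 'a closure_carrier = "('a list \<times> nat) multiset \<Rightarrow> 'a"

end

theory Submission
  imports Defs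
begin

text \<open>
  The parameters are found one at a time in \<open>A\<^sub>d\<close>, each of them filter-regular modulo its predecessors,
  until the quotient by the chosen elements has bounded degree. The search ends because the ideals that
  are generated increase strictly and \<open>A\<close> is noetherian.

  A next element exists over an infinite field for the following reason. For a homogeneous ideal \<open>I\<close>, the
  elements of \<open>A\<^sub>d\<close> that are not filter-regular on \<open>A/I\<close> lie in finitely many proper subspaces
  (\<open>bad_subspaces\<close>), and finitely many proper subspaces do not cover a vector space
  (\<open>avoid_subspaces\<close>). The first statement is proved by noetherian induction. If \<open>I\<close> is prime, then every
  element outside \<open>I\<close> is regular on \<open>A/I\<close>, so that \<open>I \<inter> A\<^sub>d\<close> is the only subspace to avoid; it is proper
  unless \<open>A/I\<close> has bounded degree, since \<open>A\<close> is finite over \<open>A(d)\<close>. If \<open>I\<close> is not prime, there is a homogeneous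
  \<open>y\<close> for which both \<open>I + Ay\<close> and \<open>I : y\<close> are strictly larger than \<open>I\<close>, and the exact sequence
  \<open>0 \<rightarrow> A/(I : y) \<rightarrow> A/I \<rightarrow> A/(I + Ay) \<rightarrow> 0\<close> reduces the claim for \<open>I\<close> to the claims for these two ideals. The
  ascending chain condition comes from leading monomials and Dickson's lemma (\<open>wf_graded_ideals\<close>), an
  argument that tolerates the signs in the commutation rule.

  The resulting sequence is a system of parameters: finiteness is the graded Nakayama lemma
  (\<open>finitely_generated_over_parameters\<close>). For algebraic independence write a homogeneous relation
  as \<open>x\<^sub>1Q + R\<close> with \<open>R\<close> free of \<open>x\<^sub>1\<close>; modulo \<open>x\<^sub>1\<close> it is a relation \<open>R\<close> between fewer parameters, and once \<open>R\<close> is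
  trivial, regularity of \<open>x\<^sub>1\<close> in large degrees leaves the relation \<open>Q\<close> of smaller degree (\<open>relation_trivial\<close>).
  Ideals are easy to handle when their generators are central. If some element of \<open>A\<^sub>d\<close> is not central,
  then \<open>d\<close> is odd and all squares in \<open>A\<^sub>d\<close> vanish, so \<open>A\<close> itself has bounded degree and the sequence is empty
  (\<open>parameters_central\<close>).

  A finite field may be too small to avoid the subspaces, and the number of subspaces may grow under a
  field extension. The construction is therefore carried out over the algebraic closure \<open>L\<close> of \<open>k\<close>. The
  parameters involve finitely many scalars, which generate a finite extension \<open>K\<close> of \<open>k\<close>, so they come
  from \<open>A\<^sub>K\<close>. A \<open>K\<close>-linear retraction \<open>L \<rightarrow> K\<close> induces an \<open>A\<^sub>K\<close>-linear retraction \<open>A\<^sub>L \<rightarrow> A\<^sub>K\<close>, whence every ideal of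
  \<open>A\<^sub>K\<close> that the parameters generate is the contraction of its extension to \<open>A\<^sub>L\<close>, and all conditions
  descend (\<open>parameter_sequence_descends\<close>).
\<close>

section \<open>Left spans over a subring\<close>

text \<open>
  The inductive form adds one term at a time, so that closure properties are proved without index
  sets; \<open>lspan_eq_finsums\<close> relates it to sums with one coefficient for each generator.
\<close>

inductive_set lspan :: "('b, 'n) ring_scheme \<Rightarrow> 'b set \<Rightarrow> 'b set \<Rightarrow> 'b set"
  for R (structure) and B and F where
    zero: "\<zero> \<in> lspan R B F"
  | step: "\<lbrakk> b \<in> B; f \<in> F; t \<in> lspan R B F \<rbrakk> \<Longrightarrow> b \<otimes> f \<oplus> t \<in> lspan R B F"

lemma lspan_mono:
  assumes "B \<subseteq> B'" "F \<subseteq> F'" shows "lspan R B F \<subseteq> lspan R B' F'"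
proof
  fix x assume "x \<in> lspan R B F" then show "x \<in> lspan R B' F'"
    by induction (use assms in \<open>auto intro: lspan.intros\<close>)
qed

context ring begin

lemma lspan_subset_carrier:
  assumes "B \<subseteq> carrier R" "F \<subseteq> carrier R" shows "lspan R B F \<subseteq> carrier R"
proof
  fix x assume "x \<in> lspan R B F" then show "x \<in> carrier R"
    by induction (use assms in auto)
qed

lemma lspan_least:
  assumes "\<zero> \<in> M" and "\<And>x y. \<lbrakk> x \<in> M; y \<in> M \<rbrakk> \<Longrightarrow> x \<oplus> y \<in> M"
    and "\<And>b f. \<lbrakk> b \<in> B; f \<in> F \<rbrakk> \<Longrightarrow> b \<otimes> f \<in> M"
  shows "lspan R B F \<subseteq> M"
proof
  fix x assume "x \<in> lspan R B F" then show "x \<in> M"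
    by induction (use assms in auto)
qed

lemma lspan_add:
  assumes BF: "B \<subseteq> carrier R" "F \<subseteq> carrier R" and x: "x \<in> lspan R B F" and y: "y \<in> lspan R B F"
  shows "x \<oplus> y \<in> lspan R B F"
  using x
proof induction
  case zero then show ?case using lspan_subset_carrier[OF BF] y by auto
next
  case (step b f t)
  have "b \<otimes> f \<oplus> t \<oplus> y = b \<otimes> f \<oplus> (t \<oplus> y)"
    using step y BF lspan_subset_carrier[OF BF] by (intro a_assoc) auto
  then show ?case using step lspan.step by metis
qed

lemma lspan_mult_in:
  assumes BF: "B \<subseteq> carrier R" "F \<subseteq> carrier R" and "b \<in> B" "f \<in> F"
  shows "b \<otimes> f \<in> lspan R B F"
proof -
  have "b \<otimes> f \<oplus> \<zero> \<in> lspan R B F" using assms by (intro lspan.intros)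
  moreover have "b \<otimes> f \<oplus> \<zero> = b \<otimes> f" using assms by (simp add: subset_iff)
  ultimately show ?thesis by metis
qed

lemma lspan_incl:
  assumes BF: "B \<subseteq> carrier R" "F \<subseteq> carrier R" and "\<one> \<in> B" "f \<in> F"
  shows "f \<in> lspan R B F"
proof -
  have "\<one> \<otimes> f \<in> lspan R B F" using assms by (intro lspan_mult_in)
  moreover have "\<one> \<otimes> f = f" using assms by (simp add: subset_iff)
  ultimately show ?thesis by metis
qed

lemma lspan_smult:
  assumes BF: "B \<subseteq> carrier R" "F \<subseteq> carrier R" and x: "x \<in> lspan R B F"
    and a: "a \<in> carrier R" and aB: "\<And>b. b \<in> B \<Longrightarrow> a \<otimes> b \<in> B"
  shows "a \<otimes> x \<in> lspan R B F"
  using x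
proof induction
  case zero then show ?case using a by (auto intro: lspan.zero)
next
  case (step b f t)
  then have c: "b \<in> carrier R" "f \<in> carrier R" "t \<in> carrier R"
    using BF lspan_subset_carrier[OF BF] by auto
  then have "a \<otimes> (b \<otimes> f \<oplus> t) = a \<otimes> b \<otimes> f \<oplus> a \<otimes> t"
    using a by (simp add: r_distr m_assoc)
  then show ?case using lspan.step[OF aB[OF step(1)] step(2,4)] by simp
qed

lemma lspan_minus:
  assumes BF: "B \<subseteq> carrier R" "F \<subseteq> carrier R" and x: "x \<in> lspan R B F"
    and mB: "\<And>b. b \<in> B \<Longrightarrow> \<ominus> b \<in> B"
  shows "\<ominus> x \<in> lspan R B F"
proof -
  have "\<ominus> \<one> \<otimes> x \<in> lspan R B F"
    using lspan_smult[OF BF x] mB BF by (auto simp: l_minus subset_iff)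
  moreover have "x \<in> carrier R" using x lspan_subset_carrier[OF BF] by auto
  ultimately show ?thesis by (simp add: l_minus)
qed

lemma finsum_in_closed:
  assumes "finite S" "\<And>s. s \<in> S \<Longrightarrow> f s \<in> M" "\<zero> \<in> M" "M \<subseteq> carrier R"
    "\<And>x y. \<lbrakk> x \<in> M; y \<in> M \<rbrakk> \<Longrightarrow> x \<oplus> y \<in> M"
  shows "finsum R f S \<in> M"
  using assms(1,2)
proof (induction S)
  case empty then show ?case using assms by simp
next
  case (insert s S)
  then have "f \<in> S \<rightarrow> carrier R" "f s \<in> carrier R" using assms(4) by auto
  then show ?case using insert assms(5) by simp
qed

lemma finsum_expand_support:
  assumes "finite S" "T \<subseteq> S" "f \<in> S \<rightarrow> carrier R" "\<And>s. s \<in> S - T \<Longrightarrow> f s = \<zero>"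
  shows "finsum R f T = finsum R f S"
  using assms by (intro add.finprod_mono_neutral_cong_left) auto

text \<open>
  Sums with one coefficient per generator are closed under addition, since coefficients of the
  same generator can be added; this absorbs repeated generators in a span.
\<close>

lemma lspan_eq_finsums:
  assumes B: "subring B R" and F: "finite F" "F \<subseteq> carrier R"
  shows "lspan R B F = {finsum R (\<lambda>f. b f \<otimes> f) F | b. b \<in> F \<rightarrow> B}"
proof
  note BR = subringE[OF B]
  show "{finsum R (\<lambda>f. b f \<otimes> f) F | b. b \<in> F \<rightarrow> B} \<subseteq> lspan R B F"
    using F BR lspan_subset_carrier[of B F]
    by (auto intro!: finsum_in_closed lspan_mult_in lspan_add lspan.zero)
  show "lspan R B F \<subseteq> {finsum R (\<lambda>f. b f \<otimes> f) F | b. b \<in> F \<rightarrow> B}"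
  proof (rule lspan_least)
    have "finsum R (\<lambda>f. \<zero> \<otimes> f) F = \<zero>" using F by (intro add.finprod_one_eqI) auto
    then show "\<zero> \<in> {finsum R (\<lambda>f. b f \<otimes> f) F | b. b \<in> F \<rightarrow> B}"
      using BR(2) by (intro CollectI exI[of _ "\<lambda>_. \<zero>"]) auto
  next
    fix x y assume "x \<in> {finsum R (\<lambda>f. b f \<otimes> f) F | b. b \<in> F \<rightarrow> B}"
      "y \<in> {finsum R (\<lambda>f. b f \<otimes> f) F | b. b \<in> F \<rightarrow> B}"
    then obtain b b' where b: "b \<in> F \<rightarrow> B" "x = finsum R (\<lambda>f. b f \<otimes> f) F"
      "b' \<in> F \<rightarrow> B" "y = finsum R (\<lambda>f. b' f \<otimes> f) F" by blast
    have c: "b f \<in> carrier R" "b' f \<in> carrier R" "f \<in> carrier R" if "f \<in> F" for f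
      using that b F BR by auto
    have "x \<oplus> y = finsum R (\<lambda>f. b f \<otimes> f \<oplus> b' f \<otimes> f) F"
      unfolding b by (intro finsum_addf[symmetric]) (auto intro: c)
    also have "\<dots> = finsum R (\<lambda>f. (b f \<oplus> b' f) \<otimes> f) F"
      by (intro finsum_cong') (auto intro: c simp: c l_distr)
    finally show "x \<oplus> y \<in> {finsum R (\<lambda>f. b f \<otimes> f) F | b. b \<in> F \<rightarrow> B}"
      using b BR(7) by (intro CollectI exI[of _ "\<lambda>f. b f \<oplus> b' f"]) auto
  next
    fix b f assume bf: "b \<in> B" "f \<in> F"
    have "finsum R (\<lambda>g. (if g = f then b else \<zero>) \<otimes> g) F = finsum R (\<lambda>g. if f = g then b \<otimes> g else \<zero>) F"
      using F bf BR by (intro finsum_cong') (auto split: if_splits simp: subset_iff)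
    also have "\<dots> = b \<otimes> f"
      using F bf BR finsum_singleton[of f F "\<lambda>g. b \<otimes> g"] by (auto simp: subset_iff)
    finally show "b \<otimes> f \<in> {finsum R (\<lambda>f. b f \<otimes> f) F | b. b \<in> F \<rightarrow> B}"
      using bf BR(2) by (intro CollectI exI[of _ "\<lambda>g. if g = f then b else \<zero>"]) auto
  qed
qed

lemma finitely_generated_over_iff_lspan:
  assumes B: "subring B R"
  shows "finitely_generated_over R B \<longleftrightarrow>
    (\<exists>F. finite F \<and> F \<subseteq> carrier R \<and> carrier R \<subseteq> lspan R B F)"
proof -
  have "(\<forall>x \<in> carrier R. \<exists>b \<in> F \<rightarrow> B. x = finsum R (\<lambda>f. b f \<otimes> f) F) \<longleftrightarrow> carrier R \<subseteq> lspan R B F"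
    if "finite F" "F \<subseteq> carrier R" for F
    unfolding lspan_eq_finsums[OF B that] by (auto simp: subset_iff Bex_def)
  then show ?thesis unfolding finitely_generated_over_def by meson
qed

end

section \<open>Homogeneous components\<close>

text \<open>
  The algebra becomes the implicit structure, so that its operations carry no index.
\<close>

locale graded_algebra = graded_commutative_algebra k A G
  for k :: "('a, 'm) ring_scheme" and A :: "('a, 'b, 'n) module_scheme" (structure)
    and G :: "nat \<Rightarrow> 'b set"
begin

lemma G_subset: "G n \<subseteq> carrier A" and G_add: "\<lbrakk> x \<in> G n; y \<in> G n \<rbrakk> \<Longrightarrow> x \<oplus> y \<in> G n"
  and G_minus: "x \<in> G n \<Longrightarrow> \<ominus> x \<in> G n"
  and G_smult: "\<lbrakk> a \<in> carrier k; x \<in> G n \<rbrakk> \<Longrightarrow> a \<odot> x \<in> G n"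
  using submoduleE[OF component_submodule[of n]] by auto

lemma G_zero: "\<zero> \<in> G n"
  using component_submodule[of n] subgroup.one_closed[of "G n" "add_monoid A"]
  by (simp add: submodule_def)

lemma G_carrier [simp, dest]: "x \<in> G n \<Longrightarrow> x \<in> carrier A"
  using G_subset by auto

text \<open>
  The homogeneous component of \<open>x\<close> in a given degree.
\<close>

definition part :: "'b \<Rightarrow> nat \<Rightarrow> 'b" where
  "part x = (THE c. (\<forall>n. c n \<in> G n) \<and> finite {n. c n \<noteq> \<zero>} \<and> x = finsum A c {n. c n \<noteq> \<zero>})"

lemma part_props:
  assumes "x \<in> carrier A"
  shows part_in: "part x n \<in> G n" and finite_part: "finite {n. part x n \<noteq> \<zero>}"
    and part_sum: "finsum A (part x) {n. part x n \<noteq> \<zero>} = x"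
  using theI'[OF direct_sum[OF assms]] unfolding part_def by auto

lemma part_eqI:
  assumes "finite S" "\<And>n. c n \<in> G n" "\<And>n. n \<notin> S \<Longrightarrow> c n = \<zero>" "finsum A c S = x"
  shows "part x = c"
proof -
  have s: "{n. c n \<noteq> \<zero>} \<subseteq> S" using assms by auto
  have "finsum A c {n. c n \<noteq> \<zero>} = finsum A c S"
    by (intro A.finsum_expand_support) (use assms s in auto)
  then have c: "(\<forall>n. c n \<in> G n) \<and> finite {n. c n \<noteq> \<zero>} \<and> x = finsum A c {n. c n \<noteq> \<zero>}"
    using assms finite_subset[OF s] by auto
  have "x \<in> carrier A" using assms by (auto intro!: M.finsum_closed)
  from the1_equality[where P="\<lambda>c. (\<forall>n. c n \<in> G n) \<and> finite {n. c n \<noteq> \<zero>} \<and> x = finsum A c {n. c n \<noteq> \<zero>}", OF direct_sum[OF this] c]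
  show ?thesis unfolding part_def .
qed

lemma part_homogeneous:
  assumes "x \<in> G m" shows "part x n = (if n = m then x else \<zero>)"
proof -
  have "part x = (\<lambda>n. if n = m then x else \<zero>)"
    by (rule part_eqI[of "{m}"]) (use assms G_zero in auto)
  then show ?thesis by simp
qed

lemma part_zero [simp]: "part \<zero> n = \<zero>"
  using part_homogeneous[OF G_zero[of 0]] by auto

lemma part_carrier [simp]: "x \<in> carrier A \<Longrightarrow> part x n \<in> carrier A"
  using part_in by blast

lemma part_add:
  assumes x: "x \<in> carrier A" and y: "y \<in> carrier A"
  shows "part (x \<oplus> y) n = part x n \<oplus> part y n"
proof -
  let ?S = "{n. part x n \<noteq> \<zero>} \<union> {n. part y n \<noteq> \<zero>}"
  have fin: "finite ?S" using finite_part[OF x] finite_part[OF y] by simp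
  have cl: "part x \<in> ?S \<rightarrow> carrier A" "part y \<in> ?S \<rightarrow> carrier A"
    using part_in[OF x] part_in[OF y] by (auto simp: Pi_iff)
  have "finsum A (part x) {n. part x n \<noteq> \<zero>} = finsum A (part x) ?S"
    by (rule A.finsum_expand_support[OF fin _ cl(1)]) auto
  moreover have "finsum A (part y) {n. part y n \<noteq> \<zero>} = finsum A (part y) ?S"
    by (rule A.finsum_expand_support[OF fin _ cl(2)]) auto
  ultimately have "finsum A (part x) ?S = x" "finsum A (part y) ?S = y"
    using part_sum[OF x] part_sum[OF y] by auto
  then have "finsum A (\<lambda>n. part x n \<oplus> part y n) ?S = x \<oplus> y"
    by (simp only: M.finsum_addf[OF cl])
  then have "part (x \<oplus> y) = (\<lambda>n. part x n \<oplus> part y n)"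
    by (intro part_eqI[OF fin] G_add part_in x y) auto
  then show ?thesis by simp
qed

lemma part_minus:
  assumes x: "x \<in> carrier A" shows "part (\<ominus> x) n = \<ominus> part x n"
proof -
  have "part (\<ominus> x) n \<oplus> part x n = part (\<ominus> x \<oplus> x) n" using x by (simp add: part_add)
  also have "\<dots> = \<zero>" using x by (simp add: M.l_neg)
  finally show ?thesis using x by (intro M.minus_equality[symmetric]) auto
qed

lemma part_finsum:
  assumes "f \<in> S \<rightarrow> carrier A"
  shows "part (finsum A f S) n = finsum A (\<lambda>s. part (f s) n) S"
  using assms
proof (induction S rule: infinite_finite_induct)
  case (insert s S)
  then have "finsum A f S \<in> carrier A" "(\<lambda>s. part (f s) n) \<in> S \<rightarrow> carrier A"
    by (auto intro!: M.finsum_closed part_carrier)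
  then show ?case using insert by (simp add: part_add)
qed auto

lemma decomposition_induct:
  assumes x: "x \<in> carrier A" and "P \<zero>" and P: "\<And>n. P (part x n)"
    and add: "\<And>y z. \<lbrakk> y \<in> carrier A; z \<in> carrier A; P y; P z \<rbrakk> \<Longrightarrow> P (y \<oplus> z)"
  shows "P x"
proof -
  have "finsum A (part x) {n. part x n \<noteq> \<zero>} \<in> {y \<in> carrier A. P y}"
    by (rule A.finsum_in_closed) (use assms finite_part in auto)
  then show ?thesis using part_sum[OF x] by simp
qed

lemma homogeneous_induct [consumes 1, case_names homogeneous add]:
  assumes x: "x \<in> carrier A" and P: "\<And>n y. y \<in> G n \<Longrightarrow> P y"
    and add: "\<And>y z. \<lbrakk> y \<in> carrier A; z \<in> carrier A; P y; P z \<rbrakk> \<Longrightarrow> P (y \<oplus> z)"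
  shows "P x"
  using x P[OF G_zero] P[OF part_in[OF x]] add by (rule decomposition_induct)

lemma part_mult_homogeneous:
  assumes a: "a \<in> G m" and y: "y \<in> carrier A"
  shows "part (a \<otimes> y) n = (if m \<le> n then a \<otimes> part y (n - m) else \<zero>)"
  using y
proof (induction y rule: homogeneous_induct)
  case (homogeneous j y)
  then show ?case
    using part_homogeneous[OF mult_degree[OF a homogeneous]] part_homogeneous[OF homogeneous] a by auto
next
  case (add y z)
  then show ?case using a by (simp add: A.r_distr part_add)
qed

lemma scalar_in_G0: "a \<in> carrier k \<Longrightarrow> a \<odot> \<one> \<in> G 0"
  using G_smult one_degree by auto

lemma smult_eq_mult: "\<lbrakk> a \<in> carrier k; x \<in> carrier A \<rbrakk> \<Longrightarrow> a \<odot> x = (a \<odot> \<one>) \<otimes> x"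
  using smult_mult_left[of a \<one> x] by simp

lemma G0_commute:
  assumes a: "a \<in> G 0" and x: "x \<in> carrier A" shows "a \<otimes> x = x \<otimes> a"
  using x
proof (induction x rule: homogeneous_induct)
  case (homogeneous n y) then show ?case using graded_commute[OF a homogeneous] by simp
next
  case (add y z) then show ?case using a by (simp add: A.l_distr A.r_distr)
qed

lemma mult_commute_up_to_sign:
  assumes "x \<in> G m" "y \<in> G n" shows "x \<otimes> y = y \<otimes> x \<or> x \<otimes> y = \<ominus> (y \<otimes> x)"
  using graded_commute[OF assms] by presburger

lemma subring_G0: "subring (G 0) A"
proof (rule A.subringI)
  show "G 0 \<subseteq> carrier A" by auto
  show "\<one> \<in> G 0" by (rule one_degree)
  fix x y assume "x \<in> G 0" "y \<in> G 0"
  then show "\<ominus> x \<in> G 0" "x \<oplus> y \<in> G 0" "x \<otimes> y \<in> G 0"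
    using G_minus G_add mult_degree[of x 0 y 0] by auto
qed

lemma generated_subalgebra_subring:
  assumes "S \<subseteq> carrier A" shows "subring (generated_subalgebra k A S) A"
  unfolding generated_subalgebra_def using assms by (intro A.generate_ring_is_subring) auto

end

section \<open>Homogeneous ideals satisfy the ascending chain condition\<close>

text \<open>
  Some subsequence is monotone. If it decreases, it is constant from the place on where it takes
  its least value.
\<close>

lemma nondecreasing_subsequence:
  fixes f :: "nat \<Rightarrow> nat"
  shows "\<exists>r :: nat \<Rightarrow> nat. strict_mono r \<and> (\<forall>i j. i \<le> j \<longrightarrow> f (r i) \<le> f (r j))"
proof -
  obtain g :: "nat \<Rightarrow> nat" where g: "strict_mono g" "monoseq (\<lambda>n. f (g n))"
    using seq_monosub[of f] by auto
  then consider "\<forall>m. \<forall>n\<ge>m. f (g m) \<le> f (g n)" | "\<forall>m. \<forall>n\<ge>m. f (g n) \<le> f (g m)"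
    unfolding monoseq_def by auto
  then show ?thesis
  proof cases
    case 1 then show ?thesis using g(1) by auto
  next
    case 2
    define v where "v = (LEAST v. v \<in> range (\<lambda>n. f (g n)))"
    have "v \<in> range (\<lambda>n. f (g n))" unfolding v_def by (rule LeastI_ex) auto
    then obtain N where N: "v = f (g N)" by auto
    have "v \<le> f (g n)" for n unfolding v_def by (rule Least_le) auto
    then have "f (g (N + n)) = v" for n using 2 N by (simp add: order_antisym)
    moreover have "strict_mono (\<lambda>n. g (N + n))" using g(1) by (simp add: strict_mono_def)
    ultimately show ?thesis by (intro exI[of _ "\<lambda>n. g (N + n)"]) auto
  qed
qed

text \<open>
  Dickson's lemma: pass to a subsequence along which the heads do not decrease, and refine it for
  the tails.
\<close>

lemma dickson_subsequence:
  fixes f :: "nat \<Rightarrow> nat list"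
  assumes "\<And>i. length (f i) = s"
  shows "\<exists>r :: nat \<Rightarrow> nat. strict_mono r \<and> (\<forall>i j. i \<le> j \<longrightarrow> list_all2 (\<le>) (f (r i)) (f (r j)))"
  using assms
proof (induction s arbitrary: f)
  case 0
  then show ?case by (intro exI[of _ id]) (auto simp: strict_mono_def)
next
  case (Suc s)
  obtain r :: "nat \<Rightarrow> nat" where r: "strict_mono r" "\<forall>i j. i \<le> j \<longrightarrow> hd (f (r i)) \<le> hd (f (r j))"
    using nondecreasing_subsequence[of "\<lambda>i. hd (f i)"] by blast
  have "length (tl (f (r i))) = s" for i using Suc(2) by simp
  then have "\<exists>q :: nat \<Rightarrow> nat. strict_mono q \<and>
      (\<forall>i j. i \<le> j \<longrightarrow> list_all2 (\<le>) (tl (f (r (q i)))) (tl (f (r (q j)))))"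
    by (rule Suc(1))
  then obtain q :: "nat \<Rightarrow> nat" where q: "strict_mono q"
    "\<forall>i j. i \<le> j \<longrightarrow> list_all2 (\<le>) (tl (f (r (q i)))) (tl (f (r (q j))))" by (elim exE conjE)
  have ne: "f i = hd (f i) # tl (f i)" for i using Suc(2)[of i] by (cases "f i") auto
  show ?case
  proof (intro exI[of _ "r \<circ> q"] conjI allI impI)
    show "strict_mono (r \<circ> q)" using r q by (intro strict_mono_o)
    fix i j :: nat assume "i \<le> j"
    then have "q i \<le> q j" using q(1) by (simp add: strict_mono_less_eq)
    then have "list_all2 (\<le>) (hd (f (r (q i))) # tl (f (r (q i)))) (hd (f (r (q j))) # tl (f (r (q j))))"
      using r(2) q(2) \<open>i \<le> j\<close> by simp
    then show "list_all2 (\<le>) (f ((r \<circ> q) i)) (f ((r \<circ> q) j))"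
      by (simp flip: ne)
  qed
qed

abbreviation lexless :: "(nat list \<times> nat list) set" where "lexless \<equiv> lex less_than"

text \<open>
  The lexicographic order is a monomial order: it is preserved when monomials are multiplied.
\<close>

lemma lexless_add:
  assumes "(a, b) \<in> lexless" "length c = length a"
  shows "(map2 (+) c a, map2 (+) c b) \<in> lexless"
  using assms
proof (induction a arbitrary: b c)
  case (Cons x a)
  obtain y b' where b: "b = y # b'" using Cons.prems by (cases b) auto
  obtain z c' where c: "c = z # c'" using Cons.prems by (cases c) auto
  show ?case using Cons by (auto simp: b c)
qed simp

lemma lexless_length: "(a, b) \<in> lexless \<Longrightarrow> length a = length b"
  by (auto simp: lex_conv)

lemma lexless_trans: "\<lbrakk> (a, b) \<in> lexless; (b, c) \<in> lexless \<rbrakk> \<Longrightarrow> (a, c) \<in> lexless"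
proof (induction a arbitrary: b c)
  case (Cons x a)
  obtain y b' where b: "b = y # b'" using Cons.prems by (cases b) auto
  obtain z c' where c: "c = z # c'" using Cons.prems by (cases c) (auto simp: b)
  show ?case using Cons by (auto simp: b c dest: lexless_length)
qed simp

lemma lexless_total: "length a = length b \<Longrightarrow> a = b \<or> (a, b) \<in> lexless \<or> (b, a) \<in> lexless"
proof (induction a b rule: list_induct2)
  case (Cons x xs y ys) then show ?case using linorder_less_linear[of x y] by auto
qed simp

abbreviation weight :: "nat list \<Rightarrow> nat list \<Rightarrow> nat" where
  "weight ds a \<equiv> sum_list (map2 (*) a ds)"

lemma monomial_eval_simps [simp]:
  "monomial_eval R [] a = \<one>\<^bsub>R\<^esub>" "monomial_eval R (z # zs) (e # a) = (z [^]\<^bsub>R\<^esub> e) \<otimes>\<^bsub>R\<^esub> monomial_eval R zs a"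
  by (auto simp: monomial_eval_def)

lemma (in ring) monomial_eval_closed [simp]:
  "\<lbrakk> length a = length zs; set zs \<subseteq> carrier R \<rbrakk> \<Longrightarrow> monomial_eval R zs a \<in> carrier R"
  by (induction a zs rule: list_induct2) auto

lemma (in ring) monomial_eval_zero: "monomial_eval R zs (replicate (length zs) 0) = \<one>"
  by (induction zs) auto

lemma (in ring) generator_eq_monomial:
  assumes "z \<in> set zs" "set zs \<subseteq> carrier R"
  shows "\<exists>a. length a = length zs \<and> monomial_eval R zs a = z"
  using assms
proof (induction zs)
  case (Cons y zs)
  show ?case
  proof (cases "z = y")
    case True
    then show ?thesis using Cons
      by (intro exI[of _ "1 # replicate (length zs) 0"]) (auto simp: monomial_eval_zero)
  next
    case False
    then obtain a where "length a = length zs" "monomial_eval R zs a = z" using Cons by auto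
    then show ?thesis using Cons by (intro exI[of _ "0 # a"]) auto
  qed
qed simp

context graded_algebra begin

lemma power_degree: "z \<in> G d \<Longrightarrow> z [^] (e::nat) \<in> G (e * d)"
proof (induction e)
  case 0 then show ?case using one_degree by simp
next
  case (Suc e) then show ?case using mult_degree[of "z [^] e" "e * d" z d] by (simp add: add.commute)
qed

abbreviation graded_list :: "'b list \<Rightarrow> nat list \<Rightarrow> bool" where
  "graded_list \<equiv> list_all2 (\<lambda>z d. z \<in> G d)"

lemma graded_list_carrier: "graded_list zs ds \<Longrightarrow> set zs \<subseteq> carrier A"
  by (induction rule: list_all2_induct) auto

lemma monomial_degree:
  assumes "graded_list zs ds" "length a = length zs"
  shows "monomial_eval A zs a \<in> G (weight ds a)"
  using assms
proof (induction zs ds arbitrary: a rule: list_all2_induct)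
  case (Cons z zs d ds)
  then obtain e a' where a: "a = e # a'" by (cases a) auto
  show ?case using Cons mult_degree[OF power_degree[of z d e]] by (auto simp: a)
qed (auto simp: one_degree)

text \<open>
  A power of the first generator of the second factor can be moved past the remaining generators
  of the first factor at the cost of a sign, because all of them are homogeneous.
\<close>

lemma monomial_mult:
  assumes "graded_list zs ds" "length a = length zs" "length b = length zs"
  shows "monomial_eval A zs a \<otimes> monomial_eval A zs b = monomial_eval A zs (map2 (+) a b) \<or>
    monomial_eval A zs a \<otimes> monomial_eval A zs b = \<ominus> monomial_eval A zs (map2 (+) a b)"
  using assms
proof (induction zs ds arbitrary: a b rule: list_all2_induct)
  case (Cons z zs d ds)
  obtain e a' f b' where a: "a = e # a'" and b: "b = f # b'"
    using Cons.prems by (metis length_Suc_conv list.size(4) One_nat_def add.right_neutral add_Suc_right)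
  let ?M = "monomial_eval A zs"
  have M: "?M a' \<in> G (weight ds a')" "?M b' \<in> G (weight ds b')" "?M (map2 (+) a' b') \<in> G (weight ds (map2 (+) a' b'))"
    using Cons by (auto simp: a b intro!: monomial_degree)
  have z: "z \<in> carrier A" using Cons by auto
  have c: "?M a' \<in> carrier A" "?M b' \<in> carrier A" "?M (map2 (+) a' b') \<in> carrier A"
    "z [^] e \<in> carrier A" "z [^] f \<in> carrier A" using M z by auto
  have IH: "?M a' \<otimes> ?M b' = ?M (map2 (+) a' b') \<or> ?M a' \<otimes> ?M b' = \<ominus> ?M (map2 (+) a' b')"
    using Cons by (auto simp: a b)
  have sw: "?M a' \<otimes> z [^] f = z [^] f \<otimes> ?M a' \<or> ?M a' \<otimes> z [^] f = \<ominus> (z [^] f \<otimes> ?M a')"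
    using mult_commute_up_to_sign[OF M(1) power_degree[OF Cons(1)]] .
  have "z [^] e \<otimes> ?M a' \<otimes> (z [^] f \<otimes> ?M b') = z [^] e \<otimes> ((?M a' \<otimes> z [^] f) \<otimes> ?M b')"
    using c by (simp add: A.m_assoc)
  moreover have "z [^] e \<otimes> ((z [^] f \<otimes> ?M a') \<otimes> ?M b') = z [^] (e + f) \<otimes> (?M a' \<otimes> ?M b')"
    using c z by (simp add: A.m_assoc A.nat_pow_mult[symmetric])
  ultimately show ?case using sw IH c z by (auto simp: a b A.l_minus A.r_minus)
qed simp

end

locale noetherian_graded_algebra = connected_noetherian_algebra k A G
  for k :: "('a, 'm) ring_scheme" and A :: "('a, 'b, 'n) module_scheme" (structure)
    and G :: "nat \<Rightarrow> 'b set"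

sublocale noetherian_graded_algebra \<subseteq> graded_algebra by unfold_locales

context noetherian_graded_algebra begin

lemma G0_eq: "G 0 = (\<lambda>a. a \<odot> \<one>) ` carrier k"
  using connected by (auto simp: bij_betw_def)

lemma scalar_nonzero: "\<lbrakk> a \<in> carrier k; a \<noteq> \<zero>\<^bsub>k\<^esub> \<rbrakk> \<Longrightarrow> a \<odot> \<one> \<noteq> \<zero>"
  using connected smult_l_null[OF A.one_closed] by (auto simp: bij_betw_def inj_on_def)

lemma G0_inverse:
  assumes "c \<in> G 0" "c \<noteq> \<zero>" obtains c' where "c' \<in> G 0" "c' \<otimes> c = \<one>"
proof -
  obtain a where a: "a \<in> carrier k" "c = a \<odot> \<one>" using assms G0_eq by auto
  have "a \<noteq> \<zero>\<^bsub>k\<^esub>" using a(2) assms(2) smult_l_null[OF A.one_closed] by metis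
  then have "a \<in> Units k" using a(1) by (simp add: k.field_Units)
  then have i: "inv\<^bsub>k\<^esub> a \<in> carrier k" "inv\<^bsub>k\<^esub> a \<otimes>\<^bsub>k\<^esub> a = \<one>\<^bsub>k\<^esub>"
    by (rule R.Units_inv_closed, rule R.Units_l_inv)
  have "(inv\<^bsub>k\<^esub> a \<odot> \<one>) \<otimes> c = \<one>"
    using a i smult_eq_mult[of "inv\<^bsub>k\<^esub> a" "a \<odot> \<one>"] smult_assoc1[of "inv\<^bsub>k\<^esub> a" a \<one>] by simp
  then show thesis using that[OF scalar_in_G0[OF i(1)]] by simp
qed

text \<open>
  Take the homogeneous components of finitely many algebra generators. Ordered monomials in them
  are closed under multiplication up to sign, so their span over \<open>G 0\<close> is a subring; it contains the
  scalars and the generators.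
\<close>

lemma spanning_monomials_exist:
  obtains zs ds where "graded_list zs ds"
    "carrier A = lspan A (G 0) {monomial_eval A zs a | a. length a = length zs}"
proof -
  obtain S where S: "finite S" "S \<subseteq> carrier A" "generated_subalgebra k A S = carrier A"
    using noetherian unfolding finitely_generated_algebra_def by auto
  have "finite (\<Union>s\<in>S. part s ` {n. part s n \<noteq> \<zero>})" using S finite_part by auto
  from finite_list[OF this]
  obtain zs where zs: "set zs = (\<Union>s\<in>S. part s ` {n. part s n \<noteq> \<zero>})" ..
  define ds where "ds = map (\<lambda>z. SOME d. z \<in> G d) zs"
  have "z \<in> G (SOME d. z \<in> G d)" if "z \<in> set zs" for z
  proof -
    from that zs obtain s n where "s \<in> S" "z = part s n" by auto
    then have "z \<in> G n" using part_in[of s n] S(2) by auto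
    then show ?thesis by (rule someI)
  qed
  then have gl: "graded_list zs ds" unfolding ds_def list_all2_map2 list_all2_same by simp
  note zc = graded_list_carrier[OF gl]
  let ?mons = "{monomial_eval A zs a | a. length a = length zs}"
  let ?M = "lspan A (G 0) ?mons"
  have mc: "?mons \<subseteq> carrier A" using zc by auto
  have G0c: "G 0 \<subseteq> carrier A" by auto
  note Mc = A.lspan_subset_carrier[OF G0c mc]
  note Madd = A.lspan_add[OF G0c mc]
  have Mminus: "\<ominus> x \<in> ?M" if "x \<in> ?M" for x
    by (rule A.lspan_minus[OF G0c mc that G_minus])
  have Msm: "c \<otimes> x \<in> ?M" if "c \<in> G 0" "x \<in> ?M" for c x
    using A.lspan_smult[OF G0c mc that(2)] that(1) subringE(6)[OF subring_G0] by auto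
  have "\<one> \<in> ?mons"
    by (intro CollectI exI[of _ "replicate (length zs) 0"]) (simp add: A.monomial_eval_zero)
  then have one: "\<one> \<in> ?M" by (rule A.lspan_incl[OF G0c mc one_degree])
  have mm: "f \<otimes> g \<in> ?M" if "f \<in> ?mons" "g \<in> ?mons" for f g
  proof -
    from that obtain a b where a: "length a = length zs" "f = monomial_eval A zs a"
      and b: "length b = length zs" "g = monomial_eval A zs b" by auto
    have "monomial_eval A zs (map2 (+) a b) \<in> ?mons" using a b by auto
    then have ab: "monomial_eval A zs (map2 (+) a b) \<in> ?M" by (rule A.lspan_incl[OF G0c mc one_degree])
    show ?thesis using monomial_mult[OF gl a(1) b(1)] Mminus[OF ab] ab unfolding a(2) b(2) by (elim disjE) simp_all
  qed
  have fM: "f \<otimes> y \<in> ?M" if "f \<in> ?mons" "y \<in> ?M" for f y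
    using that(2)
  proof induction
    case zero then show ?case using that(1) mc by (auto intro!: lspan.zero)
  next
    case (step c g t)
    have cc: "c \<in> carrier A" "g \<in> carrier A" "t \<in> carrier A" "f \<in> carrier A"
      using step that(1) mc Mc by auto
    then have "f \<otimes> (c \<otimes> g \<oplus> t) = c \<otimes> (f \<otimes> g) \<oplus> f \<otimes> t"
      using G0_commute[OF step(1), of f] by (simp add: A.r_distr A.m_assoc[symmetric])
    then show ?case using Madd[OF Msm[OF step(1) mm[OF that(1) step(2)]] step(4)] by simp
  qed
  have MM: "x \<otimes> y \<in> ?M" if "x \<in> ?M" "y \<in> ?M" for x y
    using that(1)
  proof induction
    case zero then show ?case using that(2) Mc by (auto intro!: lspan.zero)
  next
    case (step c g t)
    have cc: "c \<in> carrier A" "g \<in> carrier A" "t \<in> carrier A" "y \<in> carrier A"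
      using step that(2) mc Mc by auto
    then have "(c \<otimes> g \<oplus> t) \<otimes> y = c \<otimes> (g \<otimes> y) \<oplus> t \<otimes> y"
      by (simp add: A.l_distr A.m_assoc)
    then show ?case using Madd[OF Msm[OF step(1) fM[OF step(2) that(2)]] step(4)] by simp
  qed
  have sub: "subring ?M A"
    by (rule A.subringI[OF Mc one Mminus MM Madd])
  have zM: "z \<in> ?M" if "z \<in> set zs" for z
  proof -
    have "z \<in> ?mons" using A.generator_eq_monomial[OF that zc] by auto
    then show ?thesis by (rule A.lspan_incl[OF G0c mc one_degree])
  qed
  have SM: "S \<subseteq> ?M"
  proof
    fix s assume s: "s \<in> S"
    then have sc: "s \<in> carrier A" using S(2) by auto
    have "part s n \<in> ?M" if "n \<in> {n. part s n \<noteq> \<zero>}" for n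
      by (rule zM) (use zs s that in auto)
    then have "finsum A (part s) {n. part s n \<noteq> \<zero>} \<in> ?M"
      by (rule A.finsum_in_closed[OF finite_part[OF sc] _ lspan.zero Mc Madd])
    then show "s \<in> ?M" unfolding part_sum[OF sc] .
  qed
  have kM: "(\<lambda>a. a \<odot> \<one>) ` carrier k \<subseteq> ?M"
  proof
    fix c assume c: "c \<in> (\<lambda>a. a \<odot> \<one>) ` carrier k"
    then have "c \<in> G 0" unfolding G0_eq .
    then show "c \<in> ?M" using Msm[OF _ one, of c] by simp
  qed
  have "carrier A \<subseteq> ?M"
    unfolding S(3)[symmetric] generated_subalgebra_def
    by (rule A.generate_ring_min_subring1) (use S(2) sub SM kM in auto)
  with Mc have "carrier A = ?M" by (intro equalityI)
  then show thesis by (rule that[OF gl])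
qed

end

context graded_algebra begin

text \<open>
  A homogeneous left ideal, represented by the family of its components. It is two-sided by graded
  commutativity (\<open>graded_ideal_mult_right\<close>).
\<close>

definition graded_ideal :: "(nat \<Rightarrow> 'b set) \<Rightarrow> bool" where
  "graded_ideal I \<longleftrightarrow> (\<forall>n. I n \<subseteq> G n \<and> \<zero> \<in> I n \<and> (\<forall>x \<in> I n. \<forall>y \<in> I n. x \<oplus> y \<in> I n) \<and>
    (\<forall>m. \<forall>a \<in> G m. \<forall>x \<in> I n. a \<otimes> x \<in> I (m + n)))"

lemma graded_idealI:
  assumes "\<And>n x. x \<in> I n \<Longrightarrow> x \<in> G n" "\<And>n. \<zero> \<in> I n"
    "\<And>n x y. \<lbrakk> x \<in> I n; y \<in> I n \<rbrakk> \<Longrightarrow> x \<oplus> y \<in> I n"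
    "\<And>m n a x. \<lbrakk> a \<in> G m; x \<in> I n \<rbrakk> \<Longrightarrow> a \<otimes> x \<in> I (m + n)"
  shows "graded_ideal I"
  using assms unfolding graded_ideal_def by (intro allI conjI subsetI ballI)

context
  fixes I assumes I: "graded_ideal I"
begin

lemma graded_ideal_sub: "x \<in> I n \<Longrightarrow> x \<in> G n" and graded_ideal_zero: "\<zero> \<in> I n"
  and graded_ideal_add: "\<lbrakk> x \<in> I n; y \<in> I n \<rbrakk> \<Longrightarrow> x \<oplus> y \<in> I n"
  and graded_ideal_mult: "\<lbrakk> a \<in> G m; x \<in> I n \<rbrakk> \<Longrightarrow> a \<otimes> x \<in> I (m + n)"
  using I unfolding graded_ideal_def by auto

lemma graded_ideal_carrier: "x \<in> I n \<Longrightarrow> x \<in> carrier A"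
  using graded_ideal_sub G_carrier by blast

lemma graded_ideal_minus: "x \<in> I n \<Longrightarrow> \<ominus> x \<in> I n"
  using graded_ideal_mult[OF G_minus[OF one_degree], of x n] graded_ideal_carrier[of x n] by (simp add: A.l_minus)

lemma graded_ideal_scale: "\<lbrakk> c \<in> G 0; x \<in> I n \<rbrakk> \<Longrightarrow> c \<otimes> x \<in> I n"
  using graded_ideal_mult[of c 0 x n] by simp

lemma graded_ideal_mult_right:
  assumes x: "x \<in> I n" and a: "a \<in> G m" shows "x \<otimes> a \<in> I (n + m)"
  using mult_commute_up_to_sign[OF graded_ideal_sub[OF x] a] graded_ideal_mult[OF a x]
    graded_ideal_minus[OF graded_ideal_mult[OF a x]] by (auto simp: add.commute)

end

context
  fixes zs :: "'b list" and ds :: "nat list"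
  assumes gl: "graded_list zs ds"
begin

abbreviation (input) "mono_of \<equiv> monomial_eval A zs"

definition homogeneous_span :: "nat \<Rightarrow> (nat list \<Rightarrow> bool) \<Rightarrow> 'b set" where
  "homogeneous_span n P = lspan A (G 0) {mono_of b | b. length b = length zs \<and> weight ds b = n \<and> P b}"

abbreviation (input) "below a \<equiv> homogeneous_span (weight ds a) (\<lambda>b. (b, a) \<in> lexless)"
abbreviation (input) "atmost a \<equiv> homogeneous_span (weight ds a) (\<lambda>b. b = a \<or> (b, a) \<in> lexless)"

text \<open>
  The exponents of leading monomials, as in the theory of Groebner bases. The monomials only span
  \<open>A\<close> and may be linearly dependent, so an exponent counts as leading if some combination of smaller monomials
  completes its monomial to an element of \<open>I\<close>.
\<close>

definition leading :: "(nat \<Rightarrow> 'b set) \<Rightarrow> nat list set" where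
  "leading I = {a. length a = length zs \<and> (\<exists>t \<in> below a. mono_of a \<oplus> t \<in> I (weight ds a))}"

lemma mono_G: "length a = length zs \<Longrightarrow> mono_of a \<in> G (weight ds a)"
  by (rule monomial_degree[OF gl])

lemma mono_carrier: "length a = length zs \<Longrightarrow> mono_of a \<in> carrier A"
  using mono_G G_carrier by blast

lemma G0_carrier: "G 0 \<subseteq> carrier A" by (rule G_subset)

lemma span_gens: "{mono_of b | b. length b = length zs \<and> weight ds b = n \<and> P b} \<subseteq> carrier A"
  using mono_carrier by auto

lemma span_carrier: "x \<in> homogeneous_span n P \<Longrightarrow> x \<in> carrier A"
  using A.lspan_subset_carrier[OF G0_carrier span_gens] unfolding homogeneous_span_def by blast

lemma span_zero: "\<zero> \<in> homogeneous_span n P"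
  unfolding homogeneous_span_def by (rule lspan.zero)

lemma span_add: "\<lbrakk> x \<in> homogeneous_span n P; y \<in> homogeneous_span n P \<rbrakk> \<Longrightarrow> x \<oplus> y \<in> homogeneous_span n P"
  unfolding homogeneous_span_def by (rule A.lspan_add[OF G0_carrier span_gens])

lemma span_minus: "x \<in> homogeneous_span n P \<Longrightarrow> \<ominus> x \<in> homogeneous_span n P"
  unfolding homogeneous_span_def by (rule A.lspan_minus[OF G0_carrier span_gens _ G_minus])

lemma span_scale: "\<lbrakk> c \<in> G 0; x \<in> homogeneous_span n P \<rbrakk> \<Longrightarrow> c \<otimes> x \<in> homogeneous_span n P"
  unfolding homogeneous_span_def
  by (rule A.lspan_smult[OF G0_carrier span_gens _ _ subringE(6)[OF subring_G0]]) auto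

lemma span_mono_of:
  assumes "length b = length zs" "weight ds b = n" "P b" shows "mono_of b \<in> homogeneous_span n P"
  unfolding homogeneous_span_def
  by (rule A.lspan_incl[OF G0_carrier span_gens one_degree]) (use assms in auto)

lemma span_induct [consumes 1, case_names zero step]:
  assumes "x \<in> homogeneous_span n P" and "Q \<zero>"
    and "\<And>c b t. \<lbrakk> c \<in> G 0; length b = length zs; weight ds b = n; P b; t \<in> homogeneous_span n P; Q t \<rbrakk>
      \<Longrightarrow> Q (c \<otimes> mono_of b \<oplus> t)"
  shows "Q x"
  using assms(1) unfolding homogeneous_span_def
proof induction
  case zero then show ?case by (rule assms(2))
next
  case (step c f t)
  then obtain b where "length b = length zs" "weight ds b = n" "P b" "f = mono_of b" by auto
  then show ?case using assms(3)[of c b t] step by (simp add: homogeneous_span_def)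
qed

lemma span_weaken:
  assumes "\<And>b. P b \<Longrightarrow> Q b" "x \<in> homogeneous_span n P" shows "x \<in> homogeneous_span n Q"
  using assms(2) lspan_mono[of "G 0" "G 0" "{mono_of b | b. length b = length zs \<and> weight ds b = n \<and> P b}"
      "{mono_of b | b. length b = length zs \<and> weight ds b = n \<and> Q b}"] assms(1)
  unfolding homogeneous_span_def by blast

lemma weight_add: "length a = length b \<Longrightarrow> weight ds (map2 (+) a b) = weight ds a + weight ds b"
proof (induction a b arbitrary: ds rule: list_induct2)
  case (Cons x xs y ys) then show ?case by (cases ds) (auto simp: algebra_simps)
qed simp

lemma mono_mult_below:
  assumes c: "length c = length zs" and a: "length a = length zs" and t: "t \<in> below a"
  shows "mono_of c \<otimes> t \<in> below (map2 (+) c a)"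
  using t
proof (induction t rule: span_induct)
  case zero then show ?case using mono_carrier[OF c] span_zero by simp
next
  case (step g b t)
  note cc = mono_carrier[OF c] mono_carrier[OF step(2)] span_carrier[OF step(5)] G_carrier[OF step(1)]
  have "mono_of c \<otimes> (g \<otimes> mono_of b \<oplus> t) = g \<otimes> (mono_of c \<otimes> mono_of b) \<oplus> mono_of c \<otimes> t"
    using cc G0_commute[OF step(1) cc(1)] by (simp add: A.r_distr A.m_assoc[symmetric])
  moreover have "mono_of (map2 (+) c b) \<in> below (map2 (+) c a)"
    by (rule span_mono_of)
      (use c a step weight_add[of c a] weight_add[of c b] lexless_add[of b a c] in auto)
  then have "mono_of c \<otimes> mono_of b \<in> below (map2 (+) c a)"
    using monomial_mult[OF gl c step(2)] span_minus by auto
  ultimately show ?case using span_add[OF span_scale[OF step(1)] step(6)] by simp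
qed

text \<open>
  Multiply the element of \<open>I\<close> that witnesses \<open>a\<close> by the monomial with exponent \<open>b - a\<close>. Smaller terms
  remain smaller, and a sign is absorbed by negation.
\<close>

lemma leading_upward_closed:
  assumes I: "graded_ideal I" and a: "a \<in> leading I" and b: "length b = length zs" "list_all2 (\<le>) a b"
  shows "b \<in> leading I"
proof -
  obtain t where la: "length a = length zs" and t: "t \<in> below a" "mono_of a \<oplus> t \<in> I (weight ds a)"
    using a unfolding leading_def by auto
  \<comment> \<open>Truncated subtraction is harmless because \<open>a\<close> is componentwise below \<open>b\<close>.\<close>
  define c where "c = map2 (-) b a"
  have c: "length c = length zs" using la b by (simp add: c_def)
  have ca: "map2 (+) c a = b" using b(2) unfolding c_def
    by (induction a b rule: list_all2_induct) auto
  note cc = mono_carrier[OF c] mono_carrier[OF la] span_carrier[OF t(1)] mono_carrier[OF b(1)]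
  have u: "mono_of c \<otimes> t \<in> below b" using mono_mult_below[OF c la t(1)] by (simp add: ca)
  have "mono_of c \<otimes> (mono_of a \<oplus> t) \<in> I (weight ds b)"
    using graded_ideal_mult[OF I mono_G[OF c] t(2)] weight_add[of c a] c la by (simp add: ca)
  then have sum: "mono_of c \<otimes> mono_of a \<oplus> mono_of c \<otimes> t \<in> I (weight ds b)"
    using cc by (simp add: A.r_distr)
  from monomial_mult[OF gl c la]
  consider "mono_of c \<otimes> mono_of a = mono_of b" | "mono_of c \<otimes> mono_of a = \<ominus> mono_of b" by (auto simp: ca)
  then have "\<exists>s \<in> below b. mono_of b \<oplus> s \<in> I (weight ds b)"
  proof cases
    case 1 then show ?thesis using u sum by auto
  next
    case 2
    then have "\<ominus> (\<ominus> mono_of b \<oplus> mono_of c \<otimes> t) \<in> I (weight ds b)"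
      using graded_ideal_minus[OF I] sum by simp
    then have "mono_of b \<oplus> \<ominus> (mono_of c \<otimes> t) \<in> I (weight ds b)"
      using cc by (simp add: M.minus_add)
    then show ?thesis using span_minus[OF u] by auto
  qed
  then show ?thesis using b(1) unfolding leading_def by auto
qed

lemma upto_cases:
  assumes a: "length a = length zs" and "x \<in> atmost a"
  shows "\<exists>c \<in> G 0. \<exists>t \<in> below a. x = c \<otimes> mono_of a \<oplus> t"
  using assms(2)
proof (induction x rule: span_induct)
  case zero
  show ?case using mono_carrier[OF a]
    by (intro bexI[of _ \<zero>] bexI[OF _ G_zero] bexI[OF _ span_zero]) auto
next
  case (step g b t)
  then obtain c u where cu: "c \<in> G 0" "u \<in> below a" "t = c \<otimes> mono_of a \<oplus> u" by auto
  note cc = mono_carrier[OF a] mono_carrier[OF step(2)] span_carrier[OF cu(2)] G_carrier[OF step(1)] G_carrier[OF cu(1)]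
  show ?case
  proof (cases "b = a")
    case True
    have "g \<otimes> mono_of b \<oplus> t = (g \<oplus> c) \<otimes> mono_of a \<oplus> u"
      using cc unfolding True cu(3) by (simp add: A.l_distr M.a_assoc)
    then show ?thesis using G_add[OF step(1) cu(1)] cu(2) by blast
  next
    case False
    have "g \<otimes> mono_of b \<oplus> t = c \<otimes> mono_of a \<oplus> (g \<otimes> mono_of b \<oplus> u)"
      using cc unfolding cu(3) by (simp add: M.a_ac)
    moreover have "g \<otimes> mono_of b \<oplus> u \<in> below a"
      using False step by (intro span_add span_scale span_mono_of cu) auto
    ultimately show ?thesis using cu(1) by blast
  qed
qed

text \<open>
  The lexicographic order is total on exponents of the same length, so a combination has a largest
  term.
\<close>

lemma span_in_upto:
  assumes "x \<in> homogeneous_span n P"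
  shows "x = \<zero> \<or> (\<exists>a. length a = length zs \<and> weight ds a = n \<and> P a \<and> x \<in> atmost a)"
  using assms
proof (induction x rule: span_induct)
  case (step g b t)
  have gb: "g \<otimes> mono_of b \<in> atmost b" using step by (intro span_scale span_mono_of) auto
  from step(6) show ?case
  proof
    assume "t = \<zero>"
    then show ?thesis using step gb mono_carrier[OF step(2)] by auto
  next
    assume "\<exists>a. length a = length zs \<and> weight ds a = n \<and> P a \<and> t \<in> atmost a"
    then obtain a where a: "length a = length zs" "weight ds a = n" "P a" "t \<in> atmost a" by auto
    from a(1) step(2) consider "a = b \<or> (b, a) \<in> lexless" | "(a, b) \<in> lexless"
      using lexless_total[of a b] by auto
    then show ?thesis
    proof cases
      case 1
      then have "g \<otimes> mono_of b \<in> atmost a"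
        using step a(2) by (intro span_scale span_mono_of) auto
      then show ?thesis using a span_add by blast
    next
      case 2
      have "t \<in> homogeneous_span n (\<lambda>c. c = b \<or> (c, b) \<in> lexless)"
        by (rule span_weaken[of "\<lambda>c. c = a \<or> (c, a) \<in> lexless"])
          (use 2 a lexless_trans in auto)
      then have "g \<otimes> mono_of b \<oplus> t \<in> atmost b"
        using span_add[OF gb] step(3) by simp
      then show ?thesis using step by blast
    qed
  qed
qed auto

end

end

context noetherian_graded_algebra begin

context
  fixes zs :: "'b list" and ds :: "nat list"
  assumes gl: "graded_list zs ds"
    and span: "carrier A = lspan A (G 0) {monomial_eval A zs a | a. length a = length zs}"
begin

lemma component_spanned:
  assumes y: "y \<in> G n" shows "y \<in> homogeneous_span zs ds n (\<lambda>_. True)"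
proof -
  let ?H = "homogeneous_span zs ds n (\<lambda>_. True)"
  have "y \<in> lspan A (G 0) {monomial_eval A zs a | a. length a = length zs}"
    using y span G_carrier by auto
  then have "y \<in> carrier A \<and> part y n \<in> ?H"
  proof induction
    case zero then show ?case using span_zero[OF gl] by simp
  next
    case (step c f t)
    then obtain a where a: "f = monomial_eval A zs a" "length a = length zs" by auto
    note fG = mono_G[OF gl a(2), folded a(1)]
    have cf: "c \<otimes> f \<in> G (weight ds a)" using mult_degree[OF step(1) fG] by simp
    have "part (c \<otimes> f) n \<in> ?H"
      using part_homogeneous[OF cf, of n] span_zero[OF gl] span_scale[OF gl step(1) span_mono_of[OF gl a(2)]]
      by (auto simp: a(1))
    then show ?case using step part_add[of "c \<otimes> f" t n] G_carrier[OF cf] span_add[OF gl] by auto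
  qed
  then show ?thesis using part_homogeneous[OF y, of n] by simp
qed

text \<open>
  Division with remainder: if the leading monomial of an element of \<open>J\<close> is also leading for \<open>I\<close>,
  subtract a multiple of an element of \<open>I\<close>. The remainder lies in \<open>J\<close> and below, and the order is
  well-founded.
\<close>

lemma leading_determines:
  assumes I: "graded_ideal I" and J: "graded_ideal J" and IJ: "\<And>n. I n \<subseteq> J n"
    and lead: "leading zs ds J \<subseteq> leading zs ds I"
  shows "J n \<subseteq> I n"
proof -
  let ?m = "monomial_eval A zs"
  let ?up = "\<lambda>a. homogeneous_span zs ds (weight ds a) (\<lambda>b. b = a \<or> (b, a) \<in> lexless)"
  let ?below = "\<lambda>a. homogeneous_span zs ds (weight ds a) (\<lambda>b. (b, a) \<in> lexless)"
  have main: "\<forall>x \<in> ?up a \<inter> J (weight ds a). x \<in> I (weight ds a)" if "length a = length zs" for a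
    using that
  proof (induction a rule: wf_induct_rule[OF wf_lex[OF wf_less_than]])
    case (1 a)
    have low: "u \<in> I (weight ds a)" if "u \<in> ?below a" "u \<in> J (weight ds a)" for u
    proof (cases "u = \<zero>")
      case True then show ?thesis using graded_ideal_zero[OF I] by simp
    next
      case False
      then obtain b where b: "length b = length zs" "weight ds b = weight ds a" "(b, a) \<in> lexless" "u \<in> ?up b"
        using span_in_upto[OF gl \<open>u \<in> ?below a\<close>] by auto
      then show ?thesis using 1(1)[OF b(3,1)] that(2) by simp
    qed
    show ?case
    proof
      fix x assume x: "x \<in> ?up a \<inter> J (weight ds a)"
      then obtain c t where ct: "c \<in> G 0" "t \<in> ?below a" "x = c \<otimes> ?m a \<oplus> t"
        using upto_cases[OF gl 1(2), of x] by auto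
      note ma = mono_carrier[OF gl 1(2)] and tc = span_carrier[OF gl ct(2)] and cc = G_carrier[OF ct(1)]
      show "x \<in> I (weight ds a)"
      proof (cases "c = \<zero>")
        case True
        then have "x = t" using ct(3) ma tc by simp
        then show ?thesis using low ct(2) x by auto
      next
        case False
        then obtain c' where c': "c' \<in> G 0" "c' \<otimes> c = \<one>" using G0_inverse ct(1) by blast
        have "c' \<otimes> x = ?m a \<oplus> c' \<otimes> t"
          using c' G_carrier[OF c'(1)] ma tc cc unfolding ct(3)
          by (simp add: A.r_distr A.m_assoc[symmetric])
        moreover have "c' \<otimes> x \<in> J (weight ds a)" using graded_ideal_scale[OF J c'(1)] x by auto
        ultimately have "a \<in> leading zs ds J"
          unfolding leading_def[OF gl] using 1(2) span_scale[OF gl c'(1) ct(2)] by auto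
        then have "a \<in> leading zs ds I" using lead by auto
        then obtain u where u: "u \<in> ?below a" "?m a \<oplus> u \<in> I (weight ds a)"
          unfolding leading_def[OF gl] by auto
        note uc = span_carrier[OF gl u(1)]
        have cI: "c \<otimes> (?m a \<oplus> u) \<in> I (weight ds a)" by (rule graded_ideal_scale[OF I ct(1) u(2)])
        let ?v = "t \<oplus> \<ominus> (c \<otimes> u)"
        have xv: "x = c \<otimes> (?m a \<oplus> u) \<oplus> ?v"
          unfolding ct(3) using ma tc cc uc
          by (simp add: A.r_distr M.a_ac M.r_neg2 M.r_neg1 M.r_neg M.l_neg)
        have vc: "?v \<in> carrier A" "c \<otimes> (?m a \<oplus> u) \<in> carrier A" using ma tc cc uc by auto
        have "?v = x \<oplus> \<ominus> (c \<otimes> (?m a \<oplus> u))"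
          unfolding xv using vc by (simp add: M.a_ac M.r_neg2 M.r_neg1 M.r_neg M.l_neg)
        moreover have "x \<oplus> \<ominus> (c \<otimes> (?m a \<oplus> u)) \<in> J (weight ds a)"
          using graded_ideal_add[OF J] graded_ideal_minus[OF J] x cI IJ by blast
        ultimately have "?v \<in> J (weight ds a)" by simp
        moreover have "?v \<in> ?below a"
          by (intro span_add[OF gl] span_minus[OF gl] span_scale[OF gl] ct u)
        ultimately have "?v \<in> I (weight ds a)" by (rule low[rotated])
        then show ?thesis using xv graded_ideal_add[OF I cI] by simp
      qed
    qed
  qed
  show ?thesis
  proof
    fix x assume x: "x \<in> J n"
    show "x \<in> I n"
      using span_in_upto[OF gl component_spanned[OF graded_ideal_sub[OF J x]]]
    proof
      assume "x = \<zero>" then show ?thesis using graded_ideal_zero[OF I] by simp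
    next
      assume "\<exists>a. length a = length zs \<and> weight ds a = n \<and> True \<and> x \<in> ?up a"
      then show ?thesis using main x by blast
    qed
  qed
qed

end

text \<open>
  Each step of a strictly ascending chain contributes a new leading exponent. By Dickson's lemma one
  of these exponents lies above an earlier one, so it was not new.
\<close>

lemma wf_graded_ideals: "wf {(J, I). graded_ideal I \<and> graded_ideal J \<and> I < J}"
proof -
  obtain zs ds where gl: "graded_list zs ds"
    and span: "carrier A = lspan A (G 0) {monomial_eval A zs a | a. length a = length zs}"
    by (rule spanning_monomials_exist)
  show ?thesis
    unfolding wf_iff_no_infinite_down_chain
  proof
    assume "\<exists>f. \<forall>i. (f (Suc i), f i) \<in> {(J, I). graded_ideal I \<and> graded_ideal J \<and> I < J}"
    then obtain f where f: "graded_ideal (f i)" "f i < f (Suc i)" for i by auto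
    have mono: "f i \<le> f j" if "i \<le> j" for i j
      using lift_Suc_mono_le[of f, OF less_imp_le[OF f(2)] that] .
    have "\<exists>a. a \<in> leading zs ds (f (Suc i)) \<and> a \<notin> leading zs ds (f i)" for i
    proof (rule ccontr)
      assume "\<nexists>a. a \<in> leading zs ds (f (Suc i)) \<and> a \<notin> leading zs ds (f i)"
      then have sub: "leading zs ds (f (Suc i)) \<subseteq> leading zs ds (f i)" by blast
      have le: "f i n \<subseteq> f (Suc i) n" for n using le_funD[OF mono[of i "Suc i"]] by simp
      have "f (Suc i) n \<subseteq> f i n" for n
        by (rule leading_determines[OF gl span f(1) f(1) le sub])
      then have "f (Suc i) \<le> f i" by (rule le_funI)
      then show False using f(2)[of i] by simp
    qed
    then obtain a where a: "a i \<in> leading zs ds (f (Suc i))" "a i \<notin> leading zs ds (f i)" for i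
      by metis
    have len: "length (a i) = length zs" for i using a(1)[of i] unfolding leading_def[OF gl] by simp
    from dickson_subsequence[of a, OF len] obtain r :: "nat \<Rightarrow> nat" where
      r: "strict_mono r" "\<forall>i j. i \<le> j \<longrightarrow> list_all2 (\<le>) (a (r i)) (a (r j))" by blast
    have r01: "Suc (r 0) \<le> r 1" using r(1) by (simp add: strict_mono_def Suc_le_eq)
    have "leading zs ds (f (Suc (r 0))) \<subseteq> leading zs ds (f (r 1))"
      using mono[OF r01] unfolding leading_def[OF gl] le_fun_def by blast
    then have "a (r 1) \<in> leading zs ds (f (r 1))"
      using leading_upward_closed[OF gl f(1) _ len[of "r 1"], of "a (r 0)" "r 1"] a(1)[of "r 0"] r(2) by auto
    then show False using a(2) by simp
  qed
qed

end

section \<open>Filter-regular elements over an infinite field\<close>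

context graded_algebra begin

text \<open>
  The coefficients that carry degree \<open>m\<close> to degree \<open>n\<close>; there are no negative degrees, so only zero
  remains if \<open>n < m\<close>.
\<close>

definition gap :: "nat \<Rightarrow> nat \<Rightarrow> 'b set" where
  "gap m n = (if m \<le> n then G (n - m) else {\<zero>})"

lemma gap_zero: "\<zero> \<in> gap m n"
  using G_zero by (simp add: gap_def)

lemma gap_add: "\<lbrakk> a \<in> gap m n; b \<in> gap m n \<rbrakk> \<Longrightarrow> a \<oplus> b \<in> gap m n"
  using G_add by (auto simp: gap_def split: if_splits)

lemma gap_carrier: "a \<in> gap m n \<Longrightarrow> a \<in> carrier A"
  using G_carrier by (auto simp: gap_def split: if_splits)

lemma gap_mult:
  assumes b: "b \<in> G p" and a: "a \<in> gap m n" shows "b \<otimes> a \<in> gap m (p + n)"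
proof (cases "m \<le> n")
  case True
  then show ?thesis using mult_degree[OF b, of a "n - m"] a by (simp add: gap_def)
next
  case False
  then show ?thesis using a b gap_zero by (simp add: gap_def)
qed

lemma gap_mult_degree:
  assumes a: "a \<in> gap m n" and y: "y \<in> G m" shows "a \<otimes> y \<in> G n"
proof (cases "m \<le> n")
  case True
  then show ?thesis using mult_degree[of a "n - m" y m] a y by (simp add: gap_def)
next
  case False
  then show ?thesis using a y G_zero by (simp add: gap_def)
qed

text \<open>
  The ideal \<open>I + Ay\<close>.
\<close>

definition ideal_plus :: "(nat \<Rightarrow> 'b set) \<Rightarrow> nat \<Rightarrow> 'b \<Rightarrow> nat \<Rightarrow> 'b set" where
  "ideal_plus I m y n = {j \<oplus> a \<otimes> y | j a. j \<in> I n \<and> a \<in> gap m n}"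

text \<open>
  The ideal \<open>I : y\<close>.
\<close>

definition ideal_colon :: "(nat \<Rightarrow> 'b set) \<Rightarrow> nat \<Rightarrow> 'b \<Rightarrow> nat \<Rightarrow> 'b set" where
  "ideal_colon I m y n = {z \<in> G n. z \<otimes> y \<in> I (n + m)}"

lemma ideal_plusI: "\<lbrakk> j \<in> I n; a \<in> gap m n; x = j \<oplus> a \<otimes> y \<rbrakk> \<Longrightarrow> x \<in> ideal_plus I m y n"
  unfolding ideal_plus_def by auto

lemma ideal_plusE:
  assumes "x \<in> ideal_plus I m y n"
  obtains j a where "j \<in> I n" "a \<in> gap m n" "x = j \<oplus> a \<otimes> y"
  using assms unfolding ideal_plus_def by auto

context
  fixes I m y assumes I: "graded_ideal I" and y: "y \<in> G m"
begin

lemma ideal_plus_contains: "x \<in> I n \<Longrightarrow> x \<in> ideal_plus I m y n"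
  using graded_ideal_carrier[OF I, of x n] y gap_zero by (intro ideal_plusI[of x I n \<zero>]) auto

lemma graded_ideal_plus: "graded_ideal (ideal_plus I m y)"
proof (rule graded_idealI)
  have yc: "y \<in> carrier A" using y by (rule G_carrier)
  note Ic = graded_ideal_carrier[OF I]
  fix n
  show "\<zero> \<in> ideal_plus I m y n" by (rule ideal_plus_contains[OF graded_ideal_zero[OF I]])
  fix x assume "x \<in> ideal_plus I m y n"
  then obtain j a where x: "j \<in> I n" "a \<in> gap m n" "x = j \<oplus> a \<otimes> y" by (rule ideal_plusE)
  note c = Ic[OF x(1)] gap_carrier[OF x(2)]
  show "x \<in> G n" unfolding x(3) by (rule G_add[OF graded_ideal_sub[OF I x(1)] gap_mult_degree[OF x(2) y]])
  show "b \<otimes> x \<in> ideal_plus I m y (p + n)" if b: "b \<in> G p" for b p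
    by (rule ideal_plusI[where I=I and n="p + n" and m=m, OF graded_ideal_mult[OF I b x(1)] gap_mult[OF b x(2)]])
      (use c yc G_carrier[OF b] in \<open>simp add: x(3) A.r_distr A.m_assoc\<close>)
  fix x' assume "x' \<in> ideal_plus I m y n"
  then obtain j' a' where x': "j' \<in> I n" "a' \<in> gap m n" "x' = j' \<oplus> a' \<otimes> y" by (rule ideal_plusE)
  note c' = Ic[OF x'(1)] gap_carrier[OF x'(2)]
  show "x \<oplus> x' \<in> ideal_plus I m y n"
    by (rule ideal_plusI[where I=I and n=n and m=m, OF graded_ideal_add[OF I x(1) x'(1)] gap_add[OF x(2) x'(2)]])
      (use c c' yc in \<open>simp add: x(3) x'(3) A.l_distr M.a_ac\<close>)
qed

lemma ideal_colon_contains: "x \<in> I n \<Longrightarrow> x \<in> ideal_colon I m y n"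
  using graded_ideal_sub[OF I, of x n] graded_ideal_mult_right[OF I _ y, of x n] by (simp add: ideal_colon_def)

lemma graded_ideal_colon: "graded_ideal (ideal_colon I m y)"
proof (rule graded_idealI)
  have yc: "y \<in> carrier A" using y by (rule G_carrier)
  fix n
  show "\<zero> \<in> ideal_colon I m y n" by (rule ideal_colon_contains[OF graded_ideal_zero[OF I]])
  fix x assume "x \<in> ideal_colon I m y n"
  then have x: "x \<in> G n" "x \<otimes> y \<in> I (n + m)" by (auto simp: ideal_colon_def)
  show "x \<in> G n" by fact
  show "b \<otimes> x \<in> ideal_colon I m y (p + n)" if b: "b \<in> G p" for b p
    using graded_ideal_mult[OF I b x(2)] mult_degree[OF b x(1)] G_carrier[OF b] G_carrier[OF x(1)] yc
    by (simp add: ideal_colon_def A.m_assoc add.assoc)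
  fix x' assume "x' \<in> ideal_colon I m y n"
  then have x': "x' \<in> G n" "x' \<otimes> y \<in> I (n + m)" by (auto simp: ideal_colon_def)
  show "x \<oplus> x' \<in> ideal_colon I m y n"
    using G_add[OF x(1) x'(1)] graded_ideal_add[OF I x(2) x'(2)] G_carrier[OF x(1)] G_carrier[OF x'(1)] yc
    by (simp add: ideal_colon_def A.l_distr)
qed

end

text \<open>
  The quotient \<open>A/I\<close> has bounded degree.
\<close>

definition cofinite_ideal :: "(nat \<Rightarrow> 'b set) \<Rightarrow> bool" where
  "cofinite_ideal I \<longleftrightarrow> (\<exists>N. \<forall>n > N. G n \<subseteq> I n)"

text \<open>
  The annihilator of \<open>x\<close> in \<open>A/I\<close> has bounded degree.
\<close>

definition eventually_regular :: "nat \<Rightarrow> 'b \<Rightarrow> (nat \<Rightarrow> 'b set) \<Rightarrow> bool" where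
  "eventually_regular d x I \<longleftrightarrow> (\<exists>N. \<forall>n > N. \<forall>u \<in> G n. x \<otimes> u \<in> I (d + n) \<longrightarrow> u \<in> I n)"

text \<open>
  In the exact sequence \<open>0 \<rightarrow> A/(I : y) \<rightarrow> A/I \<rightarrow> A/(I + Ay) \<rightarrow> 0\<close>, whose first map is multiplication by
  \<open>y\<close>, the outer terms have bounded degree.
\<close>

lemma cofinite_ideal_split:
  assumes I: "graded_ideal I" and y: "y \<in> G m"
    and plus: "cofinite_ideal (ideal_plus I m y)" and colon: "cofinite_ideal (ideal_colon I m y)"
  shows "cofinite_ideal I"
proof -
  obtain N1 where N1: "\<And>n. n > N1 \<Longrightarrow> G n \<subseteq> ideal_plus I m y n"
    using plus unfolding cofinite_ideal_def by auto
  obtain N2 where N2: "\<And>n. n > N2 \<Longrightarrow> G n \<subseteq> ideal_colon I m y n"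
    using colon unfolding cofinite_ideal_def by auto
  have "u \<in> I n" if n: "n > N1 + N2 + m" and u: "u \<in> G n" for n u
  proof -
    have "u \<in> ideal_plus I m y n" using N1[of n] n u by auto
    then obtain j a where ja: "j \<in> I n" "a \<in> gap m n" "u = j \<oplus> a \<otimes> y" by (rule ideal_plusE)
    then have "a \<in> G (n - m)" using n by (simp add: gap_def)
    moreover have "n - m > N2" using n by simp
    ultimately have "a \<in> ideal_colon I m y (n - m)" using N2 by blast
    then have "a \<otimes> y \<in> I n" using n by (simp add: ideal_colon_def)
    then show ?thesis unfolding ja(3) by (rule graded_ideal_add[OF I ja(1)])
  qed
  then show ?thesis unfolding cofinite_ideal_def by blast
qed

text \<open>
  In the exact sequence \<open>0 \<rightarrow> A/(I : y) \<rightarrow> A/I \<rightarrow> A/(I + Ay) \<rightarrow> 0\<close> multiplication by \<open>x\<close> is injective in large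
  degrees on the outer terms, hence on the middle one.
\<close>

lemma eventually_regular_split:
  assumes I: "graded_ideal I" and y: "y \<in> G m" and x: "x \<in> G d"
    and plus: "eventually_regular d x (ideal_plus I m y)"
    and colon: "eventually_regular d x (ideal_colon I m y)"
  shows "eventually_regular d x I"
proof -
  have xc: "x \<in> carrier A" and yc: "y \<in> carrier A" using x y by auto
  obtain N1 where N1: "\<And>n u. \<lbrakk> n > N1; u \<in> G n; x \<otimes> u \<in> ideal_plus I m y (d + n) \<rbrakk> \<Longrightarrow> u \<in> ideal_plus I m y n"
    using plus unfolding eventually_regular_def by auto
  obtain N2 where N2: "\<And>n u. \<lbrakk> n > N2; u \<in> G n; x \<otimes> u \<in> ideal_colon I m y (d + n) \<rbrakk> \<Longrightarrow> u \<in> ideal_colon I m y n"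
    using colon unfolding eventually_regular_def by auto
  have "u \<in> I n" if n: "n > N1 + N2 + m" and u: "u \<in> G n" and xu: "x \<otimes> u \<in> I (d + n)" for n u
  proof -
    have "u \<in> ideal_plus I m y n" using N1[OF _ u ideal_plus_contains[OF I y xu]] n by simp
    then obtain j a where ja: "j \<in> I n" "a \<in> gap m n" "u = j \<oplus> a \<otimes> y" by (rule ideal_plusE)
    then have a: "a \<in> G (n - m)" using n by (simp add: gap_def)
    note c = graded_ideal_carrier[OF I ja(1)] G_carrier[OF a] xc yc
    have "x \<otimes> u \<oplus> \<ominus> (x \<otimes> j) \<in> I (d + n)"
      by (rule graded_ideal_add[OF I xu graded_ideal_minus[OF I graded_ideal_mult[OF I x ja(1)]]])
    moreover have "x \<otimes> u \<oplus> \<ominus> (x \<otimes> j) = (x \<otimes> a) \<otimes> y"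
      unfolding ja(3) using c by (simp add: A.r_distr A.m_assoc M.a_ac M.r_neg2 M.r_neg1 M.r_neg M.l_neg)
    ultimately have "x \<otimes> a \<in> ideal_colon I m y (d + (n - m))"
      using mult_degree[OF x a] n by (simp add: ideal_colon_def)
    moreover have "n - m > N2" using n by simp
    ultimately have "a \<in> ideal_colon I m y (n - m)" using N2[OF _ a] by blast
    then have "a \<otimes> y \<in> I n" using n by (simp add: ideal_colon_def)
    then show ?thesis unfolding ja(3) by (rule graded_ideal_add[OF I ja(1)])
  qed
  then show ?thesis unfolding eventually_regular_def by blast
qed

definition prime_ideal :: "(nat \<Rightarrow> 'b set) \<Rightarrow> bool" where
  "prime_ideal I \<longleftrightarrow> (\<forall>m n. \<forall>x \<in> G m. \<forall>y \<in> G n. x \<otimes> y \<in> I (m + n) \<longrightarrow> x \<in> I m \<or> y \<in> I n)"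

end

context noetherian_graded_algebra begin

text \<open>
  If \<open>x \<otimes> y \<in> I\<close> for homogeneous \<open>x, y \<notin> I\<close>, then \<open>I + Ay\<close> contains \<open>y\<close> and \<open>I : y\<close> contains \<open>x\<close>, so both are
  strictly larger than \<open>I\<close>. Hence noetherian induction may assume the claim for them whenever \<open>I\<close> is not
  prime.
\<close>

lemma noetherian_induct [consumes 1, case_names prime split]:
  assumes "graded_ideal I"
    and prime: "\<And>I. \<lbrakk> graded_ideal I; prime_ideal I \<rbrakk> \<Longrightarrow> Q I"
    and split: "\<And>I m y. \<lbrakk> graded_ideal I; y \<in> G m; Q (ideal_plus I m y); Q (ideal_colon I m y) \<rbrakk> \<Longrightarrow> Q I"
  shows "Q I"
  using wf_graded_ideals assms(1)
proof (induction I rule: wf_induct_rule)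
  case (less I)
  have IH: "Q J" if "graded_ideal J" "\<And>n x. x \<in> I n \<Longrightarrow> x \<in> J n" "z \<in> J l" "z \<notin> I l" for J z l
  proof -
    have "I \<le> J" using that(2) by (auto simp: le_fun_def)
    moreover have "I \<noteq> J" using that(3,4) by auto
    ultimately have "(J, I) \<in> {(J, I). graded_ideal I \<and> graded_ideal J \<and> I < J}" using that(1) less(2) by auto
    then show ?thesis using less(1) that(1) by blast
  qed
  show ?case
  proof (cases "prime_ideal I")
    case True then show ?thesis using prime less(2) by blast
  next
    case False
    then obtain m n x y where xy: "x \<in> G m" "y \<in> G n" "x \<otimes> y \<in> I (m + n)" "x \<notin> I m" "y \<notin> I n"
      unfolding prime_ideal_def by blast
    show ?thesis
    proof (rule split[OF less(2) xy(2)])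
      show "Q (ideal_colon I n y)"
      proof (rule IH[OF graded_ideal_colon[OF less(2) xy(2)] ideal_colon_contains[OF less(2) xy(2)]])
        show "x \<in> ideal_colon I n y m" using xy by (simp add: ideal_colon_def)
      qed (use xy in auto)
      show "Q (ideal_plus I n y)"
      proof (rule IH[OF graded_ideal_plus[OF less(2) xy(2)] ideal_plus_contains[OF less(2) xy(2)]])
        show "y \<in> ideal_plus I n y n"
          by (rule ideal_plusI[of \<zero> _ _ \<one>]) (use xy graded_ideal_zero[OF less(2)] one_degree in \<open>auto simp: gap_def\<close>)
      qed (use xy in auto)
    qed
  qed
qed

definition subspace_of :: "'b set \<Rightarrow> 'b set \<Rightarrow> bool" where
  "subspace_of W V \<longleftrightarrow> W \<subseteq> V \<and> (\<forall>x \<in> W. \<forall>y \<in> W. x \<oplus> y \<in> W) \<and> (\<forall>c \<in> G 0. \<forall>x \<in> W. c \<otimes> x \<in> W)"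

text \<open>
  Let \<open>u\<close> avoid all subspaces except perhaps \<open>W\<close>, and let \<open>v\<close> avoid \<open>W\<close>. If \<open>u \<in> W\<close>, the line \<open>v + cu\<close> misses \<open>W\<close>.
  It meets every other subspace in at most one point, since two points would put \<open>u\<close> in it; so
  infinitely many scalars \<open>c\<close> leave a point outside all of them.
\<close>

lemma avoid_subspaces:
  assumes inf: "infinite (carrier k)" and V: "subspace_of V (carrier A)" "\<zero> \<in> V"
    and "finite \<W>" and "\<And>W. W \<in> \<W> \<Longrightarrow> subspace_of W V \<and> W \<noteq> V"
  shows "\<exists>x \<in> V. x \<notin> \<Union>\<W>"
  using assms(4,5)
proof (induction \<W>)
  case empty then show ?case using V(2) by auto
next
  case (insert W \<W>)
  then obtain u where u: "u \<in> V" "u \<notin> \<Union>\<W>" by auto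
  have W: "subspace_of W V" "W \<noteq> V" using insert(4) by auto
  then obtain v where v: "v \<in> V" "v \<notin> W" unfolding subspace_of_def by auto
  have uc: "u \<in> carrier A" and vc: "v \<in> carrier A" using u v V unfolding subspace_of_def by auto
  show ?case
  proof (rule ccontr)
    assume no: "\<not> (\<exists>x \<in> V. x \<notin> \<Union>(insert W \<W>))"
    then have uW: "u \<in> W" using u by auto
    have neg: "\<ominus> x \<in> W'" if "subspace_of W' V" "x \<in> W'" for x W'
    proof -
      have "\<ominus> \<one> \<otimes> x \<in> W'" using that G_minus[OF one_degree] unfolding subspace_of_def by blast
      moreover have "x \<in> carrier A" using that V unfolding subspace_of_def by auto
      ultimately show ?thesis by (simp add: A.l_minus)
    qed
    have "\<exists>W' \<in> \<W>. v \<oplus> c \<otimes> u \<in> W'" if c: "c \<in> G 0" for c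
    proof -
      have cu: "c \<otimes> u \<in> W" using W(1) c uW unfolding subspace_of_def by blast
      have "v \<oplus> c \<otimes> u \<in> V" using V(1) v(1) u(1) c unfolding subspace_of_def by blast
      moreover have "v \<oplus> c \<otimes> u \<notin> W"
      proof
        assume "v \<oplus> c \<otimes> u \<in> W"
        then have "v \<oplus> c \<otimes> u \<oplus> \<ominus> (c \<otimes> u) \<in> W" using W(1) neg[OF W(1) cu] unfolding subspace_of_def by blast
        moreover have "v \<oplus> c \<otimes> u \<oplus> \<ominus> (c \<otimes> u) = v"
          using uc vc G_carrier[OF c] by (simp add: M.a_assoc M.r_neg)
        ultimately show False using v by simp
      qed
      ultimately show ?thesis using no by auto
    qed
    moreover have infG: "infinite (G 0)" using inf connected bij_betw_finite by blast
    ultimately obtain W' where W': "W' \<in> \<W>" "infinite {c \<in> G 0. v \<oplus> c \<otimes> u \<in> W'}"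
      using pigeonhole_infinite_rel[OF infG insert(1), of "\<lambda>c W'. v \<oplus> c \<otimes> u \<in> W'"] by auto
    have sW: "subspace_of W' V" using insert(4) W'(1) by auto
    from infinite_imp_nonempty[OF W'(2)]
    obtain c where c: "c \<in> {c \<in> G 0. v \<oplus> c \<otimes> u \<in> W'}" unfolding ex_in_conv[symmetric] ..
    have "infinite ({c \<in> G 0. v \<oplus> c \<otimes> u \<in> W'} - {c})" using W'(2) by simp
    from infinite_imp_nonempty[OF this]
    obtain e where e: "e \<in> {c \<in> G 0. v \<oplus> c \<otimes> u \<in> W'} - {c}" unfolding ex_in_conv[symmetric] ..
    have cc: "c \<in> carrier A" "e \<in> carrier A" "c \<in> G 0" "e \<in> G 0" using c e by auto
    have "v \<oplus> c \<otimes> u \<oplus> \<ominus> (v \<oplus> e \<otimes> u) \<in> W'"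
      using sW neg[OF sW] c e unfolding subspace_of_def by blast
    moreover have "v \<oplus> c \<otimes> u \<oplus> \<ominus> (v \<oplus> e \<otimes> u) = (c \<oplus> \<ominus> e) \<otimes> u"
      using uc vc cc by (simp add: A.l_distr A.l_minus M.minus_add M.a_ac M.r_neg2 M.r_neg1 M.r_neg M.l_neg)
    ultimately have ceu: "(c \<oplus> \<ominus> e) \<otimes> u \<in> W'" by simp
    have "c \<oplus> \<ominus> e \<noteq> \<zero>" using e cc M.minus_equality[of c "\<ominus> e"] by auto
    then obtain g where g: "g \<in> G 0" "g \<otimes> (c \<oplus> \<ominus> e) = \<one>"
      using G0_inverse G_add[OF cc(3) G_minus[OF cc(4)]] by blast
    have "g \<otimes> ((c \<oplus> \<ominus> e) \<otimes> u) \<in> W'" using sW g(1) ceu unfolding subspace_of_def by blast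
    moreover have "g \<otimes> ((c \<oplus> \<ominus> e) \<otimes> u) = u"
      using g G_carrier[OF g(1)] cc uc by (simp add: A.m_assoc[symmetric])
    ultimately show False using u(2) W'(1) by auto
  qed
qed

end

locale finite_over_degree = noetherian_graded_algebra k A G
  for k :: "('a, 'm) ring_scheme" and A :: "('a, 'b, 'n) module_scheme" (structure)
    and G :: "nat \<Rightarrow> 'b set" +
  fixes d :: nat
  assumes d_pos: "d \<ge> 1"
    and finite_over: "finitely_generated_over A (generated_subalgebra k A (G d))"
begin

text \<open>
  Modulo \<open>I\<close> the subalgebra generated by \<open>G d\<close> consists of scalars, so \<open>A/I\<close> is spanned by the
  finitely many module generators of \<open>A\<close>.
\<close>

lemma cofinite_if_contains_generators:
  assumes I: "graded_ideal I" and sub: "G d \<subseteq> I d" shows "cofinite_ideal I"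
proof -
  let ?B = "generated_subalgebra k A (G d)"
  let ?P = "{x \<in> carrier A. \<forall>n. part x n \<in> I n}"
  have sB: "subring ?B A" by (rule generated_subalgebra_subring[OF G_subset])
  obtain F where F: "finite F" "F \<subseteq> carrier A" "carrier A \<subseteq> lspan A ?B F"
    using finite_over A.finitely_generated_over_iff_lspan[OF sB] by auto
  have "finite (\<Union>f\<in>F. {n. part f n \<noteq> \<zero>})" using F finite_part by auto
  from this[unfolded finite_nat_set_iff_bounded_le]
  obtain D where D: "\<forall>n \<in> (\<Union>f\<in>F. {n. part f n \<noteq> \<zero>}). n \<le> D" ..
  have Pc: "x \<in> carrier A" if "x \<in> ?P" for x using that by simp
  have P0: "\<zero> \<in> ?P" using graded_ideal_zero[OF I] by simp
  have Padd: "x \<oplus> y \<in> ?P" if "x \<in> ?P" "y \<in> ?P" for x y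
    using that graded_ideal_add[OF I] by (simp add: part_add)
  have Pminus: "\<ominus> x \<in> ?P" if "x \<in> ?P" for x
    using that graded_ideal_minus[OF I] by (simp add: part_minus)
  have IP: "x \<in> ?P" if "x \<in> I n" for x n
    using that graded_ideal_sub[OF I that] graded_ideal_zero[OF I] by (auto simp: part_homogeneous)
  have Pleft: "a \<otimes> x \<in> ?P" if a: "a \<in> carrier A" and x: "x \<in> ?P" for a x
    using a
  proof (induction a rule: homogeneous_induct)
    case (homogeneous m y)
    have xc: "x \<in> carrier A" and px: "\<And>n. part x n \<in> I n" using x by auto
    have "part (y \<otimes> x) n \<in> I n" for n
      using part_mult_homogeneous[OF homogeneous xc, of n] graded_ideal_zero[OF I]
        graded_ideal_mult[OF I homogeneous px, of "n - m"] by (cases "m \<le> n") auto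
    then show ?case using G_carrier[OF homogeneous] xc by simp
  next
    case (add y z) then show ?case using Padd[of "y \<otimes> x" "z \<otimes> x"] Pc[OF x] by (simp add: A.l_distr)
  qed
  have Pright: "x \<otimes> a \<in> ?P" if x: "x \<in> ?P" and a: "a \<in> carrier A" for a x
    using a
  proof (induction a rule: homogeneous_induct)
    case (homogeneous m y)
    have xc: "x \<in> carrier A" and px: "\<And>n. part x n \<in> I n" using x by auto
    have yc: "y \<in> carrier A" using homogeneous by (rule G_carrier)
    show ?case
    proof (rule decomposition_induct[OF xc])
      show "\<zero> \<otimes> y \<in> ?P" using yc P0 by simp
      show "part x n \<otimes> y \<in> ?P" for n by (rule IP[OF graded_ideal_mult_right[OF I px homogeneous]])
      show "(u \<oplus> v) \<otimes> y \<in> ?P" if "u \<in> carrier A" "v \<in> carrier A" "u \<otimes> y \<in> ?P" "v \<otimes> y \<in> ?P" for u v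
        using Padd[OF that(3,4)] that(1,2) yc by (simp add: A.l_distr)
    qed
  next
    case (add y z) then show ?case using Padd[of "x \<otimes> y" "x \<otimes> z"] Pc[OF x] by (simp add: A.r_distr)
  qed
  \<comment> \<open>The scalars together with the ideal form a subring, which therefore contains the generated subalgebra.\<close>
  let ?E = "{b \<in> carrier A. \<exists>c \<in> G 0. \<exists>p \<in> ?P. b = c \<oplus> p}"
  have EI: "c \<oplus> p \<in> ?E" if "c \<in> G 0" "p \<in> ?P" for c p
    using that G_carrier[OF that(1)] Pc[OF that(2)] by auto
  have "subring ?E A"
  proof (rule A.subringI)
    show "?E \<subseteq> carrier A" by auto
    show "\<one> \<in> ?E" using EI[OF one_degree P0] by simp
    fix x assume "x \<in> ?E"
    then obtain c p where x: "c \<in> G 0" "p \<in> ?P" "x = c \<oplus> p" by auto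
    note xc = G_carrier[OF x(1)] Pc[OF x(2)]
    show "\<ominus> x \<in> ?E" using EI[OF G_minus[OF x(1)] Pminus[OF x(2)]] xc by (simp add: x(3) M.minus_add)
    fix y assume "y \<in> ?E"
    then obtain e q where y: "e \<in> G 0" "q \<in> ?P" "y = e \<oplus> q" by auto
    note yc = G_carrier[OF y(1)] Pc[OF y(2)]
    have "x \<oplus> y = (c \<oplus> e) \<oplus> (p \<oplus> q)" using xc yc by (simp add: x(3) y(3) M.a_ac)
    then show "x \<oplus> y \<in> ?E" using EI[OF G_add[OF x(1) y(1)] Padd[OF x(2) y(2)]] by (simp only:)
    have "x \<otimes> y = (c \<otimes> e) \<oplus> (c \<otimes> q \<oplus> p \<otimes> (e \<oplus> q))"
      using xc yc by (simp add: x(3) y(3) A.l_distr A.r_distr M.a_ac)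
    moreover have "c \<otimes> q \<oplus> p \<otimes> (e \<oplus> q) \<in> ?P"
      by (rule Padd[OF Pleft[OF xc(1) y(2)] Pright[OF x(2)]]) (use yc in simp)
    moreover have "c \<otimes> e \<in> G 0" using mult_degree[OF x(1) y(1)] by simp
    ultimately show "x \<otimes> y \<in> ?E" using EI by (simp only:)
  qed
  moreover have "(\<lambda>a. a \<odot> \<one>) ` carrier k \<union> G d \<subseteq> ?E"
  proof
    fix x assume "x \<in> (\<lambda>a. a \<odot> \<one>) ` carrier k \<union> G d"
    then show "x \<in> ?E"
    proof
      assume "x \<in> (\<lambda>a. a \<odot> \<one>) ` carrier k"
      then have "x \<in> G 0" by (simp add: G0_eq)
      then show ?thesis using EI[OF _ P0, of x] G_carrier[of x 0] by simp
    next
      assume x: "x \<in> G d"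
      then have "x \<in> ?P" using sub IP by auto
      then show ?thesis using EI[OF G_zero, of x] G_carrier[OF x] by simp
    qed
  qed
  ultimately have BE: "?B \<subseteq> ?E"
    unfolding generated_subalgebra_def by (intro A.generate_ring_min_subring1) auto
  have "part x n \<in> I n" if x: "x \<in> lspan A ?B F" and n: "n > D" for x n
  proof -
    have "x \<in> carrier A \<and> part x n \<in> I n" using x
    proof induction
      case zero then show ?case using graded_ideal_zero[OF I] by simp
    next
      case (step b f t)
      then obtain c p where b: "c \<in> G 0" "p \<in> ?P" "b = c \<oplus> p" using BE by auto
      have fc: "f \<in> carrier A" using step F by auto
      have pf: "p \<otimes> f \<in> ?P" by (rule Pright[OF b(2) fc])
      have "part f n = \<zero>"
      proof (rule ccontr)
        assume "part f n \<noteq> \<zero>"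
        then have "n \<le> D" using D step(2) by blast
        then show False using n by simp
      qed
      then have "part (c \<otimes> f) n = \<zero>" using part_mult_homogeneous[OF b(1) fc, of n] G_carrier[OF b(1)] by simp
      moreover note cc = G_carrier[OF b(1)] Pc[OF b(2)] fc
      ultimately have "part (b \<otimes> f) n \<in> I n" "b \<otimes> f \<in> carrier A"
        using pf by (auto simp: b(3) A.l_distr part_add)
      then show ?case using step(4) graded_ideal_add[OF I] by (simp add: part_add)
    qed
    then show ?thesis by simp
  qed
  moreover have "part x n = x" "x \<in> lspan A ?B F" if "x \<in> G n" for x n
    using part_homogeneous[OF that, of n] G_carrier[OF that] F(3) by auto
  ultimately have "G n \<subseteq> I n" if "n > D" for n using that by fastforce
  then show ?thesis unfolding cofinite_ideal_def by blast
qed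

text \<open>
  For prime \<open>I\<close> only the elements of \<open>I\<close> can fail, and these form a proper subspace of \<open>G d\<close> unless
  \<open>A/I\<close> has bounded degree. For other ideals, collect the subspaces of \<open>I + Ay\<close> and \<open>I : y\<close>.
\<close>

lemma bad_subspaces:
  assumes "graded_ideal I"
  shows "\<exists>\<W>. finite \<W> \<and> (\<forall>W \<in> \<W>. subspace_of W (G d) \<and> W \<noteq> G d) \<and>
    (\<forall>x \<in> G d. x \<notin> \<Union>\<W> \<longrightarrow> eventually_regular d x I)"
  using assms
proof (induction I rule: noetherian_induct)
  case (prime I)
  show ?case
  proof (cases "G d \<subseteq> I d")
    case True
    then have "eventually_regular d x I" for x
      using cofinite_if_contains_generators[OF prime(1)]
      unfolding cofinite_ideal_def eventually_regular_def by blast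
    then show ?thesis by (intro exI[of _ "{}"]) auto
  next
    case False
    have "subspace_of (I d) (G d)"
      unfolding subspace_of_def using graded_ideal_sub[OF prime(1)] graded_ideal_add[OF prime(1)] graded_ideal_scale[OF prime(1)]
      by blast
    moreover have "eventually_regular d x I" if "x \<in> G d" "x \<notin> I d" for x
      using prime(2) that unfolding eventually_regular_def prime_ideal_def by blast
    ultimately show ?thesis using False by (intro exI[of _ "{I d}"]) auto
  qed
next
  case (split I m y)
  then obtain \<W>1 \<W>2 where W1: "finite \<W>1" "\<forall>W \<in> \<W>1. subspace_of W (G d) \<and> W \<noteq> G d"
      "\<forall>x \<in> G d. x \<notin> \<Union>\<W>1 \<longrightarrow> eventually_regular d x (ideal_plus I m y)"
    and W2: "finite \<W>2" "\<forall>W \<in> \<W>2. subspace_of W (G d) \<and> W \<noteq> G d"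
      "\<forall>x \<in> G d. x \<notin> \<Union>\<W>2 \<longrightarrow> eventually_regular d x (ideal_colon I m y)" by auto
  then have "\<forall>x \<in> G d. x \<notin> \<Union>(\<W>1 \<union> \<W>2) \<longrightarrow> eventually_regular d x I"
    using eventually_regular_split[OF split(1,2)] by auto
  then show ?case using W1(1,2) W2(1,2) by (intro exI[of _ "\<W>1 \<union> \<W>2"]) auto
qed

lemma exists_regular_element:
  assumes "infinite (carrier k)" "graded_ideal I"
  shows "\<exists>x \<in> G d. eventually_regular d x I"
proof -
  obtain \<W> where W: "finite \<W>" "\<forall>W \<in> \<W>. subspace_of W (G d) \<and> W \<noteq> G d"
    "\<forall>x \<in> G d. x \<notin> \<Union>\<W> \<longrightarrow> eventually_regular d x I"
    using bad_subspaces[OF assms(2)] by blast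
  have "subspace_of (G d) (carrier A)"
    unfolding subspace_of_def using G_subset G_add mult_degree[of _ 0 _ d] by auto
  then have "\<exists>x \<in> G d. x \<notin> \<Union>\<W>"
    using avoid_subspaces[OF assms(1) _ G_zero W(1)] W(2) by blast
  then show ?thesis using W(3) by blast
qed

end

context graded_algebra begin

text \<open>
  The homogeneous elements of the ideal generated by \<open>xs\<close>, arranged by degree.
\<close>

definition graded_idl :: "'b list \<Rightarrow> nat \<Rightarrow> 'b set" where
  "graded_idl xs n = Idl (set xs) \<inter> G n"

lemma graded_ideal_graded_idl:
  assumes "set xs \<subseteq> carrier A" shows "graded_ideal (graded_idl xs)"
proof -
  interpret J: ideal "Idl (set xs)" A using assms by (rule A.genideal_ideal)
  show ?thesis
    by (rule graded_idealI) (auto simp: graded_idl_def G_zero G_add mult_degree J.I_l_closed)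
qed

text \<open>
  Besides filter-regularity, no element is taken after the quotient has become bounded. A
  superfluous element would be algebraically dependent on the others.
\<close>

definition parameter_sequence :: "nat \<Rightarrow> 'b list \<Rightarrow> bool" where
  "parameter_sequence d xs \<longleftrightarrow> set xs \<subseteq> G d \<and> (\<forall>i < length xs.
     eventually_regular d (xs ! i) (graded_idl (take i xs)) \<and> \<not> cofinite_ideal (graded_idl (take i xs)))"

end

context finite_over_degree begin

text \<open>
  Extend the sequence by a filter-regular element while the quotient is unbounded. Such an element
  is not in the ideal of its predecessors, since it would annihilate the unbounded quotient; so the ideals
  increase strictly.
\<close>

lemma exists_parameter_sequence:
  assumes inf: "infinite (carrier k)"
  shows "\<exists>xs. parameter_sequence d xs \<and> cofinite_ideal (graded_idl xs)"
proof -
  have "\<exists>ys. parameter_sequence d ys \<and> cofinite_ideal (graded_idl ys)" if "parameter_sequence d xs" for xs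
    using wf_graded_ideals that
  proof (induction "graded_idl xs" arbitrary: xs rule: wf_induct_rule)
    case less
    show ?case
    proof (cases "cofinite_ideal (graded_idl xs)")
      case True then show ?thesis using less(2) by blast
    next
      case False
      have xs: "set xs \<subseteq> G d" using less(2) unfolding parameter_sequence_def by auto
      then have xc: "set xs \<subseteq> carrier A" by auto
      obtain x where x: "x \<in> G d" "eventually_regular d x (graded_idl xs)"
        using exists_regular_element[OF inf graded_ideal_graded_idl[OF xc]] by auto
      have ps: "parameter_sequence d (xs @ [x])"
        using less(2) x False unfolding parameter_sequence_def by (auto simp: nth_append less_Suc_eq)
      have xc': "set (xs @ [x]) \<subseteq> carrier A" using xc x(1) by auto
      interpret J: ideal "Idl (set xs)" A using xc by (rule A.genideal_ideal)
      have xnot: "x \<notin> Idl (set xs)"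
      proof
        assume "x \<in> Idl (set xs)"
        then have "x \<otimes> u \<in> graded_idl xs (d + n)" if "u \<in> G n" for u n
          using that mult_degree[OF x(1) that] by (simp add: graded_idl_def J.I_r_closed)
        then have "cofinite_ideal (graded_idl xs)"
          using x(2) unfolding eventually_regular_def cofinite_ideal_def by blast
        then show False using False by simp
      qed
      have sub: "set (xs @ [x]) \<subseteq> Idl (set (xs @ [x]))" by (rule A.genideal_self[OF xc'])
      interpret J': ideal "Idl (set (xs @ [x]))" A using xc' by (rule A.genideal_ideal)
      have "Idl (set xs) \<subseteq> Idl (set (xs @ [x]))"
        by (rule A.genideal_minimal[OF J'.is_ideal]) (use sub in auto)
      then have le: "graded_idl xs \<le> graded_idl (xs @ [x])" by (auto simp: le_fun_def graded_idl_def)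
      have "x \<in> graded_idl (xs @ [x]) d" "x \<notin> graded_idl xs d"
        using sub x(1) xnot by (auto simp: graded_idl_def)
      then have "graded_idl xs \<noteq> graded_idl (xs @ [x])" by metis
      then show ?thesis
        using less(1)[OF _ ps] le graded_ideal_graded_idl[OF xc] graded_ideal_graded_idl[OF xc'] by auto
    qed
  qed
  moreover have "parameter_sequence d []" by (simp add: parameter_sequence_def)
  ultimately show ?thesis by blast
qed

text \<open>
  For odd \<open>d\<close> the sign rule gives \<open>x\<^sup>2 = - x\<^sup>2\<close>, which forces \<open>x\<^sup>2 = 0\<close> unless \<open>2 = 0\<close>. For even \<open>d\<close>, and
  when \<open>2 = 0\<close>, the signs that involve \<open>x\<close> disappear.
\<close>

lemma square_zero_or_central:
  "(\<forall>x \<in> G d. x \<otimes> x = \<zero>) \<or> (\<forall>x \<in> G d. \<forall>y \<in> carrier A. x \<otimes> y = y \<otimes> x)"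
proof (cases "even d \<or> \<one>\<^bsub>k\<^esub> \<oplus>\<^bsub>k\<^esub> \<one>\<^bsub>k\<^esub> = \<zero>\<^bsub>k\<^esub>")
  case True
  have "x \<otimes> y = y \<otimes> x" if x: "x \<in> G d" and y: "y \<in> carrier A" for x y
    using y
  proof (induction y rule: homogeneous_induct)
    case (homogeneous n y)
    show ?case
    proof (cases "even d")
      case True then show ?thesis using graded_commute[OF x homogeneous] by simp
    next
      case False
      with \<open>even d \<or> _\<close> have "\<one>\<^bsub>k\<^esub> \<oplus>\<^bsub>k\<^esub> \<one>\<^bsub>k\<^esub> = \<zero>\<^bsub>k\<^esub>" by simp
      moreover have yx: "y \<otimes> x \<in> carrier A" using G_carrier[OF x] G_carrier[OF homogeneous] by simp
      ultimately have "y \<otimes> x \<oplus> y \<otimes> x = \<zero>"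
        using smult_l_distr[OF R.one_closed R.one_closed yx] by simp
      then have "\<ominus> (y \<otimes> x) = y \<otimes> x" using yx by (intro M.minus_equality)
      then show ?thesis using graded_commute[OF x homogeneous] by (simp split: if_splits)
    qed
  next
    case (add y z) then show ?case using G_carrier[OF x] by (simp add: A.l_distr A.r_distr)
  qed
  then show ?thesis by blast
next
  case False
  have "x \<otimes> x = \<zero>" if x: "x \<in> G d" for x
  proof -
    let ?t = "\<one>\<^bsub>k\<^esub> \<oplus>\<^bsub>k\<^esub> \<one>\<^bsub>k\<^esub>"
    have xx: "x \<otimes> x \<in> carrier A" using G_carrier[OF x] by simp
    have "x \<otimes> x = \<ominus> (x \<otimes> x)" using graded_commute[OF x x] False by simp
    then have "x \<otimes> x \<oplus> x \<otimes> x = \<zero>" using M.r_neg[OF xx] by simp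
    then have t: "?t \<odot> (x \<otimes> x) = \<zero>" using smult_l_distr[OF R.one_closed R.one_closed xx] xx by simp
    have "?t \<in> Units k" using False by (simp add: k.field_Units)
    then have i: "inv\<^bsub>k\<^esub> ?t \<in> carrier k" "inv\<^bsub>k\<^esub> ?t \<otimes>\<^bsub>k\<^esub> ?t = \<one>\<^bsub>k\<^esub>"
      by (rule R.Units_inv_closed, rule R.Units_l_inv)
    have "x \<otimes> x = (inv\<^bsub>k\<^esub> ?t \<otimes>\<^bsub>k\<^esub> ?t) \<odot> (x \<otimes> x)" using xx i by simp
    also have "\<dots> = inv\<^bsub>k\<^esub> ?t \<odot> (?t \<odot> (x \<otimes> x))" using xx i by (intro smult_assoc1) auto
    also have "\<dots> = \<zero>" using t i by simp
    finally show ?thesis .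
  qed
  then show ?thesis by blast
qed

text \<open>
  If the squares of \<open>G d\<close> vanish, then every prime homogeneous ideal contains \<open>G d\<close>. By noetherian
  induction every homogeneous ideal then has a quotient of bounded degree, and a parameter sequence is
  empty.
\<close>

lemma parameters_central:
  assumes "parameter_sequence d xs" "x \<in> set xs" "y \<in> carrier A"
  shows "x \<otimes> y = y \<otimes> x"
proof (rule ccontr)
  assume "x \<otimes> y \<noteq> y \<otimes> x"
  moreover have "x \<in> G d" using assms unfolding parameter_sequence_def by auto
  ultimately have sq: "\<forall>x \<in> G d. x \<otimes> x = \<zero>" using square_zero_or_central assms(3) by blast
  have cof: "cofinite_ideal I" if "graded_ideal I" for I
    using that
  proof (induction I rule: noetherian_induct)
    case (prime I)
    have "x \<in> I d" if x: "x \<in> G d" for x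
    proof -
      have "x \<otimes> x \<in> I (d + d)" using sq x graded_ideal_zero[OF prime(1)] by simp
      then show ?thesis using prime(2) x unfolding prime_ideal_def by blast
    qed
    then show ?case using cofinite_if_contains_generators[OF prime(1)] by blast
  next
    case (split I m y) then show ?case using cofinite_ideal_split by blast
  qed
  have "0 < length xs" using assms(2) by auto
  then have "\<not> cofinite_ideal (graded_idl (take 0 xs))"
    using assms(1) unfolding parameter_sequence_def by blast
  then show False using cof[OF graded_ideal_graded_idl[of "take 0 xs"]] by simp
qed

end

section \<open>Parameter sequences are filter-regular systems of parameters\<close>

context ring begin

lemma Idl_empty: "Idl {} = {\<zero>}"
proof
  show "Idl {} \<subseteq> {\<zero>}" by (rule genideal_minimal[OF zeroideal]) simp
  interpret J: ideal "Idl {}" R by (rule genideal_ideal) simp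
  show "{\<zero>} \<subseteq> Idl {}" by simp
qed

text \<open>
  For central \<open>x\<close> the sums \<open>x \<otimes> a \<oplus> s\<close> form a two-sided ideal.
\<close>

lemma Idl_insert_central:
  assumes x: "x \<in> carrier R" and S: "S \<subseteq> carrier R"
    and central: "\<And>y. y \<in> carrier R \<Longrightarrow> x \<otimes> y = y \<otimes> x"
    and y: "y \<in> Idl (insert x S)"
  obtains a s where "a \<in> carrier R" "s \<in> Idl S" "y = x \<otimes> a \<oplus> s"
proof -
  interpret J: ideal "Idl S" R using S by (rule genideal_ideal)
  let ?K = "{x \<otimes> a \<oplus> s | a s. a \<in> carrier R \<and> s \<in> Idl S}"
  have KI: "x \<otimes> a \<oplus> s \<in> ?K" if "a \<in> carrier R" "s \<in> Idl S" for a s using that by auto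
  have "ideal ?K R"
  proof (rule idealI[OF ring_axioms])
    show "subgroup ?K (add_monoid R)"
    proof (rule add.subgroupI)
      show "?K \<subseteq> carrier R" using x J.Icarr by auto
      show "?K \<noteq> {}" using KI[OF zero_closed J.zero_closed] by blast
      fix u assume "u \<in> ?K"
      then obtain a s where u: "u = x \<otimes> a \<oplus> s" "a \<in> carrier R" "s \<in> Idl S" by auto
      have "\<ominus> u = x \<otimes> \<ominus> a \<oplus> \<ominus> s" using u x J.Icarr[OF u(3)] by (simp add: minus_add r_minus)
      then show "\<ominus> u \<in> ?K" using KI[of "\<ominus> a" "\<ominus> s"] u by (simp add: J.a_inv_closed)
      fix v assume "v \<in> ?K"
      then obtain b t where v: "v = x \<otimes> b \<oplus> t" "b \<in> carrier R" "t \<in> Idl S" by auto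
      have "u \<oplus> v = x \<otimes> (a \<oplus> b) \<oplus> (s \<oplus> t)"
        using u v x J.Icarr[OF u(3)] J.Icarr[OF v(3)] by (simp add: r_distr a_ac)
      then show "u \<oplus> v \<in> ?K" using KI[of "a \<oplus> b" "s \<oplus> t"] u v by simp
    qed
  next
    fix u b assume "u \<in> ?K" and b: "b \<in> carrier R"
    then obtain a s where u: "u = x \<otimes> a \<oplus> s" "a \<in> carrier R" "s \<in> Idl S" by auto
    note sc = J.Icarr[OF u(3)]
    have "u \<otimes> b = x \<otimes> (a \<otimes> b) \<oplus> s \<otimes> b" using u b x sc by (simp add: l_distr m_assoc)
    then show "u \<otimes> b \<in> ?K" using KI[of "a \<otimes> b" "s \<otimes> b"] u b J.I_r_closed by simp
    have "b \<otimes> u = (b \<otimes> x) \<otimes> a \<oplus> b \<otimes> s" using u b x sc by (simp add: r_distr m_assoc)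
    also have "\<dots> = x \<otimes> (b \<otimes> a) \<oplus> b \<otimes> s" using u b x sc by (simp add: central[symmetric] m_assoc)
    finally show "b \<otimes> u \<in> ?K" using KI[of "b \<otimes> a" "b \<otimes> s"] u b J.I_l_closed by simp
  qed
  moreover have "insert x S \<subseteq> ?K"
  proof
    fix u assume "u \<in> insert x S"
    then consider "u = x" | "u \<in> S" by auto
    then show "u \<in> ?K"
    proof cases
      case 1 then show ?thesis using KI[of \<one> \<zero>] x by simp
    next
      case 2
      then have "u \<in> Idl S" "u \<in> carrier R" using genideal_self[OF S] S by auto
      then show ?thesis using KI[of \<zero> u] x by simp
    qed
  qed
  ultimately have "Idl (insert x S) \<subseteq> ?K" by (rule genideal_minimal)
  then show thesis using y that by auto
qed

end

context noetherian_graded_algebra begin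

text \<open>
  A subspace of \<open>G n\<close> together with all components of higher degree is a homogeneous ideal. A maximal
  one among those coming from finitely spanned subspaces exists by the chain condition, and it exhausts
  \<open>G n\<close>.
\<close>

lemma component_finite_dimensional:
  obtains F where "finite F" "F \<subseteq> G n" "G n \<subseteq> lspan A (G 0) F"
proof -
  \<comment> \<open>The subspace spanned by \<open>F\<close>, together with all components of degree larger than \<open>n\<close>.\<close>
  let ?I = "\<lambda>F i. if i < n then {\<zero>} else if i = n then lspan A (G 0) F else G i"
  have G0c: "G 0 \<subseteq> carrier A" by (rule G_subset)
  have IF: "graded_ideal (?I F)" if F: "F \<subseteq> G n" for F
  proof (rule graded_idealI)
    have Fc: "F \<subseteq> carrier A" using F G_subset by blast
    have sub: "lspan A (G 0) F \<subseteq> G n"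
      by (rule A.lspan_least) (use F mult_degree[of _ 0 _ n] G_zero G_add in auto)
    fix i
    show "\<zero> \<in> ?I F i" using G_zero lspan.zero by auto
    fix x assume x: "x \<in> ?I F i"
    show xG: "x \<in> G i" using x sub G_zero by (auto split: if_splits)
    show "x \<oplus> y \<in> ?I F i" if "y \<in> ?I F i" for y
      using x that A.lspan_add[OF G0c Fc] G_add by (auto split: if_splits)
    show "a \<otimes> x \<in> ?I F (m + i)" if a: "a \<in> G m" for a m
    proof (cases "i < n")
      case True
      then have "a \<otimes> x = \<zero>" using x G_carrier[OF a] by simp
      then show ?thesis using G_zero lspan.zero by auto
    next
      case False
      show ?thesis
      proof (cases "m = 0")
        case True
        have "a \<otimes> x \<in> lspan A (G 0) F" if "x \<in> lspan A (G 0) F"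
          by (rule A.lspan_smult[OF G0c Fc that]) (use a True subringE(6)[OF subring_G0] in auto)
        then show ?thesis using x False True mult_degree[OF a xG] by (auto split: if_splits)
      next
        case m: False
        then show ?thesis using False mult_degree[OF a xG] by auto
      qed
    qed
  qed
  let ?Q = "{?I F | F. finite F \<and> F \<subseteq> G n}"
  have "?I {} \<in> ?Q" by blast
  from wfE_min[OF wf_graded_ideals this] obtain J where J: "J \<in> ?Q"
    "\<And>J'. (J', J) \<in> {(J, I). graded_ideal I \<and> graded_ideal J \<and> I < J} \<Longrightarrow> J' \<notin> ?Q" by blast
  then obtain F where F: "finite F" "F \<subseteq> G n" "J = ?I F" by blast
  have "y \<in> lspan A (G 0) F" if y: "y \<in> G n" for y
  proof (rule ccontr)
    assume no: "y \<notin> lspan A (G 0) F"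
    let ?F = "insert y F"
    have F': "finite ?F" "?F \<subseteq> G n" using F y by auto
    have "?F \<subseteq> carrier A" using F' G_subset by blast
    from A.lspan_incl[OF G0c this one_degree, of y] have yin: "y \<in> lspan A (G 0) ?F" by simp
    have "lspan A (G 0) F \<subseteq> lspan A (G 0) ?F" by (rule lspan_mono) auto
    then have "?I F \<le> ?I ?F" by (auto simp: le_fun_def)
    moreover have "?I F n \<noteq> ?I ?F n" using no yin by auto
    then have "?I F \<noteq> ?I ?F" by metis
    ultimately have "(?I ?F, J) \<in> {(J, I). graded_ideal I \<and> graded_ideal J \<and> I < J}"
      using IF[OF F(2)] IF[OF F'(2)] F(3) by (simp add: less_le)
    from J(2)[OF this] show False using F' by blast
  qed
  then show thesis using that F by blast
qed

end

lemma weight_replicate: "length es = n \<Longrightarrow> weight (replicate n d) es = d * sum_list es"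
  by (induction es arbitrary: n) (auto simp: algebra_simps)

context graded_algebra begin

text \<open>
  The value at \<open>hs\<close> of the polynomial with coefficients \<open>c\<close> and exponents in \<open>E\<close>.
\<close>

definition poly_value :: "'b list \<Rightarrow> (nat list \<Rightarrow> 'a) \<Rightarrow> nat list set \<Rightarrow> 'b" where
  "poly_value hs c E = finsum A (\<lambda>es. c es \<odot> monomial_eval A hs es) E"

lemma monomial_equal_degrees:
  assumes "set hs \<subseteq> G d" "length es = length hs"
  shows "monomial_eval A hs es \<in> G (d * sum_list es)"
proof -
  have "graded_list hs (replicate (length hs) d)"
    using assms(1) by (auto simp: list_all2_conv_all_nth)
  from monomial_degree[OF this assms(2)] show ?thesis
    using weight_replicate[OF assms(2)] by simp
qed

lemma poly_value_terms:
  assumes "set hs \<subseteq> carrier A" "E \<subseteq> {es. length es = length hs}" "c \<in> E \<rightarrow> carrier k"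
  shows "(\<lambda>es. c es \<odot> monomial_eval A hs es) \<in> E \<rightarrow> carrier A"
proof (rule Pi_I)
  fix es assume "es \<in> E"
  then have "length es = length hs" "c es \<in> carrier k" using assms(2,3) by auto
  then show "c es \<odot> monomial_eval A hs es \<in> carrier A" using assms(1) by simp
qed

lemma poly_value_degree:
  assumes "set hs \<subseteq> G d" "finite E" "\<And>es. es \<in> E \<Longrightarrow> length es = length hs \<and> sum_list es = e"
    "c \<in> E \<rightarrow> carrier k"
  shows "poly_value hs c E \<in> G (d * e)"
  unfolding poly_value_def
proof (rule A.finsum_in_closed[OF assms(2) _ G_zero G_subset G_add])
  fix es assume es: "es \<in> E"
  then have "monomial_eval A hs es \<in> G (d * e)" using monomial_equal_degrees[OF assms(1)] assms(3) by auto
  then show "c es \<odot> monomial_eval A hs es \<in> G (d * e)" using es assms(4) by (intro G_smult) auto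
qed

text \<open>
  The terms without the first variable form a polynomial in the others; the remaining terms are
  divisible by the first variable.
\<close>

lemma poly_value_split:
  assumes hs: "set (x # zs) \<subseteq> carrier A" and E: "finite E" "E \<subseteq> {es. length es = Suc (length zs)}"
    and c: "c \<in> E \<rightarrow> carrier k"
  defines "E0 \<equiv> {es. 0 # es \<in> E}" and "E1 \<equiv> {es. es \<noteq> [] \<and> Suc (hd es) # tl es \<in> E}"
  shows "poly_value (x # zs) c E = poly_value zs (\<lambda>es. c (0 # es)) E0 \<oplus>
    x \<otimes> poly_value (x # zs) (\<lambda>es. c (Suc (hd es) # tl es)) E1"
    and "finite E0" "finite E1"
proof -
  let ?f = "\<lambda>es. c es \<odot> monomial_eval A (x # zs) es" and ?inc = "\<lambda>es. Suc (hd es) # tl es"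
  have inj0: "inj_on ((#) 0) E0" by (simp add: inj_on_def)
  have inj1: "inj_on ?inc E1" unfolding E1_def by (rule inj_onI) (auto intro: list.expand)
  have im: "E = (#) 0 ` E0 \<union> ?inc ` E1"
  proof (intro equalityI subsetI)
    fix es assume es: "es \<in> E"
    then obtain e es' where ee: "es = e # es'" using E(2) by (cases es) auto
    show "es \<in> (#) 0 ` E0 \<union> ?inc ` E1"
    proof (cases e)
      case 0 then show ?thesis using es by (auto simp: ee E0_def)
    next
      case (Suc e')
      then have "es = ?inc (e' # es')" "e' # es' \<in> E1" using es by (auto simp: ee E1_def)
      then show ?thesis by blast
    qed
  qed (auto simp: E0_def E1_def)
  have disj: "(#) 0 ` E0 \<inter> ?inc ` E1 = {}" by auto
  have sub: "(#) 0 ` E0 \<subseteq> E" "?inc ` E1 \<subseteq> E" using im by auto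
  then have "finite ((#) 0 ` E0)" "finite (?inc ` E1)" using E(1) finite_subset by auto
  then show fin: "finite E0" "finite E1"
    using finite_imageD inj0 inj1 by blast+
  have fE: "?f \<in> E \<rightarrow> carrier A" by (rule poly_value_terms[OF hs _ c]) (use E(2) in simp)
  have len0: "length es = length zs" if "es \<in> E0" for es using that E(2) by (auto simp: E0_def)
  have len1: "es \<noteq> []" "length (tl es) = length zs" if "es \<in> E1" for es using that E(2) by (auto simp: E1_def)
  have L1: "E1 \<subseteq> {es. length es = length (x # zs)}" 
  proof
    fix es assume "es \<in> E1"
    then show "es \<in> {es. length es = length (x # zs)}" using len1[of es] by (cases es) auto
  qed
  have xc: "x \<in> carrier A" and zc: "set zs \<subseteq> carrier A" using hs by auto
  have c0: "c (0 # es) \<in> carrier k" if "es \<in> E0" for es using that c by (auto simp: E0_def)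
  have c1: "c (?inc es) \<in> carrier k" if "es \<in> E1" for es using that c by (auto simp: E1_def)
  have "poly_value (x # zs) c E = finsum A ?f ((#) 0 ` E0) \<oplus> finsum A ?f (?inc ` E1)"
    unfolding poly_value_def
    by (subst im, rule M.finsum_Un_disjoint) (use fin disj fE sub in auto)
  also have "finsum A ?f ((#) 0 ` E0) = finsum A (\<lambda>es. ?f (0 # es)) E0"
    by (rule M.finsum_reindex) (use fE sub inj0 in auto)
  also have "\<dots> = poly_value zs (\<lambda>es. c (0 # es)) E0"
    unfolding poly_value_def
    by (rule M.finsum_cong') (use len0 c0 zc in auto)
  also have "finsum A ?f (?inc ` E1) = finsum A (\<lambda>es. ?f (?inc es)) E1"
    by (rule M.finsum_reindex) (use fE sub inj1 in auto)
  also have "\<dots> = finsum A (\<lambda>es. x \<otimes> (c (?inc es) \<odot> monomial_eval A (x # zs) es)) E1"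
  proof (rule M.finsum_cong')
    have mc: "monomial_eval A (x # zs) es \<in> carrier A" if "es \<in> E1" for es
      by (rule A.monomial_eval_closed) (use len1[OF that] hs in \<open>auto simp: neq_Nil_conv\<close>)
    show "(\<lambda>es. x \<otimes> (c (?inc es) \<odot> monomial_eval A (x # zs) es)) \<in> E1 \<rightarrow> carrier A"
      using mc c1 xc by auto
    fix es assume es: "es \<in> E1"
    then obtain e es' where ee: "es = e # es'" using len1 by (cases es) auto
    have m': "monomial_eval A zs es' \<in> carrier A" using len1[OF es] zc by (simp add: ee)
    have "monomial_eval A (x # zs) (?inc es) = x \<otimes> monomial_eval A (x # zs) es"
      using xc m' A.nat_pow_Suc2[OF xc, of e] by (simp add: ee A.m_assoc del: A.nat_pow_Suc)
    then show "?f (?inc es) = x \<otimes> (c (?inc es) \<odot> monomial_eval A (x # zs) es)"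
      using smult_mult_right[OF c1[OF es] xc mc[OF es]] by simp
  qed simp
  also have "\<dots> = x \<otimes> poly_value (x # zs) (\<lambda>es. c (?inc es)) E1"
    unfolding poly_value_def
    by (rule A.finsum_rdistr[symmetric, OF fin(2) xc])
      (rule poly_value_terms[OF hs L1], use c1 in simp)
  finally show "poly_value (x # zs) c E = poly_value zs (\<lambda>es. c (0 # es)) E0 \<oplus>
    x \<otimes> poly_value (x # zs) (\<lambda>es. c (?inc es)) E1" .
qed

end

context finite_over_degree begin

text \<open>
  Graded Nakayama lemma: spanning sets of the components up to degree \<open>N\<close> generate. An element of larger
  degree is a combination of the parameters with coefficients of smaller degree, to which induction
  applies.
\<close>

lemma finitely_generated_over_parameters:
  assumes ps: "parameter_sequence d xs" and cof: "cofinite_ideal (graded_idl xs)"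
  shows "finitely_generated_over A (generated_subalgebra k A (set xs))"
proof -
  let ?B = "generated_subalgebra k A (set xs)"
  have xs: "set xs \<subseteq> G d" using ps unfolding parameter_sequence_def by simp
  then have xc: "set xs \<subseteq> carrier A" by auto
  have sB: "subring ?B A" by (rule generated_subalgebra_subring[OF xc])
  note Bc = subringE(1)[OF sB]
  have xB: "set xs \<subseteq> ?B" and G0B: "G 0 \<subseteq> ?B"
    unfolding G0_eq generated_subalgebra_def by (auto intro: generate_ring.incl)
  obtain N where N: "\<And>n. n > N \<Longrightarrow> G n \<subseteq> graded_idl xs n" using cof unfolding cofinite_ideal_def by auto
  have "\<exists>F. finite F \<and> F \<subseteq> G n \<and> G n \<subseteq> lspan A (G 0) F" for n
    using component_finite_dimensional[of n] by metis
  then obtain F where F: "\<And>n. finite (F n)" "\<And>n. F n \<subseteq> G n" "\<And>n. G n \<subseteq> lspan A (G 0) (F n)" by metis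
  let ?F = "\<Union>n\<in>{..N}. F n"
  let ?M = "lspan A ?B ?F"
  have Fc: "?F \<subseteq> carrier A" using F(2) G_subset by blast
  note Madd = A.lspan_add[OF Bc Fc]
  have Mmult: "b \<otimes> x \<in> ?M" if "b \<in> ?B" "x \<in> ?M" for b x
    by (rule A.lspan_smult[OF Bc Fc that(2)]) (use that(1) Bc subringE(6)[OF sB] in auto)
  have low: "G n \<subseteq> ?M" if "n \<le> N" for n
  proof -
    have "lspan A (G 0) (F n) \<subseteq> ?M" by (rule lspan_mono[OF G0B]) (use that in auto)
    then show ?thesis using F(3)[of n] by blast
  qed
  have idl: "part y m \<in> ?M" if "set zs \<subseteq> set xs" "y \<in> Idl (set zs)" "\<And>j. j < m \<Longrightarrow> G j \<subseteq> ?M" for zs y m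
    using that(1,2)
  proof (induction zs arbitrary: y)
    case Nil
    then have "y = \<zero>" using A.Idl_empty by simp
    then show ?case using lspan.zero[of A] by simp
  next
    case (Cons z zs)
    have z: "z \<in> G d" "z \<in> ?B" "z \<in> set xs" using Cons(2) xs xB by auto
    have zsc: "set zs \<subseteq> carrier A" using Cons(2) xc by auto
    obtain a s where as: "a \<in> carrier A" "s \<in> Idl (set zs)" "y = z \<otimes> a \<oplus> s"
      by (rule A.Idl_insert_central[OF G_carrier[OF z(1)] zsc parameters_central[OF ps z(3)], of y])
        (use Cons(3) in auto)
    interpret J: ideal "Idl (set zs)" A using zsc by (rule A.genideal_ideal)
    have sM: "part s m \<in> ?M" using Cons(1)[OF _ as(2)] Cons(2) by simp
    have "part (z \<otimes> a) m \<in> ?M"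
    proof (cases "d \<le> m")
      case True
      then have "part a (m - d) \<in> ?M" using that(3)[of "m - d"] part_in[OF as(1)] d_pos by auto
      then show ?thesis using part_mult_homogeneous[OF z(1) as(1)] True Mmult[OF z(2)] by simp
    next
      case False
      then show ?thesis using part_mult_homogeneous[OF z(1) as(1)] lspan.zero[of A] by simp
    qed
    then show ?case using Madd[OF _ sM] as(1) G_carrier[OF z(1)] J.Icarr[OF as(2)] by (simp add: as(3) part_add)
  qed
  have all: "G m \<subseteq> ?M" for m
  proof (induction m rule: less_induct)
    case (less m)
    show ?case
    proof (cases "m \<le> N")
      case True then show ?thesis by (rule low)
    next
      case False
      show ?thesis
      proof
        fix y assume y: "y \<in> G m"
        then have "y \<in> Idl (set xs)" using N[of m] False by (auto simp: graded_idl_def)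
        then have "part y m \<in> ?M" using idl[OF subset_refl _ less] by blast
        then show "y \<in> ?M" using part_homogeneous[OF y, of m] by simp
      qed
    qed
  qed
  have "carrier A \<subseteq> ?M"
  proof
    fix y assume "y \<in> carrier A"
    then show "y \<in> ?M"
    proof (induction y rule: homogeneous_induct)
      case (homogeneous n y) then show ?case using all by blast
    next
      case (add y z) then show ?case by (intro Madd)
    qed
  qed
  moreover have "finite ?F" using F(1) by simp
  ultimately show ?thesis using A.finitely_generated_over_iff_lspan[OF sB] Fc by blast
qed

lemma parameter_sequence_middle:
  assumes "parameter_sequence d (pre @ x # zs)"
  shows "eventually_regular d x (graded_idl pre)" "\<not> cofinite_ideal (graded_idl pre)"
    "x \<in> G d" "set (pre @ x # zs) \<subseteq> G d"
proof -
  have "length pre < length (pre @ x # zs)" by simp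
  then have "eventually_regular d ((pre @ x # zs) ! length pre) (graded_idl (take (length pre) (pre @ x # zs))) \<and>
    \<not> cofinite_ideal (graded_idl (take (length pre) (pre @ x # zs)))"
    using assms unfolding parameter_sequence_def by blast
  then show "eventually_regular d x (graded_idl pre)" "\<not> cofinite_ideal (graded_idl pre)" by simp_all
  show "x \<in> G d" "set (pre @ x # zs) \<subseteq> G d" using assms unfolding parameter_sequence_def by auto
qed

text \<open>
  The relation is only required to annihilate \<open>A\<close> modulo the earlier parameters in large degrees,
  which makes the claim inductive. Write the polynomial as \<open>R + xQ\<close> with \<open>R\<close> free of \<open>x\<close>. Modulo \<open>x\<close> only \<open>R\<close> remains,
  a relation between fewer parameters. Once \<open>R = 0\<close>, the factor \<open>x\<close> cancels in large degrees and \<open>Q\<close> is a relation of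
  smaller degree.
  If \<open>x\<close> is the last parameter, the quotient by \<open>x\<close> is no longer unbounded and gives no information on \<open>R\<close>;
  but then a homogeneous \<open>R \<noteq> 0\<close> is a nonzero constant, which cannot annihilate the unbounded quotient by
  the earlier parameters.
\<close>

lemma relation_trivial:
  assumes "parameter_sequence d (pre @ ys)" "ys \<noteq> []" "finite E"
    "\<And>es. es \<in> E \<Longrightarrow> length es = length ys \<and> sum_list es = e" "c \<in> E \<rightarrow> carrier k"
    "\<And>n u. \<lbrakk> n > N; u \<in> G n \<rbrakk> \<Longrightarrow> poly_value ys c E \<otimes> u \<in> Idl (set pre)"
    "es \<in> E"
  shows "c es = \<zero>\<^bsub>k\<^esub>"
  using assms
proof (induction ys arbitrary: pre E c e N es)
  case (Cons x zs)
  note outer = Cons.IH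
  from Cons.prems show ?case
  proof (induction e arbitrary: E c N es rule: less_induct)
    case (less e)
    note ps = less.prems(1) and E = less.prems(3) and len = less.prems(4) and c = less.prems(5)
      and kill = less.prems(6) and esE = less.prems(7)
    note mid = parameter_sequence_middle[OF ps]
    have hc: "set (x # zs) \<subseteq> carrier A" and xc: "x \<in> carrier A" and zc: "set zs \<subseteq> carrier A"
      and prec: "set pre \<subseteq> carrier A" using mid(4) by auto
    have zG: "set zs \<subseteq> G d" and xzG: "set (x # zs) \<subseteq> G d" using mid(4) by auto
    let ?E0 = "{es. 0 # es \<in> E}" and ?E1 = "{es. es \<noteq> [] \<and> Suc (hd es) # tl es \<in> E}"
    let ?c0 = "\<lambda>es. c (0 # es)" and ?c1 = "\<lambda>es. c (Suc (hd es) # tl es)"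
    have EL: "E \<subseteq> {es. length es = Suc (length zs)}" using len by auto
    note sp = poly_value_split[OF hc E EL c]
    have len0: "length es = length zs \<and> sum_list es = e" if "es \<in> ?E0" for es
      using len[of "0 # es"] that by auto
    have len1: "length es = length (x # zs) \<and> Suc (sum_list es) = e" if "es \<in> ?E1" for es
      using len[of "Suc (hd es) # tl es"] that by (cases es) auto
    have c0: "?c0 \<in> ?E0 \<rightarrow> carrier k" and c1: "?c1 \<in> ?E1 \<rightarrow> carrier k" using c by auto
    interpret J: ideal "Idl (set pre)" A using prec by (rule A.genideal_ideal)
    have Qc: "poly_value (x # zs) ?c1 ?E1 \<in> carrier A"
      unfolding poly_value_def
      by (rule M.finsum_closed) (rule poly_value_terms[OF hc _ c1], use len1 in auto)
    have Rc: "poly_value zs ?c0 ?E0 \<in> carrier A"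
      unfolding poly_value_def
      by (rule M.finsum_closed) (rule poly_value_terms[OF zc _ c0], use len0 in auto)
    have zero0: "?c0 es = \<zero>\<^bsub>k\<^esub>" if es: "es \<in> ?E0" for es
    proof (cases "zs = []")
      case False
      have prec': "set (pre @ [x]) \<subseteq> carrier A" using prec xc by simp
      interpret J': ideal "Idl (set (pre @ [x]))" A using prec' by (rule A.genideal_ideal)
      have sub: "set (pre @ [x]) \<subseteq> Idl (set (pre @ [x]))" by (rule A.genideal_self[OF prec'])
      have JJ': "Idl (set pre) \<subseteq> Idl (set (pre @ [x]))"
        by (rule A.genideal_minimal[OF J'.is_ideal]) (use sub in auto)
      have R: "poly_value zs ?c0 ?E0 \<otimes> u \<in> Idl (set (pre @ [x]))" if u: "n > N" "u \<in> G n" for n u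
      proof -
        note uc = G_carrier[OF u(2)]
        let ?xQu = "x \<otimes> (poly_value (x # zs) ?c1 ?E1 \<otimes> u)"
        have xQu: "?xQu \<in> Idl (set (pre @ [x]))" using sub uc Qc by (intro J'.I_r_closed) auto
        have "poly_value (x # zs) c E \<otimes> u \<in> Idl (set (pre @ [x]))" using kill[OF u] JJ' by blast
        then have "poly_value (x # zs) c E \<otimes> u \<oplus> \<ominus> ?xQu \<in> Idl (set (pre @ [x]))"
          using xQu by (intro J'.a_closed J'.a_inv_closed)
        moreover have "poly_value (x # zs) c E \<otimes> u \<oplus> \<ominus> ?xQu = poly_value zs ?c0 ?E0 \<otimes> u"
          unfolding sp(1) using xc uc Qc Rc by (simp add: A.l_distr A.m_assoc M.a_assoc M.r_neg)
        ultimately show ?thesis by simp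
      qed
      have "parameter_sequence d ((pre @ [x]) @ zs)" using ps by simp
      from outer[OF this False sp(2) len0 c0 R es] show ?thesis .
    next
      case True
      then have e0: "es = []" "e = 0" using len0[OF es] by auto
      show ?thesis
      proof (rule ccontr)
        assume nz: "?c0 es \<noteq> \<zero>\<^bsub>k\<^esub>"
        have "es' = [0]" if "es' \<in> E" for es'
          using len[OF that] e0 True by (cases es') auto
        moreover have "[0] \<in> E" using es e0 by simp
        ultimately have E0: "E = {[0]}" by blast
        have ck: "c [0] \<in> carrier k" using c E0 by auto
        have val: "poly_value (x # zs) c E = c [0] \<odot> \<one>"
          unfolding poly_value_def E0 using True ck xc by (simp add: Pi_def)
        have "c [0] \<in> Units k" using nz e0 ck by (simp add: k.field_Units)
        then have i: "inv\<^bsub>k\<^esub> (c [0]) \<in> carrier k" "inv\<^bsub>k\<^esub> (c [0]) \<otimes>\<^bsub>k\<^esub> c [0] = \<one>\<^bsub>k\<^esub>"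
          by (rule R.Units_inv_closed, rule R.Units_l_inv)
        have "u \<in> graded_idl pre n" if u: "n > N" "u \<in> G n" for n u
        proof -
          note uc = G_carrier[OF u(2)]
          have "(inv\<^bsub>k\<^esub> (c [0]) \<odot> \<one>) \<otimes> (poly_value (x # zs) c E \<otimes> u) \<in> Idl (set pre)"
            by (rule J.I_l_closed[OF kill[OF u]]) (use i in simp)
          moreover have "(inv\<^bsub>k\<^esub> (c [0]) \<odot> \<one>) \<otimes> (poly_value (x # zs) c E \<otimes> u) = u"
            unfolding val using i ck uc
            by (simp add: smult_eq_mult[symmetric] smult_assoc1[symmetric])
          ultimately show ?thesis using u(2) by (simp add: graded_idl_def)
        qed
        then have "cofinite_ideal (graded_idl pre)" unfolding cofinite_ideal_def by blast
        then show False using mid(2) by simp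
      qed
    qed
    have R0: "poly_value zs ?c0 ?E0 = \<zero>"
      unfolding poly_value_def
    proof (rule M.add.finprod_one_eqI)
      fix es assume es: "es \<in> ?E0"
      have "monomial_eval A zs es \<in> carrier A" using len0[OF es] zc by simp
      then show "c (0 # es) \<odot> monomial_eval A zs es = \<zero>" using zero0[OF es] by simp
    qed
    have zero1: "?c1 es = \<zero>\<^bsub>k\<^esub>" if es: "es \<in> ?E1" for es
    proof -
      obtain e' where e': "e = Suc e'" using len1[OF es] by auto
      have QG: "poly_value (x # zs) ?c1 ?E1 \<in> G (d * e')"
        by (rule poly_value_degree[OF xzG sp(3) _ c1]) (use len1 e' in auto)
      obtain N' where N': "\<And>n u. \<lbrakk> n > N'; u \<in> G n; x \<otimes> u \<in> graded_idl pre (d + n) \<rbrakk> \<Longrightarrow> u \<in> graded_idl pre n"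
        using mid(1) unfolding eventually_regular_def by auto
      have Q: "poly_value (x # zs) ?c1 ?E1 \<otimes> u \<in> Idl (set pre)" if u: "n > N + N'" "u \<in> G n" for n u
      proof -
        note uc = G_carrier[OF u(2)]
        let ?Qu = "poly_value (x # zs) ?c1 ?E1 \<otimes> u"
        have Qu: "?Qu \<in> G (d * e' + n)" by (rule mult_degree[OF QG u(2)])
        have "poly_value (x # zs) c E \<otimes> u = x \<otimes> ?Qu"
          unfolding sp(1) R0 using xc uc Qc by (simp add: A.m_assoc)
        then have "x \<otimes> ?Qu \<in> Idl (set pre)" using kill[OF _ u(2)] u(1) by simp
        then have "x \<otimes> ?Qu \<in> graded_idl pre (d + (d * e' + n))"
          using mult_degree[OF mid(3) Qu] by (simp add: graded_idl_def)
        then have "?Qu \<in> graded_idl pre (d * e' + n)" using N'[OF _ Qu] u(1) by simp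
        then show ?thesis by (simp add: graded_idl_def)
      qed
      have e'e: "e' < e" using e' by simp
      have len1': "length es = length (x # zs) \<and> sum_list es = e'" if "es \<in> ?E1" for es
        using len1[OF that] e' by simp
      from less.IH[OF e'e ps _ sp(3) len1' c1 Q es] show ?thesis by simp
    qed
    obtain f es' where fe: "es = f # es'" using len[OF esE] by (cases es) auto
    show ?case
    proof (cases f)
      case 0 then show ?thesis using zero0[of es'] esE fe by simp
    next
      case (Suc f') then show ?thesis using zero1[of "f' # es'"] esE fe by simp
    qed
  qed
qed simp

text \<open>
  All parameters have degree \<open>d\<close>, so each homogeneous part of a relation is a relation.
\<close>

lemma parameters_algebraically_independent:
  assumes ps: "parameter_sequence d xs"
  shows "algebraically_independent k A xs"
  unfolding algebraically_independent_def
proof (intro allI impI ballI)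
  fix E c es0
  assume H: "finite E \<and> E \<subseteq> {es. length es = length xs} \<and> c \<in> E \<rightarrow> carrier k \<and>
    finsum A (\<lambda>es. c es \<odot> monomial_eval A xs es) E = \<zero>" and es0: "es0 \<in> E"
  have xs: "set xs \<subseteq> G d" using ps unfolding parameter_sequence_def by simp
  then have xc: "set xs \<subseteq> carrier A" by auto
  have E: "finite E" "E \<subseteq> {es. length es = length xs}" and c: "c \<in> E \<rightarrow> carrier k" using H by auto
  note terms = poly_value_terms[OF xc E(2) c]
  show "c es0 = \<zero>\<^bsub>k\<^esub>"
  proof (cases "xs = []")
    case True
    then have "E = {[]}" using E es0 by auto
    moreover have "c [] \<in> carrier k" using c es0 \<open>E = {[]}\<close> by auto
    ultimately have "c [] \<odot> \<one> = \<zero>" using H True by (simp add: Pi_def)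
    then show ?thesis using scalar_nonzero \<open>c [] \<in> carrier k\<close> es0 \<open>E = {[]}\<close> by auto
  next
    case False
    define e where "e = sum_list es0"
    let ?Ee = "{es \<in> E. sum_list es = e}"
    have tG: "c es \<odot> monomial_eval A xs es \<in> G (d * sum_list es)" if "es \<in> E" for es
      using that E(2) c by (intro G_smult monomial_equal_degrees[OF xs]) auto
    have p: "part (c es \<odot> monomial_eval A xs es) (d * e) =
        (if sum_list es = e then c es \<odot> monomial_eval A xs es else \<zero>)" if "es \<in> E" for es
      using part_homogeneous[OF tG[OF that], of "d * e"] d_pos by auto
    have "\<zero> = part (finsum A (\<lambda>es. c es \<odot> monomial_eval A xs es) E) (d * e)" using H by simp
    also have "\<dots> = finsum A (\<lambda>es. part (c es \<odot> monomial_eval A xs es) (d * e)) E"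
      by (rule part_finsum[OF terms])
    also have "\<dots> = finsum A (\<lambda>es. part (c es \<odot> monomial_eval A xs es) (d * e)) ?Ee"
      by (rule A.finsum_expand_support[symmetric, OF E(1)])
        (use p terms in \<open>auto simp: Pi_iff\<close>)
    also have "\<dots> = poly_value xs c ?Ee"
      unfolding poly_value_def by (rule M.finsum_cong') (use p terms in \<open>auto simp: Pi_iff\<close>)
    finally have z: "poly_value xs c ?Ee = \<zero>" by simp
    show ?thesis
      by (rule relation_trivial[where pre = "[]" and ys = xs and E = ?Ee and e = e and N = 0])
        (use ps False E c es0 z in \<open>auto simp: e_def A.Idl_empty\<close>)
  qed
qed

lemma parameters_filter_regular:
  assumes ps: "parameter_sequence d xs"
  shows "filter_regular A G xs"
  unfolding filter_regular_def Let_def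
proof (intro conjI allI impI)
  have xs: "set xs \<subseteq> G d" using ps unfolding parameter_sequence_def by simp
  then show "set xs \<subseteq> homogeneous_positive G"
    using d_pos unfolding homogeneous_positive_def by (auto intro!: bexI[of _ d])
  fix i assume i: "i < length xs"
  let ?I = "Idl (set (take i xs))"
  have tc: "set (take i xs) \<subseteq> carrier A" using xs set_take_subset[of i xs] by auto
  interpret J: ideal ?I A using tc by (rule A.genideal_ideal)
  have xi: "xs ! i \<in> carrier A" using xs i nth_mem by blast
  obtain N where N: "\<And>n u. \<lbrakk> n > N; u \<in> G n; xs ! i \<otimes> u \<in> graded_idl (take i xs) (d + n) \<rbrakk>
      \<Longrightarrow> u \<in> graded_idl (take i xs) n"
    using ps i unfolding parameter_sequence_def eventually_regular_def by blast
  have "annihilator (A Quot ?I) (?I +> xs ! i) \<inter> quotient_grading A G ?I n \<subseteq> {\<zero>\<^bsub>A Quot ?I\<^esub>}" if n: "n > N" for n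
  proof
    fix U assume U: "U \<in> annihilator (A Quot ?I) (?I +> xs ! i) \<inter> quotient_grading A G ?I n"
    then obtain y where y: "y \<in> G n" "U = ?I +> y" unfolding quotient_grading_def by auto
    note yc = G_carrier[OF y(1)]
    have "(?I +> xs ! i) \<otimes>\<^bsub>A Quot ?I\<^esub> (?I +> y) = \<zero>\<^bsub>A Quot ?I\<^esub>"
      using U unfolding annihilator_def y(2) by simp
    then have "?I +> (xs ! i \<otimes> y) = ?I"
      using J.rcoset_mult_add[OF xi yc] by (simp add: FactRing_def)
    then have "xs ! i \<otimes> y \<in> ?I" using xi yc by (intro J.rcos_const_imp_mem) auto
    moreover have "xs ! i \<in> G d" using xs i nth_mem by blast
    ultimately have "xs ! i \<otimes> y \<in> graded_idl (take i xs) (d + n)"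
      using mult_degree[OF _ y(1)] by (simp add: graded_idl_def)
    then have "y \<in> ?I" using N[OF n y(1)] by (simp add: graded_idl_def)
    then show "U \<in> {\<zero>\<^bsub>A Quot ?I\<^esub>}" using J.a_rcos_const unfolding y(2) by (simp add: FactRing_def)
  qed
  then show "bounded_degree (A Quot ?I) (quotient_grading A G ?I) (annihilator (A Quot ?I) (?I +> xs ! i))"
    unfolding bounded_degree_def by blast
qed

lemma parameters_system:
  assumes ps: "parameter_sequence d xs" and cof: "cofinite_ideal (graded_idl xs)"
  shows "system_of_parameters k A G xs"
  using finitely_generated_over_parameters[OF assms] parameters_algebraically_independent[OF ps]
    parameters_filter_regular[OF ps]
  unfolding system_of_parameters_def filter_regular_def by simp

end

section \<open>Extension of scalars\<close>

lemma ring_cong: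
  fixes R :: "('x, 'r) ring_scheme" and R' :: "('x, 's) ring_scheme"
  assumes "ring R" "carrier R' = carrier R" "monoid.mult R' = monoid.mult R" "monoid.one R' = monoid.one R"
    "ring.zero R' = ring.zero R" "ring.add R' = ring.add R"
  shows "ring R'"
proof -
  interpret R: ring R by fact
  have "abelian_group R'"
  proof (rule abelian_groupI)
    fix x assume "x \<in> carrier R'"
    then show "\<exists>y \<in> carrier R'. y \<oplus>\<^bsub>R'\<^esub> x = \<zero>\<^bsub>R'\<^esub>"
      using assms by (intro bexI[of _ "\<ominus>\<^bsub>R\<^esub> x"]) (auto simp: R.l_neg)
  qed (use assms in \<open>auto simp: R.a_ac\<close>)
  moreover have "Group.monoid R'" by (rule monoidI) (use assms in \<open>auto simp: R.m_assoc\<close>)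
  ultimately show ?thesis by (rule ringI) (use assms in \<open>auto simp: R.l_distr R.r_distr\<close>)
qed

lemma additive_finsum:
  assumes "abelian_group R" "abelian_group S" and f: "f \<in> carrier R \<rightarrow> carrier S"
    and add: "\<And>x y. \<lbrakk> x \<in> carrier R; y \<in> carrier R \<rbrakk> \<Longrightarrow> f (x \<oplus>\<^bsub>R\<^esub> y) = f x \<oplus>\<^bsub>S\<^esub> f y"
    and zero: "f \<zero>\<^bsub>R\<^esub> = \<zero>\<^bsub>S\<^esub>" and g: "g \<in> I \<rightarrow> carrier R"
  shows "f (finsum R g I) = finsum S (\<lambda>i. f (g i)) I"
proof -
  interpret R: abelian_group R by fact
  interpret S: abelian_group S by fact
  show ?thesis
    using g
  proof (induction I rule: infinite_finite_induct)
    case (insert i I)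
    then have "g i \<in> carrier R" "g \<in> I \<rightarrow> carrier R" "(\<lambda>i. f (g i)) \<in> I \<rightarrow> carrier S" "f (g i) \<in> carrier S"
      using f by auto
    then show ?case using insert by (simp add: add)
  qed (simp_all add: zero)
qed

lemma formal_mult_of [simp]:
  "formal_mult K A (frag_of (c, x)) (frag_of (c', y)) = frag_of (c \<otimes>\<^bsub>K\<^esub> c', x \<otimes>\<^bsub>A\<^esub> y)"
  by (simp add: formal_mult_def)

lemma formal_mult_left:
  "formal_mult K A 0 v = 0" "formal_mult K A (u + u') v = formal_mult K A u v + formal_mult K A u' v"
  "formal_mult K A (u - u') v = formal_mult K A u v - formal_mult K A u' v"
  by (simp_all add: formal_mult_def frag_extend_add frag_extend_diff)

lemma formal_mult_right:
  "formal_mult K A u 0 = 0" "formal_mult K A u (v - v') = formal_mult K A u v - formal_mult K A u v'"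
  "formal_mult K A u (v + v') = formal_mult K A u v + formal_mult K A u v'"
proof -
  have "formal_mult K A u 0 = 0 \<and> formal_mult K A u (v - v') = formal_mult K A u v - formal_mult K A u v' \<and>
    formal_mult K A u (v + v') = formal_mult K A u v + formal_mult K A u v'"
    using subset_UNIV[of "Poly_Mapping.keys u"]
  proof (induction u rule: frag_induction)
    case (one p)
    then show ?case by (cases p) (simp add: formal_mult_def frag_extend_diff frag_extend_add)
  next
    case (diff a b) then show ?case by (simp add: formal_mult_left)
  qed (simp_all add: formal_mult_left)
  then show "formal_mult K A u 0 = 0" "formal_mult K A u (v - v') = formal_mult K A u v - formal_mult K A u v'"
    "formal_mult K A u (v + v') = formal_mult K A u v + formal_mult K A u v'" by auto
qed

lemma keys_diff_subset: "\<lbrakk> Poly_Mapping.keys a \<subseteq> S; Poly_Mapping.keys b \<subseteq> S \<rbrakk> \<Longrightarrow> Poly_Mapping.keys (a - b) \<subseteq> S"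
  for a b :: "'x \<Rightarrow>\<^sub>0 int"
  using keys_diff[of a b] by blast

lemma keys_add_subset: "\<lbrakk> Poly_Mapping.keys a \<subseteq> S; Poly_Mapping.keys b \<subseteq> S \<rbrakk> \<Longrightarrow> Poly_Mapping.keys (a + b) \<subseteq> S"
  for a b :: "'x \<Rightarrow>\<^sub>0 int"
  using Poly_Mapping.keys_add[of a b] by blast

locale scalar_extension = graded_algebra k A G + K: field K
  for k :: "('a, 'm) ring_scheme" and A :: "('a, 'b, 'n) module_scheme" (structure)
    and G :: "nat \<Rightarrow> 'b set" and K :: "('c, 'l) ring_scheme" +
  fixes \<iota> :: "'a \<Rightarrow> 'c"
  assumes hom: "\<iota> \<in> ring_hom k K"
begin

abbreviation "fm \<equiv> formal_mult K A"
abbreviation "Z \<equiv> tensor_kernel k \<iota> K A"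
abbreviation "cls \<equiv> tensor_class k \<iota> K A"
abbreviation "B \<equiv> base_change k \<iota> K A"
abbreviation "GB \<equiv> base_change_grading k \<iota> K A G"

abbreviation (input) Pairs :: "('c \<times> 'b) set" where "Pairs \<equiv> carrier K \<times> carrier A"
abbreviation formal :: "(('c \<times> 'b) \<Rightarrow>\<^sub>0 int) \<Rightarrow> bool" where "formal u \<equiv> Poly_Mapping.keys u \<subseteq> Pairs"

text \<open>
  The integral monoid ring of the multiplicative monoid \<open>K \<times> A\<close>. The base change is its quotient by the
  ideal of bilinearity relations (\<open>base_change_eq_quotient\<close>), which gives its ring structure.
\<close>

definition formal_ring :: "(('c \<times> 'b) \<Rightarrow>\<^sub>0 int) ring" where
  "formal_ring = \<lparr> carrier = {u. formal u}, monoid.mult = fm, monoid.one = frag_of (\<one>\<^bsub>K\<^esub>, \<one>), ring.zero = 0, ring.add = (+) \<rparr>"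

lemma hom_closed: "a \<in> carrier k \<Longrightarrow> \<iota> a \<in> carrier K"
  using hom by (rule ring_hom_closed)

lemma formal_mult_closed:
  assumes "formal u" "formal v" shows "formal (fm u v)"
  using assms(1)
proof (induction u rule: frag_induction)
  case (one p)
  obtain c x where p: "p = (c, x)" "c \<in> carrier K" "x \<in> carrier A" using one by auto
  show ?case
    using assms(2)
  proof (induction v rule: frag_induction)
    case (one q) then show ?case by (cases q) (simp add: p)
  next
    case (diff a b) then show ?case by (simp add: formal_mult_right keys_diff_subset)
  qed (simp add: formal_mult_right)
next
  case (diff a b) then show ?case by (simp add: formal_mult_left keys_diff_subset)
qed (simp add: formal_mult_left)

lemma formal_mult_assoc:
  assumes "formal u" "formal v" "formal w" shows "fm (fm u v) w = fm u (fm v w)"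
  using assms(1)
proof (induction u rule: frag_induction)
  case (one p)
  show ?case
    using assms(2)
  proof (induction v rule: frag_induction)
    case q: (one q)
    show ?case
      using assms(3)
    proof (induction w rule: frag_induction)
      case r: (one r)
      then show ?case using one q by (cases p, cases q, cases r) (simp add: K.m_assoc A.m_assoc)
    next
      case (diff a b) then show ?case by (simp add: formal_mult_right)
    qed (simp add: formal_mult_right)
  next
    case (diff a b) then show ?case by (simp add: formal_mult_right formal_mult_left)
  qed (simp add: formal_mult_right formal_mult_left)
next
  case (diff a b) then show ?case by (simp add: formal_mult_left)
qed (simp add: formal_mult_left)

lemma formal_mult_one:
  assumes "formal u"
  shows "fm (frag_of (\<one>\<^bsub>K\<^esub>, \<one>)) u = u" "fm u (frag_of (\<one>\<^bsub>K\<^esub>, \<one>)) = u"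
proof -
  have "fm (frag_of (\<one>\<^bsub>K\<^esub>, \<one>)) u = u \<and> fm u (frag_of (\<one>\<^bsub>K\<^esub>, \<one>)) = u"
    using assms
  proof (induction u rule: frag_induction)
    case (one p) then show ?case by (cases p) simp
  next
    case (diff a b) then show ?case by (simp add: formal_mult_left formal_mult_right)
  qed (simp add: formal_mult_left formal_mult_right)
  then show "fm (frag_of (\<one>\<^bsub>K\<^esub>, \<one>)) u = u" "fm u (frag_of (\<one>\<^bsub>K\<^esub>, \<one>)) = u" by auto
qed

lemma ring_formal_ring: "ring formal_ring"
proof (rule ringI)
  show "abelian_group formal_ring"
  proof (rule abelian_groupI)
    fix u assume "u \<in> carrier formal_ring"
    then show "\<exists>v \<in> carrier formal_ring. v \<oplus>\<^bsub>formal_ring\<^esub> u = \<zero>\<^bsub>formal_ring\<^esub>"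
      by (intro bexI[of _ "- u"]) (auto simp: formal_ring_def)
  qed (auto simp: formal_ring_def add.assoc add.commute dest!: subsetD[OF Poly_Mapping.keys_add])
  show "Group.monoid formal_ring"
    by (rule monoidI)
      (simp_all add: formal_ring_def formal_mult_closed formal_mult_assoc formal_mult_one)
qed (simp_all add: formal_ring_def formal_mult_left formal_mult_right)

lemma add_monoid_formal_ring: "add_monoid formal_ring = tensor_free K A"
  by (simp add: formal_ring_def free_Abelian_group_def)

lemma relators_formal: "tensor_relators k \<iota> K A \<subseteq> carrier (tensor_free K A)"
  unfolding tensor_relators_def
  by (auto simp: hom_closed keys_frag_of dest!: subsetD[OF keys_diff])

lemma subgroup_kernel: "subgroup Z (tensor_free K A)"
  unfolding tensor_kernel_def by (rule group.generate_is_subgroup[OF group_free_Abelian_group relators_formal])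

lemma kernel_facts: "z \<in> Z \<Longrightarrow> formal z" "0 \<in> Z" "\<lbrakk> z \<in> Z; w \<in> Z \<rbrakk> \<Longrightarrow> z + w \<in> Z"
    "z \<in> Z \<Longrightarrow> - z \<in> Z" "\<lbrakk> z \<in> Z; w \<in> Z \<rbrakk> \<Longrightarrow> z - w \<in> Z"
proof -
  note s = subgroup.subset[OF subgroup_kernel]
  show f: "z \<in> Z \<Longrightarrow> formal z" for z using subsetD[OF s, of z] by (simp only: carrier_free_Abelian_group_iff)
  show "0 \<in> Z" using subgroup.one_closed[OF subgroup_kernel] by simp
  show add: "\<lbrakk> z \<in> Z; w \<in> Z \<rbrakk> \<Longrightarrow> z + w \<in> Z" for z w using subgroup.m_closed[OF subgroup_kernel, of z w] by simp
  show neg: "z \<in> Z \<Longrightarrow> - z \<in> Z" for z using subgroup.m_inv_closed[OF subgroup_kernel, of z] f[of z] by simp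
  show "\<lbrakk> z \<in> Z; w \<in> Z \<rbrakk> \<Longrightarrow> z - w \<in> Z" using add[OF _ neg, of z w] by simp
qed

lemma relator_in_kernel: "r \<in> tensor_relators k \<iota> K A \<Longrightarrow> r \<in> Z"
  unfolding tensor_kernel_def by (rule generate.incl)

text \<open>
  The kernel is generated as a group by the relators, so an additive map preserves it as soon as it
  sends relators into it.
\<close>

lemma kernel_map:
  assumes h0: "h 0 = 0" and hdiff: "\<And>u v. h (u - v) = h u - h v"
    and rel: "\<And>r. r \<in> tensor_relators k \<iota> K A \<Longrightarrow> h r \<in> Z" and z: "z \<in> Z"
  shows "h z \<in> Z"
proof -
  have neg: "h (- u) = - h u" for u using hdiff[of 0 u] h0 by simp
  have add: "h (u + v) = h u + h v" for u v using hdiff[of u "- v"] neg by simp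
  show ?thesis
    using z[unfolded tensor_kernel_def]
  proof (induction z rule: generate.induct)
    case one then show ?case using h0 kernel_facts(2) by simp
  next
    case (incl r) then show ?case by (rule rel)
  next
    case (inv r)
    then have "inv\<^bsub>tensor_free K A\<^esub> r = - r" using relators_formal by auto
    then show ?case using neg kernel_facts(4)[OF rel[OF inv]] by simp
  next
    case (eng u v) then show ?case using add kernel_facts(3) by simp
  qed
qed

lemma tensor_relators_cases [consumes 1, case_names left right balanced]:
  assumes "r \<in> tensor_relators k \<iota> K A"
    and "\<And>c c' x. \<lbrakk> c \<in> carrier K; c' \<in> carrier K; x \<in> carrier A;
      r = frag_of (c \<oplus>\<^bsub>K\<^esub> c', x) - frag_of (c, x) - frag_of (c', x) \<rbrakk> \<Longrightarrow> P"
    and "\<And>c x x'. \<lbrakk> c \<in> carrier K; x \<in> carrier A; x' \<in> carrier A;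
      r = frag_of (c, x \<oplus> x') - frag_of (c, x) - frag_of (c, x') \<rbrakk> \<Longrightarrow> P"
    and "\<And>c a x. \<lbrakk> c \<in> carrier K; a \<in> carrier k; x \<in> carrier A;
      r = frag_of (c \<otimes>\<^bsub>K\<^esub> \<iota> a, x) - frag_of (c, a \<odot> x) \<rbrakk> \<Longrightarrow> P"
  shows P
  using assms(1) unfolding tensor_relators_def by (elim UnE CollectE exE conjE)
    (rule assms(2), assumption+, rule assms(3), assumption+, rule assms(4), assumption+)

lemma tensor_relatorsI:
  "\<lbrakk> c \<in> carrier K; c' \<in> carrier K; x \<in> carrier A \<rbrakk> \<Longrightarrow>
    frag_of (c \<oplus>\<^bsub>K\<^esub> c', x) - frag_of (c, x) - frag_of (c', x) \<in> tensor_relators k \<iota> K A"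
  "\<lbrakk> c \<in> carrier K; x \<in> carrier A; x' \<in> carrier A \<rbrakk> \<Longrightarrow>
    frag_of (c, x \<oplus> x') - frag_of (c, x) - frag_of (c, x') \<in> tensor_relators k \<iota> K A"
  "\<lbrakk> c \<in> carrier K; a \<in> carrier k; x \<in> carrier A \<rbrakk> \<Longrightarrow>
    frag_of (c \<otimes>\<^bsub>K\<^esub> \<iota> a, x) - frag_of (c, a \<odot> x) \<in> tensor_relators k \<iota> K A"
  unfolding tensor_relators_def by blast+

lemma formal_mult_relator:
  assumes r: "r \<in> tensor_relators k \<iota> K A" and p: "d \<in> carrier K" "w \<in> carrier A"
  shows "fm (frag_of (d, w)) r \<in> Z" "fm r (frag_of (d, w)) \<in> Z"
proof -
  have "fm (frag_of (d, w)) r \<in> tensor_relators k \<iota> K A \<and> fm r (frag_of (d, w)) \<in> tensor_relators k \<iota> K A"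
    using r
  proof (cases rule: tensor_relators_cases)
    case (left c c' x)
    then show ?thesis
      using tensor_relatorsI(1)[of "d \<otimes>\<^bsub>K\<^esub> c" "d \<otimes>\<^bsub>K\<^esub> c'" "w \<otimes> x"]
        tensor_relatorsI(1)[of "c \<otimes>\<^bsub>K\<^esub> d" "c' \<otimes>\<^bsub>K\<^esub> d" "x \<otimes> w"] p
      by (simp add: formal_mult_left formal_mult_right K.r_distr K.l_distr)
  next
    case (right c x x')
    then show ?thesis
      using tensor_relatorsI(2)[of "d \<otimes>\<^bsub>K\<^esub> c" "w \<otimes> x" "w \<otimes> x'"]
        tensor_relatorsI(2)[of "c \<otimes>\<^bsub>K\<^esub> d" "x \<otimes> w" "x' \<otimes> w"] p
      by (simp add: formal_mult_left formal_mult_right A.r_distr A.l_distr)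
  next
    case (balanced c a x)
    have "d \<otimes>\<^bsub>K\<^esub> (c \<otimes>\<^bsub>K\<^esub> \<iota> a) = (d \<otimes>\<^bsub>K\<^esub> c) \<otimes>\<^bsub>K\<^esub> \<iota> a" "(c \<otimes>\<^bsub>K\<^esub> \<iota> a) \<otimes>\<^bsub>K\<^esub> d = (c \<otimes>\<^bsub>K\<^esub> d) \<otimes>\<^bsub>K\<^esub> \<iota> a"
      using p balanced hom_closed by (simp_all add: K.m_ac)
    moreover have "w \<otimes> (a \<odot> x) = a \<odot> (w \<otimes> x)" "(a \<odot> x) \<otimes> w = a \<odot> (x \<otimes> w)"
      using smult_mult_left[of a x w] smult_mult_right[of a w x] p balanced by auto
    ultimately show ?thesis
      using tensor_relatorsI(3)[of "d \<otimes>\<^bsub>K\<^esub> c" a "w \<otimes> x"] tensor_relatorsI(3)[of "c \<otimes>\<^bsub>K\<^esub> d" a "x \<otimes> w"] p balanced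
      by (simp add: formal_mult_left formal_mult_right)
  qed
  then show "fm (frag_of (d, w)) r \<in> Z" "fm r (frag_of (d, w)) \<in> Z" using relator_in_kernel by auto
qed

text \<open>
  Multiplying a relator by a pair gives a relator again.
\<close>

lemma ideal_kernel: "ideal Z formal_ring"
proof (rule idealI[OF ring_formal_ring])
  show "subgroup Z (add_monoid formal_ring)" unfolding add_monoid_formal_ring by (rule subgroup_kernel)
  fix z u assume z: "z \<in> Z" and "u \<in> carrier formal_ring"
  then have u: "formal u" by (simp add: formal_ring_def)
  have "fm u r \<in> Z \<and> fm r u \<in> Z" if r: "r \<in> tensor_relators k \<iota> K A" for r
    using u
  proof (induction u rule: frag_induction)
    case (one p) then show ?case using formal_mult_relator[OF r] by (cases p) simp
  next
    case (diff a b) then show ?case by (simp add: formal_mult_left formal_mult_right kernel_facts(5))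
  qed (simp add: formal_mult_left formal_mult_right kernel_facts(2))
  then have "fm u z \<in> Z" "fm z u \<in> Z"
    using kernel_map[of "fm u", OF formal_mult_right(1,2) _ z]
      kernel_map[of "\<lambda>z. fm z u", OF formal_mult_left(1,3) _ z] by auto
  then show "u \<otimes>\<^bsub>formal_ring\<^esub> z \<in> Z" "z \<otimes>\<^bsub>formal_ring\<^esub> u \<in> Z" by (simp_all add: formal_ring_def)
qed

lemma cls_eq: "cls u = Z +>\<^bsub>formal_ring\<^esub> u"
  unfolding tensor_class_def a_r_coset_def add_monoid_formal_ring ..

lemma base_change_eq_quotient:
  "carrier B = carrier (formal_ring Quot Z)" "monoid.mult B = monoid.mult (formal_ring Quot Z)"
  "monoid.one B = monoid.one (formal_ring Quot Z)" "ring.zero B = ring.zero (formal_ring Quot Z)" "ring.add B = ring.add (formal_ring Quot Z)"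
proof -
  have "monoid.mult formal_ring = fm" "monoid.one formal_ring = frag_of (\<one>\<^bsub>K\<^esub>, \<one>)" by (simp_all add: formal_ring_def)
  then show "carrier B = carrier (formal_ring Quot Z)" "monoid.mult B = monoid.mult (formal_ring Quot Z)"
  "monoid.one B = monoid.one (formal_ring Quot Z)" "ring.zero B = ring.zero (formal_ring Quot Z)" "ring.add B = ring.add (formal_ring Quot Z)"
    unfolding base_change_def FactRing_def rcoset_mult_def cls_eq FactGroup_def A_RCOSETS_def
      add_monoid_formal_ring set_add_def
    by (simp_all add: fun_eq_iff)
qed

sublocale B: ring B
  using ideal.quotient_is_ring[OF ideal_kernel] base_change_eq_quotient by (rule ring_cong)

lemma cls_hom: "cls \<in> ring_hom formal_ring B"
proof -
  have "cls = (+>\<^bsub>formal_ring\<^esub>) Z" by (rule ext) (rule cls_eq)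
  then show ?thesis
    using ideal.rcos_ring_hom[OF ideal_kernel] base_change_eq_quotient unfolding ring_hom_def by simp
qed

lemma cls_facts:
  "formal u \<Longrightarrow> cls u \<in> carrier B"
  "\<lbrakk> formal u; formal v \<rbrakk> \<Longrightarrow> cls (u + v) = cls u \<oplus>\<^bsub>B\<^esub> cls v"
  "\<lbrakk> formal u; formal v \<rbrakk> \<Longrightarrow> cls (fm u v) = cls u \<otimes>\<^bsub>B\<^esub> cls v"
  "cls (frag_of (\<one>\<^bsub>K\<^esub>, \<one>)) = \<one>\<^bsub>B\<^esub>"
  using ring_hom_closed[OF cls_hom, of u] ring_hom_add[OF cls_hom, of u v] ring_hom_mult[OF cls_hom, of u v]
    ring_hom_one[OF cls_hom] by (simp_all add: formal_ring_def)

lemma cls_zero: "cls 0 = \<zero>\<^bsub>B\<^esub>"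
  using ring_hom_zero[OF cls_hom ring_formal_ring B.ring_axioms] by (simp add: formal_ring_def)

lemma cls_minus: "formal u \<Longrightarrow> cls (- u) = \<ominus>\<^bsub>B\<^esub> cls u"
  using cls_facts(2)[of "- u" u] cls_zero cls_facts(1)[of u] cls_facts(1)[of "- u"]
  by (intro B.minus_equality[symmetric]) auto

lemma cls_surj: assumes "U \<in> carrier B" obtains u where "formal u" "U = cls u"
  using assms unfolding base_change_eq_quotient(1) FactRing_def A_RCOSETS_def add_monoid_formal_ring
    RCOSETS_def tensor_class_def by auto

lemma cls_mem: "v \<in> cls u \<longleftrightarrow> v - u \<in> Z"
proof -
  have "v \<in> cls u \<longleftrightarrow> (\<exists>z \<in> Z. v = z + u)" by (auto simp: tensor_class_def r_coset_def)
  also have "\<dots> \<longleftrightarrow> v - u \<in> Z" by (auto intro: bexI[of _ "v - u"])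
  finally show ?thesis .
qed

lemma cls_eqI: assumes "formal u" "formal v" "v - u \<in> Z" shows "cls v = cls u"
proof -
  have "cls (v - u) = Z"
    using ideal.axioms(1)[OF ideal_kernel] assms(3) unfolding cls_eq
    by (simp add: abelian_subgroup.a_rcos_const abelian_subgroupI3 ring.is_abelian_group[OF ring_formal_ring])
  also have "\<dots> = cls 0" by (auto simp: cls_mem)
  finally have "cls (v - u) = \<zero>\<^bsub>B\<^esub>" using cls_zero by simp
  moreover have "cls (v - u + u) = cls (v - u) \<oplus>\<^bsub>B\<^esub> cls u"
    by (rule cls_facts(2)[OF keys_diff_subset[OF assms(2,1)] assms(1)])
  ultimately show ?thesis using cls_facts(1)[OF assms(1)] by simp
qed

text \<open>
  The pure tensor \<open>c \<otimes> x\<close>.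
\<close>

definition tens :: "'c \<Rightarrow> 'b \<Rightarrow> (('c \<times> 'b) \<Rightarrow>\<^sub>0 int) set" where
  "tens c x = cls (frag_of (c, x))"

lemma tens_closed [simp]: "\<lbrakk> c \<in> carrier K; x \<in> carrier A \<rbrakk> \<Longrightarrow> tens c x \<in> carrier B"
  unfolding tens_def by (rule cls_facts) simp

lemma tens_add_left:
  assumes "c \<in> carrier K" "c' \<in> carrier K" "x \<in> carrier A"
  shows "tens (c \<oplus>\<^bsub>K\<^esub> c') x = tens c x \<oplus>\<^bsub>B\<^esub> tens c' x"
proof -
  have "tens (c \<oplus>\<^bsub>K\<^esub> c') x = cls (frag_of (c, x) + frag_of (c', x))"
    unfolding tens_def
    by (rule cls_eqI) (use assms relator_in_kernel[OF tensor_relatorsI(1)[OF assms]] in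
      \<open>auto dest!: subsetD[OF Poly_Mapping.keys_add] simp: diff_diff_eq keys_frag_of\<close>)
  then show ?thesis unfolding tens_def using assms by (simp add: cls_facts)
qed

lemma tens_add_right:
  assumes "c \<in> carrier K" "x \<in> carrier A" "x' \<in> carrier A"
  shows "tens c (x \<oplus> x') = tens c x \<oplus>\<^bsub>B\<^esub> tens c x'"
proof -
  have "tens c (x \<oplus> x') = cls (frag_of (c, x) + frag_of (c, x'))"
    unfolding tens_def
    by (rule cls_eqI) (use assms relator_in_kernel[OF tensor_relatorsI(2)[OF assms]] in
      \<open>auto dest!: subsetD[OF Poly_Mapping.keys_add] simp: diff_diff_eq keys_frag_of\<close>)
  then show ?thesis unfolding tens_def using assms by (simp add: cls_facts)
qed

lemma tens_balanced:
  assumes "c \<in> carrier K" "a \<in> carrier k" "x \<in> carrier A"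
  shows "tens (c \<otimes>\<^bsub>K\<^esub> \<iota> a) x = tens c (a \<odot> x)"
  unfolding tens_def
  by (rule cls_eqI) (use assms relator_in_kernel[OF tensor_relatorsI(3)[OF assms]] hom_closed in auto)

lemma tens_mult:
  assumes "c \<in> carrier K" "c' \<in> carrier K" "x \<in> carrier A" "y \<in> carrier A"
  shows "tens c x \<otimes>\<^bsub>B\<^esub> tens c' y = tens (c \<otimes>\<^bsub>K\<^esub> c') (x \<otimes> y)"
  unfolding tens_def using assms cls_facts(3)[of "frag_of (c, x)" "frag_of (c', y)"] by simp

lemma tens_one: "tens \<one>\<^bsub>K\<^esub> \<one> = \<one>\<^bsub>B\<^esub>"
  unfolding tens_def by (rule cls_facts)

lemma tens_zero: "c \<in> carrier K \<Longrightarrow> tens c \<zero> = \<zero>\<^bsub>B\<^esub>" "x \<in> carrier A \<Longrightarrow> tens \<zero>\<^bsub>K\<^esub> x = \<zero>\<^bsub>B\<^esub>"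
  using tens_add_right[of c \<zero> \<zero>] tens_add_left[of "\<zero>\<^bsub>K\<^esub>" "\<zero>\<^bsub>K\<^esub>" x] tens_closed[of c \<zero>] tens_closed[of "\<zero>\<^bsub>K\<^esub>" x]
  by (simp_all add: B.add.l_cancel_one')

lemma tens_minus:
  assumes "c \<in> carrier K" "x \<in> carrier A"
  shows "tens (\<ominus>\<^bsub>K\<^esub> c) x = \<ominus>\<^bsub>B\<^esub> tens c x" "tens c (\<ominus> x) = \<ominus>\<^bsub>B\<^esub> tens c x"
proof -
  have "tens (\<ominus>\<^bsub>K\<^esub> c) x \<oplus>\<^bsub>B\<^esub> tens c x = \<zero>\<^bsub>B\<^esub>"
    using assms tens_add_left[of "\<ominus>\<^bsub>K\<^esub> c" c x] tens_zero by (simp add: K.l_neg)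
  then show "tens (\<ominus>\<^bsub>K\<^esub> c) x = \<ominus>\<^bsub>B\<^esub> tens c x" using assms by (intro B.minus_equality[symmetric]) auto
  have "tens c (\<ominus> x) \<oplus>\<^bsub>B\<^esub> tens c x = \<zero>\<^bsub>B\<^esub>"
    using assms tens_add_right[of c "\<ominus> x" x] tens_zero by (simp add: M.l_neg)
  then show "tens c (\<ominus> x) = \<ominus>\<^bsub>B\<^esub> tens c x" using assms by (intro B.minus_equality[symmetric]) auto
qed

text \<open>
  The set \<open>Y\<close> is closed under negation, so the negative of a pure tensor is a pure tensor of the same
  kind and sums suffice.
\<close>

lemma cls_induct:
  assumes "Poly_Mapping.keys u \<subseteq> C \<times> Y" and CY: "C \<subseteq> carrier K" "Y \<subseteq> carrier A"
    and minus: "\<And>x. x \<in> Y \<Longrightarrow> \<ominus> x \<in> Y"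
    and "P \<zero>\<^bsub>B\<^esub>" and tens: "\<And>c x. \<lbrakk> c \<in> C; x \<in> Y \<rbrakk> \<Longrightarrow> P (tens c x)"
    and add: "\<And>U V. \<lbrakk> U \<in> carrier B; V \<in> carrier B; P U; P V \<rbrakk> \<Longrightarrow> P (U \<oplus>\<^bsub>B\<^esub> V)"
  shows "P (cls u)"
proof -
  have "P (cls u) \<and> P (cls (- u))"
    using assms(1)
  proof (rule free_Abelian_group_induct)
    show "P (cls 0) \<and> P (cls (- 0))" using assms(5) cls_zero by simp
  next
    fix u v assume uv: "Poly_Mapping.keys u \<subseteq> C \<times> Y" "Poly_Mapping.keys v \<subseteq> C \<times> Y"
      "P (cls u) \<and> P (cls (- u))" "P (cls v) \<and> P (cls (- v))"
    then have f: "formal u" "formal v" using CY by blast+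
    have "cls (u - v) = cls u \<oplus>\<^bsub>B\<^esub> cls (- v)" "cls (- (u - v)) = cls v \<oplus>\<^bsub>B\<^esub> cls (- u)"
      using f cls_facts(2)[of u "- v"] cls_facts(2)[of v "- u"] by auto
    then show "P (cls (u - v)) \<and> P (cls (- (u - v)))" using uv(3,4) f add cls_facts(1) by simp
  next
    fix p assume "p \<in> C \<times> Y"
    then obtain c x where p: "p = (c, x)" "c \<in> C" "x \<in> Y" by auto
    then have "cls (- frag_of p) = tens c (\<ominus> x)"
      using CY cls_minus[of "frag_of p"] tens_minus(2)[of c x] by (auto simp: tens_def)
    then show "P (cls (frag_of p)) \<and> P (cls (- frag_of p))"
      using tens[of c x] tens[of c "\<ominus> x"] minus p by (simp add: tens_def)
  qed
  then show ?thesis by simp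
qed

lemma tensor_induct [consumes 1, case_names zero tens add]:
  assumes "U \<in> carrier B" "P \<zero>\<^bsub>B\<^esub>" "\<And>c x. \<lbrakk> c \<in> carrier K; x \<in> carrier A \<rbrakk> \<Longrightarrow> P (tens c x)"
    "\<And>U V. \<lbrakk> U \<in> carrier B; V \<in> carrier B; P U; P V \<rbrakk> \<Longrightarrow> P (U \<oplus>\<^bsub>B\<^esub> V)"
  shows "P U"
proof -
  obtain u where "formal u" "U = cls u" using cls_surj[OF assms(1)] .
  then show ?thesis using cls_induct[of u "carrier K" "carrier A" P] assms(2-4) by auto
qed

lemma graded_tensor_induct [consumes 1, case_names zero tens add]:
  assumes "U \<in> GB n" "P \<zero>\<^bsub>B\<^esub>" "\<And>c x. \<lbrakk> c \<in> carrier K; x \<in> G n \<rbrakk> \<Longrightarrow> P (tens c x)"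
    "\<And>U V. \<lbrakk> U \<in> carrier B; V \<in> carrier B; P U; P V \<rbrakk> \<Longrightarrow> P (U \<oplus>\<^bsub>B\<^esub> V)"
  shows "P U"
proof -
  obtain u where "Poly_Mapping.keys u \<subseteq> carrier K \<times> G n" "U = cls u"
    using assms(1) unfolding base_change_grading_def by auto
  then show ?thesis using cls_induct[of u "carrier K" "G n" P] assms(2-4) G_subset G_minus by auto
qed

text \<open>
  A balanced biadditive map extends to formal sums of pairs; it kills the relators, hence the
  kernel.
\<close>

lemma universal_property:
  fixes H :: "('h, 'o) ring_scheme" and g :: "'c \<Rightarrow> 'b \<Rightarrow> 'h"
  assumes H: "abelian_group H"
    and closed: "\<And>c x. \<lbrakk> c \<in> carrier K; x \<in> carrier A \<rbrakk> \<Longrightarrow> g c x \<in> carrier H"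
    and left: "\<And>c c' x. \<lbrakk> c \<in> carrier K; c' \<in> carrier K; x \<in> carrier A \<rbrakk> \<Longrightarrow> g (c \<oplus>\<^bsub>K\<^esub> c') x = g c x \<oplus>\<^bsub>H\<^esub> g c' x"
    and right: "\<And>c x x'. \<lbrakk> c \<in> carrier K; x \<in> carrier A; x' \<in> carrier A \<rbrakk> \<Longrightarrow> g c (x \<oplus> x') = g c x \<oplus>\<^bsub>H\<^esub> g c x'"
    and bal: "\<And>c a x. \<lbrakk> c \<in> carrier K; a \<in> carrier k; x \<in> carrier A \<rbrakk> \<Longrightarrow> g (c \<otimes>\<^bsub>K\<^esub> \<iota> a) x = g c (a \<odot> x)"
  obtains \<Phi> where "\<Phi> \<in> carrier B \<rightarrow> carrier H"
    "\<And>U V. \<lbrakk> U \<in> carrier B; V \<in> carrier B \<rbrakk> \<Longrightarrow> \<Phi> (U \<oplus>\<^bsub>B\<^esub> V) = \<Phi> U \<oplus>\<^bsub>H\<^esub> \<Phi> V"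
    "\<Phi> \<zero>\<^bsub>B\<^esub> = \<zero>\<^bsub>H\<^esub>"
    "\<And>c x. \<lbrakk> c \<in> carrier K; x \<in> carrier A \<rbrakk> \<Longrightarrow> \<Phi> (tens c x) = g c x"
proof -
  interpret H: abelian_group H by fact
  have "case_prod g ` Pairs \<subseteq> carrier (add_monoid H)" using closed by auto
  then obtain h where h: "h \<in> Group.hom (tensor_free K A) (add_monoid H)"
    "\<And>p. p \<in> Pairs \<Longrightarrow> h (frag_of p) = case_prod g p"
    using comm_group.free_Abelian_group_universal[OF H.a_comm_group, of "case_prod g" Pairs] by blast
  have hc: "h u \<in> carrier H" if "formal u" for u using hom_in_carrier[OF h(1)] that by simp
  have hadd: "h (u + v) = h u \<oplus>\<^bsub>H\<^esub> h v" if "formal u" "formal v" for u v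
    using hom_mult[OF h(1), of u v] that by simp
  have h0: "h 0 = \<zero>\<^bsub>H\<^esub>" using hadd[of 0 0] hc[of 0] by (simp add: H.add.l_cancel_one')
  have hg: "h (frag_of (c, x)) = g c x" if "c \<in> carrier K" "x \<in> carrier A" for c x using h(2)[of "(c, x)"] that by simp
  have hdiff: "h (u - v) = \<zero>\<^bsub>H\<^esub>" if "formal u" "formal v" "h u = h v" for u v
  proof -
    have "h (u - v + v) = h (u - v) \<oplus>\<^bsub>H\<^esub> h v" by (rule hadd[OF keys_diff_subset[OF that(1,2)] that(2)])
    then have "h u = h (u - v) \<oplus>\<^bsub>H\<^esub> h v" by simp
    then show ?thesis using that hc keys_diff_subset[OF that(1,2)] by (simp add: H.add.l_cancel_one')
  qed
  have hrel: "h r = \<zero>\<^bsub>H\<^esub>" if "r \<in> tensor_relators k \<iota> K A" for r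
    using that
  proof (cases rule: tensor_relators_cases)
    case (left c c' x)
    have "h (frag_of (c \<oplus>\<^bsub>K\<^esub> c', x) - (frag_of (c, x) + frag_of (c', x))) = \<zero>\<^bsub>H\<^esub>"
      by (rule hdiff) (use left assms(3) hadd hg in \<open>auto dest!: subsetD[OF Poly_Mapping.keys_add] simp: keys_frag_of\<close>)
    then show ?thesis by (simp add: left diff_diff_eq)
  next
    case (right c x x')
    have "h (frag_of (c, x \<oplus> x') - (frag_of (c, x) + frag_of (c, x'))) = \<zero>\<^bsub>H\<^esub>"
      by (rule hdiff) (use right assms(4) hadd hg in \<open>auto dest!: subsetD[OF Poly_Mapping.keys_add] simp: keys_frag_of\<close>)
    then show ?thesis by (simp add: right diff_diff_eq)
  next
    case (balanced c a x)
    show ?thesis unfolding balanced(4) by (rule hdiff) (use balanced bal hom_closed hg in auto)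
  qed
  have hZ: "h z = \<zero>\<^bsub>H\<^esub>" if z: "z \<in> Z" for z
    using z[unfolded tensor_kernel_def]
  proof (induction z rule: generate.induct)
    case one then show ?case using h0 by simp
  next
    case (incl r) then show ?case by (rule hrel)
  next
    case (inv r)
    from subsetD[OF relators_formal this] have r: "formal r" by simp
    have "\<zero>\<^bsub>H\<^esub> = h (- r) \<oplus>\<^bsub>H\<^esub> h r" using hadd[of "- r" r] r h0 by simp
    then show ?case using hrel[OF inv] hc[of "- r"] r by simp
  next
    case (eng u v)
    then have "formal u" "formal v" using kernel_facts(1) unfolding tensor_kernel_def by blast+
    then show ?case using hadd eng by simp
  qed
  define \<Phi> where "\<Phi> U = h (SOME u. formal u \<and> U = cls u)" for U
  have \<Phi>: "\<Phi> (cls u) = h u" if u: "formal u" for u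
  proof -
    define v where "v = (SOME v. formal v \<and> cls u = cls v)"
    have "formal v \<and> cls u = cls v" unfolding v_def by (rule someI[of _ u]) (use u in simp)
    then have v: "formal v" and eq: "cls u = cls v" by auto
    have "v \<in> cls v" unfolding cls_mem using kernel_facts(2) by simp
    then have "v - u \<in> Z" unfolding eq[symmetric] cls_mem .
    then have "h (v - u) = \<zero>\<^bsub>H\<^esub>" by (rule hZ)
    moreover have "h (v - u + u) = h (v - u) \<oplus>\<^bsub>H\<^esub> h u"
      by (rule hadd[OF keys_diff_subset[OF v u] u])
    ultimately have "h v = h u" using hc[OF u] by simp
    then show ?thesis unfolding \<Phi>_def v_def .
  qed
  show thesis
  proof
    show "\<Phi> \<in> carrier B \<rightarrow> carrier H"
    proof
      fix U assume "U \<in> carrier B"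
      then obtain u where "formal u" "U = cls u" by (rule cls_surj)
      then show "\<Phi> U \<in> carrier H" using \<Phi> hc by simp
    qed
    show "\<Phi> (U \<oplus>\<^bsub>B\<^esub> V) = \<Phi> U \<oplus>\<^bsub>H\<^esub> \<Phi> V" if UV: "U \<in> carrier B" "V \<in> carrier B" for U V
    proof -
      obtain u where u: "formal u" "U = cls u" by (rule cls_surj[OF UV(1)])
      obtain v where v: "formal v" "V = cls v" by (rule cls_surj[OF UV(2)])
      have "\<Phi> (U \<oplus>\<^bsub>B\<^esub> V) = \<Phi> (cls (u + v))" using u v cls_facts(2) by simp
      also have "\<dots> = h (u + v)" by (rule \<Phi>[OF keys_add_subset[OF u(1) v(1)]])
      finally show ?thesis using \<Phi> hadd u v by simp
    qed
    show "\<Phi> \<zero>\<^bsub>B\<^esub> = \<zero>\<^bsub>H\<^esub>" using \<Phi>[of 0] h0 cls_zero by simp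
    show "\<Phi> (tens c x) = g c x" if "c \<in> carrier K" "x \<in> carrier A" for c x
      unfolding tens_def using \<Phi>[of "frag_of (c, x)"] hg that by simp
  qed
qed

end

section \<open>The extended algebra is again graded, connected and noetherian\<close>

context scalar_extension begin

lemma formal_smult_eq:
  assumes "a \<in> carrier K" "formal u" shows "formal_smult K a u = fm (frag_of (a, \<one>)) u"
  using assms(2)
proof (induction u rule: frag_induction)
  case (one p) then show ?case by (cases p) (simp add: formal_smult_def)
next
  case (diff u v) then show ?case by (simp add: formal_smult_def formal_mult_right frag_extend_diff)
qed (simp add: formal_smult_def formal_mult_right)

text \<open>
  Scalar multiplication is multiplication by \<open>a \<otimes> 1\<close>, which reduces the module axioms to ring
  axioms.
\<close>

lemma smult_eq_tens:
  assumes a: "a \<in> carrier K" and U: "U \<in> carrier B"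
  shows "a \<odot>\<^bsub>B\<^esub> U = tens a \<one> \<otimes>\<^bsub>B\<^esub> U"
proof -
  obtain u where u: "formal u" "U = cls u" using cls_surj[OF U] .
  have "cls (formal_smult K a v) = tens a \<one> \<otimes>\<^bsub>B\<^esub> U" if "v \<in> U" for v
  proof -
    have vu: "v - u \<in> Z" using that cls_mem u by simp
    then have v: "formal v" using keys_add_subset[OF kernel_facts(1)[OF vu] u(1)] by simp
    have "cls v = U" using cls_eqI[OF u(1) v vu] u by simp
    then show ?thesis
      using cls_facts(3)[of "frag_of (a, \<one>)" v] a v by (simp add: formal_smult_eq tens_def)
  qed
  moreover have "u \<in> U" using cls_mem kernel_facts(2) u by simp
  moreover have "a \<odot>\<^bsub>B\<^esub> U = (\<Union>v \<in> U. cls (formal_smult K a v))" by (simp add: base_change_def)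
  ultimately show ?thesis by auto
qed

lemma tens_factor: "\<lbrakk> c \<in> carrier K; x \<in> carrier A \<rbrakk> \<Longrightarrow> tens c x = tens c \<one> \<otimes>\<^bsub>B\<^esub> tens \<one>\<^bsub>K\<^esub> x"
  using tens_mult[of c "\<one>\<^bsub>K\<^esub>" \<one> x] by simp

lemma tens_scalar_commute:
  assumes a: "a \<in> carrier K" and U: "U \<in> carrier B" shows "tens a \<one> \<otimes>\<^bsub>B\<^esub> U = U \<otimes>\<^bsub>B\<^esub> tens a \<one>"
  using U
proof (induction U rule: tensor_induct)
  case (tens c x) then show ?case using a by (simp add: tens_mult K.m_comm)
next
  case (add U V) then show ?case using a by (simp add: B.l_distr B.r_distr)
qed (use a in simp)

lemma module_B: "module K B"
proof (rule moduleI[OF K.is_cring B.is_abelian_group])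
  fix a b U V assume a: "a \<in> carrier K" and b: "b \<in> carrier K" and U: "U \<in> carrier B" and V: "V \<in> carrier B"
  show "a \<odot>\<^bsub>B\<^esub> U \<in> carrier B" using a U by (simp add: smult_eq_tens)
  show "(a \<oplus>\<^bsub>K\<^esub> b) \<odot>\<^bsub>B\<^esub> U = a \<odot>\<^bsub>B\<^esub> U \<oplus>\<^bsub>B\<^esub> b \<odot>\<^bsub>B\<^esub> U"
    using a b U by (simp add: smult_eq_tens tens_add_left B.l_distr)
  show "a \<odot>\<^bsub>B\<^esub> (U \<oplus>\<^bsub>B\<^esub> V) = a \<odot>\<^bsub>B\<^esub> U \<oplus>\<^bsub>B\<^esub> a \<odot>\<^bsub>B\<^esub> V"
    using a U V by (simp add: smult_eq_tens B.r_distr)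
  have "tens (a \<otimes>\<^bsub>K\<^esub> b) \<one> = tens a \<one> \<otimes>\<^bsub>B\<^esub> tens b \<one>" using a b by (simp add: tens_mult)
  then show "(a \<otimes>\<^bsub>K\<^esub> b) \<odot>\<^bsub>B\<^esub> U = a \<odot>\<^bsub>B\<^esub> (b \<odot>\<^bsub>B\<^esub> U)"
    using a b U by (simp add: smult_eq_tens B.m_assoc)
next
  fix U assume "U \<in> carrier B"
  then show "\<one>\<^bsub>K\<^esub> \<odot>\<^bsub>B\<^esub> U = U" by (simp add: smult_eq_tens tens_one)
qed

lemma GB_subset: "U \<in> GB n \<Longrightarrow> U \<in> carrier B"
  by (induction U rule: graded_tensor_induct) auto

lemma GB_tens: "\<lbrakk> c \<in> carrier K; x \<in> G n \<rbrakk> \<Longrightarrow> tens c x \<in> GB n"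
  unfolding base_change_grading_def tens_def by (rule imageI) simp

lemma GB_zero: "\<zero>\<^bsub>B\<^esub> \<in> GB n"
  unfolding base_change_grading_def cls_zero[symmetric] by (rule imageI) simp

lemma GB_add:
  assumes "U \<in> GB n" "V \<in> GB n" shows "U \<oplus>\<^bsub>B\<^esub> V \<in> GB n"
proof -
  obtain u v where uv: "Poly_Mapping.keys u \<subseteq> carrier K \<times> G n" "Poly_Mapping.keys v \<subseteq> carrier K \<times> G n"
    "U = cls u" "V = cls v" using assms unfolding base_change_grading_def by auto
  then have "formal u" "formal v" using G_subset by blast+
  then have "U \<oplus>\<^bsub>B\<^esub> V = cls (u + v)" using uv by (simp add: cls_facts)
  moreover have "cls (u + v) \<in> GB n"
    unfolding base_change_grading_def by (rule imageI) (simp add: keys_add_subset[OF uv(1,2)])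
  ultimately show ?thesis by simp
qed

lemma GB_mult:
  assumes U: "U \<in> GB m" and V: "V \<in> GB n" shows "U \<otimes>\<^bsub>B\<^esub> V \<in> GB (m + n)"
  using U
proof (induction U rule: graded_tensor_induct)
  case zero then show ?case using GB_subset[OF V] GB_zero by simp
next
  case (tens c x)
  show ?case
    using V
  proof (induction V rule: graded_tensor_induct)
    case zero then show ?case using tens GB_zero by simp
  next
    case (tens c' y)
    then show ?case using \<open>c \<in> carrier K\<close> \<open>x \<in> G m\<close> by (simp add: tens_mult GB_tens mult_degree)
  next
    case (add V W) then show ?case using tens GB_add by (simp add: B.r_distr)
  qed
next
  case (add U W) then show ?case using GB_subset[OF V] GB_add by (simp add: B.l_distr)
qed

lemma GB_smult: "\<lbrakk> a \<in> carrier K; U \<in> GB n \<rbrakk> \<Longrightarrow> a \<odot>\<^bsub>B\<^esub> U \<in> GB n"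
  using GB_mult[OF GB_tens[OF _ one_degree], of a U n] GB_subset by (simp add: smult_eq_tens)

lemma GB_minus: "U \<in> GB n \<Longrightarrow> \<ominus>\<^bsub>B\<^esub> U \<in> GB n"
  using GB_mult[OF GB_tens[OF K.a_inv_closed[OF K.one_closed] one_degree], of U n] GB_subset[of U n]
  by (simp add: tens_minus tens_one B.l_minus)

lemma GB_graded_commute:
  assumes U: "U \<in> GB m" and V: "V \<in> GB n"
  shows "U \<otimes>\<^bsub>B\<^esub> V = (if odd (m * n) then \<ominus>\<^bsub>B\<^esub> (V \<otimes>\<^bsub>B\<^esub> U) else V \<otimes>\<^bsub>B\<^esub> U)"
  using U
proof (induction U rule: graded_tensor_induct)
  case zero then show ?case using GB_subset[OF V] by simp
next
  case (tens c x)
  then have cx: "c \<in> carrier K" "x \<in> G m" "x \<in> carrier A" by auto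
  show ?case
    using V
  proof (induction V rule: graded_tensor_induct)
    case zero then show ?case using cx by simp
  next
    case (tens c' y)
    then have cy: "c' \<in> carrier K" "y \<in> G n" "y \<in> carrier A" by auto
    have "tens c x \<otimes>\<^bsub>B\<^esub> tens c' y = tens (c' \<otimes>\<^bsub>K\<^esub> c) (x \<otimes> y)"
      using cx cy by (simp add: tens_mult K.m_comm)
    then show ?case using cx cy graded_commute[OF cx(2) cy(2)] by (simp add: tens_mult tens_minus)
  next
    case (add V W) then show ?case using cx by (simp add: B.l_distr B.r_distr B.minus_add)
  qed
next
  case (add U W) then show ?case using GB_subset[OF V] by (simp add: B.l_distr B.r_distr B.minus_add)
qed

lemma tens_finsum:
  assumes c: "c \<in> carrier K" and f: "f \<in> I \<rightarrow> carrier A"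
  shows "tens c (finsum A f I) = finsum B (\<lambda>i. tens c (f i)) I"
  by (rule additive_finsum[OF M.abelian_group_axioms B.is_abelian_group]) (use c f tens_add_right tens_zero in auto)

text \<open>
  The projection of \<open>K \<otimes> A\<close> to \<open>K \<otimes> A\<^sub>n\<close> along the other components.
\<close>

definition is_projection :: "nat \<Rightarrow> ((('c \<times> 'b) \<Rightarrow>\<^sub>0 int) set \<Rightarrow> (('c \<times> 'b) \<Rightarrow>\<^sub>0 int) set) \<Rightarrow> bool" where
  "is_projection n \<Phi> \<longleftrightarrow> \<Phi> \<in> carrier B \<rightarrow> carrier B \<and>
    (\<forall>U \<in> carrier B. \<forall>V \<in> carrier B. \<Phi> (U \<oplus>\<^bsub>B\<^esub> V) = \<Phi> U \<oplus>\<^bsub>B\<^esub> \<Phi> V) \<and> \<Phi> \<zero>\<^bsub>B\<^esub> = \<zero>\<^bsub>B\<^esub> \<and>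
    (\<forall>c \<in> carrier K. \<forall>x \<in> carrier A. \<Phi> (tens c x) = tens c (part x n))"

definition projection :: "nat \<Rightarrow> (('c \<times> 'b) \<Rightarrow>\<^sub>0 int) set \<Rightarrow> (('c \<times> 'b) \<Rightarrow>\<^sub>0 int) set" where
  "projection n = (SOME \<Phi>. is_projection n \<Phi>)"

lemma is_projection_projection: "is_projection n (projection n)"
proof -
  have "\<exists>\<Phi>. is_projection n \<Phi>"
  proof (rule universal_property[OF B.is_abelian_group, of "\<lambda>c x. tens c (part x n)"])
    fix c a x assume c: "c \<in> carrier K" "a \<in> carrier k" "x \<in> carrier A"
    have "part (a \<odot> x) n = a \<odot> part x n"
      using part_mult_homogeneous[OF scalar_in_G0[OF c(2)] c(3), of n] c
        smult_eq_mult[OF c(2,3)] smult_eq_mult[OF c(2) part_carrier[OF c(3)]] by simp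
    then show "tens (c \<otimes>\<^bsub>K\<^esub> \<iota> a) (part x n) = tens c (part (a \<odot> x) n)"
      using c tens_balanced by simp
  next
    fix \<Phi> assume "\<Phi> \<in> carrier B \<rightarrow> carrier B"
      "\<And>U V. \<lbrakk> U \<in> carrier B; V \<in> carrier B \<rbrakk> \<Longrightarrow> \<Phi> (U \<oplus>\<^bsub>B\<^esub> V) = \<Phi> U \<oplus>\<^bsub>B\<^esub> \<Phi> V"
      "\<Phi> \<zero>\<^bsub>B\<^esub> = \<zero>\<^bsub>B\<^esub>"
      "\<And>c x. \<lbrakk> c \<in> carrier K; x \<in> carrier A \<rbrakk> \<Longrightarrow> \<Phi> (tens c x) = tens c (part x n)"
    then have "is_projection n \<Phi>" unfolding is_projection_def by blast
    then show ?thesis by blast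
  qed (simp_all add: tens_add_left tens_add_right part_add)
  then show ?thesis unfolding projection_def by (rule someI_ex)
qed

text \<open>
  The projections recover the components of any decomposition, which gives uniqueness; existence
  holds for pure tensors by decomposing the right factor.
\<close>

lemma GB_direct_sum:
  assumes U: "U \<in> carrier B"
  shows "\<exists>!c. (\<forall>n. c n \<in> GB n) \<and> finite {n. c n \<noteq> \<zero>\<^bsub>B\<^esub>} \<and> U = finsum B c {n. c n \<noteq> \<zero>\<^bsub>B\<^esub>}"
proof -
  let ?p = projection
  have proj: "\<And>n. ?p n \<in> carrier B \<rightarrow> carrier B"
    "\<And>n U V. \<lbrakk> U \<in> carrier B; V \<in> carrier B \<rbrakk> \<Longrightarrow> ?p n (U \<oplus>\<^bsub>B\<^esub> V) = ?p n U \<oplus>\<^bsub>B\<^esub> ?p n V"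
    "\<And>n. ?p n \<zero>\<^bsub>B\<^esub> = \<zero>\<^bsub>B\<^esub>"
    "\<And>n c x. \<lbrakk> c \<in> carrier K; x \<in> carrier A \<rbrakk> \<Longrightarrow> ?p n (tens c x) = tens c (part x n)"
    using is_projection_projection unfolding is_projection_def by blast+
  have projc: "projection n V \<in> carrier B" if "V \<in> carrier B" for V n using proj(1) that by auto
  have projG: "projection n V \<in> GB n" if "V \<in> carrier B" for n V
    using that
  proof (induction V rule: tensor_induct)
    case (tens c x) then show ?case using proj(4) GB_tens[OF _ part_in] by simp
  next
    case (add V W) then show ?case using proj(2) GB_add by simp
  qed (simp add: proj(3) GB_zero)
  have projid: "projection n V = (if n = m then V else \<zero>\<^bsub>B\<^esub>)" if "V \<in> GB m" for n m V
    using that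
  proof (induction V rule: graded_tensor_induct)
    case (tens c x)
    then show ?case using proj(4)[of c x n] part_homogeneous[OF tens(2), of n] tens_zero(1) by auto
  next
    case (add V W) then show ?case using proj(2) by auto
  qed (simp add: proj(3))
  have "\<exists>S. finite S \<and> (\<forall>n. n \<notin> S \<longrightarrow> projection n U = \<zero>\<^bsub>B\<^esub>) \<and> U = finsum B (\<lambda>n. projection n U) S"
    using U
  proof (induction U rule: tensor_induct)
    case zero then show ?case by (intro exI[of _ "{}"]) (simp add: proj(3))
  next
    case (tens c x)
    let ?S = "{n. part x n \<noteq> \<zero>}"
    have "tens c x = tens c (finsum A (part x) ?S)" using part_sum[OF tens(2)] by simp
    also have "\<dots> = finsum B (\<lambda>n. tens c (part x n)) ?S"
      by (rule tens_finsum) (use tens in auto)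
    also have "\<dots> = finsum B (\<lambda>n. projection n (tens c x)) ?S" using proj(4) tens by simp
    finally have "tens c x = finsum B (\<lambda>n. projection n (tens c x)) ?S" .
    moreover have "projection n (tens c x) = \<zero>\<^bsub>B\<^esub>" if "n \<notin> ?S" for n
      using that proj(4)[OF tens] tens_zero(1)[OF tens(1)] by simp
    ultimately show ?case using finite_part[OF tens(2)] by blast
  next
    case (add V W)
    then obtain S T where S: "finite S" "\<And>n. n \<notin> S \<Longrightarrow> projection n V = \<zero>\<^bsub>B\<^esub>" "V = finsum B (\<lambda>n. projection n V) S"
      and T: "finite T" "\<And>n. n \<notin> T \<Longrightarrow> projection n W = \<zero>\<^bsub>B\<^esub>" "W = finsum B (\<lambda>n. projection n W) T" by blast
    have fin: "finite (S \<union> T)" using S(1) T(1) by simp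
    have cV: "(\<lambda>n. projection n V) \<in> S \<union> T \<rightarrow> carrier B" and cW: "(\<lambda>n. projection n W) \<in> S \<union> T \<rightarrow> carrier B"
      using projc add(1,2) by auto
    have "finsum B (\<lambda>n. projection n V) S = finsum B (\<lambda>n. projection n V) (S \<union> T)"
      by (rule B.finsum_expand_support[OF fin _ cV]) (use S(2) in auto)
    moreover have "finsum B (\<lambda>n. projection n W) T = finsum B (\<lambda>n. projection n W) (S \<union> T)"
      by (rule B.finsum_expand_support[OF fin _ cW]) (use T(2) in auto)
    moreover have "finsum B (\<lambda>n. projection n V \<oplus>\<^bsub>B\<^esub> projection n W) (S \<union> T) =
        finsum B (\<lambda>n. projection n V) (S \<union> T) \<oplus>\<^bsub>B\<^esub> finsum B (\<lambda>n. projection n W) (S \<union> T)"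
      by (rule B.finsum_addf[OF cV cW])
    ultimately have "V \<oplus>\<^bsub>B\<^esub> W = finsum B (\<lambda>n. projection n (V \<oplus>\<^bsub>B\<^esub> W)) (S \<union> T)"
      using S(3) T(3) proj(2)[OF add(1,2)] by simp
    moreover have "projection n (V \<oplus>\<^bsub>B\<^esub> W) = \<zero>\<^bsub>B\<^esub>" if "n \<notin> S \<union> T" for n
      using that S(2) T(2) proj(2)[OF add(1,2)] by simp
    ultimately show ?case using fin by (intro exI[of _ "S \<union> T"]) auto
  qed
  then obtain S where S: "finite S" "\<And>n. n \<notin> S \<Longrightarrow> projection n U = \<zero>\<^bsub>B\<^esub>" "U = finsum B (\<lambda>n. projection n U) S" by blast
  show ?thesis
  proof (rule ex1I[of _ "\<lambda>n. projection n U"], intro conjI allI)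
    show "projection n U \<in> GB n" for n by (rule projG[OF U])
    have sub: "{n. projection n U \<noteq> \<zero>\<^bsub>B\<^esub>} \<subseteq> S" using S(2) by auto
    then show "finite {n. projection n U \<noteq> \<zero>\<^bsub>B\<^esub>}" using S(1) finite_subset by blast
    have "finsum B (\<lambda>n. projection n U) {n. projection n U \<noteq> \<zero>\<^bsub>B\<^esub>} = finsum B (\<lambda>n. projection n U) S"
      by (rule B.finsum_expand_support[OF S(1) sub]) (use projc[OF U] in auto)
    then show "U = finsum B (\<lambda>n. projection n U) {n. projection n U \<noteq> \<zero>\<^bsub>B\<^esub>}" using S(3) by simp
  next
    fix c assume c: "(\<forall>n. c n \<in> GB n) \<and> finite {n. c n \<noteq> \<zero>\<^bsub>B\<^esub>} \<and> U = finsum B c {n. c n \<noteq> \<zero>\<^bsub>B\<^esub>}"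
    let ?T = "{n. c n \<noteq> \<zero>\<^bsub>B\<^esub>}"
    have cc: "c i \<in> carrier B" for i using c GB_subset by blast
    show "c = (\<lambda>n. projection n U)"
    proof
      fix n
      have "projection n U = finsum B (\<lambda>i. projection n (c i)) ?T"
        using c additive_finsum[OF B.is_abelian_group B.is_abelian_group proj(1) proj(2) proj(3), of c ?T n] cc by auto
      also have "\<dots> = finsum B (\<lambda>i. if n = i then c i else \<zero>\<^bsub>B\<^esub>) ?T"
        by (rule B.finsum_cong') (use c cc projid in auto)
      also have "\<dots> = c n"
      proof (cases "n \<in> ?T")
        case True then show ?thesis using c cc B.finsum_singleton[of n ?T c] by auto
      next
        case False
        then have "finsum B (\<lambda>i. if n = i then c i else \<zero>\<^bsub>B\<^esub>) ?T = \<zero>\<^bsub>B\<^esub>"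
          by (intro B.add.finprod_one_eqI) auto
        then show ?thesis using False by simp
      qed
      finally show "c n = projection n U" by simp
    qed
  qed
qed

lemma base_change_graded: "graded_commutative_algebra K B GB"
proof (intro graded_commutative_algebra.intro graded_commutative_algebra_axioms.intro)
  interpret MB: module K B by (rule module_B)
  show "module K B" by (rule module_B)
  show "field K" by (rule K.field_axioms)
  show "ring B" by (rule B.ring_axioms)
  show "submodule (GB n) K B" for n
    by (rule MB.submoduleI) (use GB_subset GB_zero GB_minus GB_add GB_smult in auto)
  show "\<one>\<^bsub>B\<^esub> \<in> GB 0" using GB_tens[OF K.one_closed one_degree] tens_one by simp
  fix a U V assume a: "a \<in> carrier K" and U: "U \<in> carrier B" and V: "V \<in> carrier B"
  show "a \<odot>\<^bsub>B\<^esub> (U \<otimes>\<^bsub>B\<^esub> V) = (a \<odot>\<^bsub>B\<^esub> U) \<otimes>\<^bsub>B\<^esub> V"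
    using a U V by (simp add: smult_eq_tens B.m_assoc)
  have "tens a \<one> \<otimes>\<^bsub>B\<^esub> (U \<otimes>\<^bsub>B\<^esub> V) = (U \<otimes>\<^bsub>B\<^esub> tens a \<one>) \<otimes>\<^bsub>B\<^esub> V"
    using a U V by (simp add: tens_scalar_commute[symmetric] B.m_assoc)
  then show "a \<odot>\<^bsub>B\<^esub> (U \<otimes>\<^bsub>B\<^esub> V) = U \<otimes>\<^bsub>B\<^esub> (a \<odot>\<^bsub>B\<^esub> V)"
    using a U V by (simp add: smult_eq_tens B.m_assoc)
qed (use GB_direct_sum GB_mult GB_graded_commute in auto)

lemma scalar_eq_tens: "a \<in> carrier K \<Longrightarrow> a \<odot>\<^bsub>B\<^esub> \<one>\<^bsub>B\<^esub> = tens a \<one>"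
  using smult_eq_tens[OF _ B.one_closed] by simp

text \<open>
  The map \<open>x \<mapsto> 1 \<otimes> x\<close> is a ring homomorphism that sends scalars to scalars.
\<close>

lemma generated_image:
  assumes S: "S \<subseteq> carrier A" and S': "S' \<subseteq> carrier B" and im: "\<And>s. s \<in> S \<Longrightarrow> tens \<one>\<^bsub>K\<^esub> s \<in> S'"
    and x: "x \<in> generated_subalgebra k A S"
  shows "tens \<one>\<^bsub>K\<^esub> x \<in> generated_subalgebra K B S'"
proof -
  have kS: "(\<lambda>a. a \<odot> \<one>) ` carrier k \<union> S \<subseteq> carrier A" using S by auto
  have "x \<in> carrier A \<and> tens \<one>\<^bsub>K\<^esub> x \<in> generated_subalgebra K B S'"
    using x unfolding generated_subalgebra_def
  proof (induction x rule: generate_ring.induct)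
    case one then show ?case using tens_one generate_ring.one[of B] by simp
  next
    case (incl h)
    then have hc: "h \<in> carrier A" using kS by auto
    show ?case
    proof (cases "h \<in> S")
      case True then show ?thesis using im hc by (auto intro: generate_ring.incl)
    next
      case False
      then obtain a where a: "a \<in> carrier k" "h = a \<odot> \<one>" using incl by auto
      then have "tens \<one>\<^bsub>K\<^esub> h = \<iota> a \<odot>\<^bsub>B\<^esub> \<one>\<^bsub>B\<^esub>"
        using tens_balanced[OF K.one_closed a(1) A.one_closed] hom_closed[OF a(1)] by (simp add: scalar_eq_tens)
      then show ?thesis using hc hom_closed[OF a(1)] by (auto intro: generate_ring.incl)
    qed
  next
    case (a_inv h) then show ?case by (auto simp: tens_minus intro: generate_ring.a_inv)
  next
    case (eng_add h h') then show ?case by (auto simp: tens_add_right intro: generate_ring.eng_add)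
  next
    case (eng_mult h h')
    then have "tens \<one>\<^bsub>K\<^esub> (h \<otimes> h') = tens \<one>\<^bsub>K\<^esub> h \<otimes>\<^bsub>B\<^esub> tens \<one>\<^bsub>K\<^esub> h'" by (simp add: tens_mult)
    then show ?case using eng_mult by (auto intro: generate_ring.eng_mult)
  qed
  then show ?thesis by simp
qed

end

locale connected_scalar_extension = scalar_extension k A G K \<iota> + noetherian_graded_algebra k A G
  for k :: "('a, 'm) ring_scheme" and A :: "('a, 'b, 'n) module_scheme" (structure)
    and G :: "nat \<Rightarrow> 'b set" and K :: "('c, 'l) ring_scheme" and \<iota> :: "'a \<Rightarrow> 'c"
begin

text \<open>
  The map \<open>a \<mapsto> a \<otimes> 1\<close> has a left inverse: project \<open>A\<close> to \<open>A\<^sub>0 = k\<close> and multiply in \<open>K\<close>.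
\<close>

lemma base_change_unit_injective:
  assumes "a \<in> carrier K" "tens a \<one> = \<zero>\<^bsub>B\<^esub>" shows "a = \<zero>\<^bsub>K\<^esub>"
proof -
  let ?j = "\<lambda>a. a \<odot> \<one>"
  define q where "q x = the_inv_into (carrier k) ?j (part x 0)" for x
  have bij: "bij_betw ?j (carrier k) (G 0)" by (rule connected)
  have q: "q x \<in> carrier k" "q x \<odot> \<one> = part x 0" if "x \<in> carrier A" for x
    using the_inv_into_into[OF bij_betw_imp_inj_on[OF bij], of "part x 0" "carrier k"]
      f_the_inv_into_f_bij_betw[OF bij, of "part x 0"] part_in[OF that] bij
    unfolding q_def by (auto simp: bij_betw_def)
  have qI: "q x = a" if "x \<in> carrier A" "a \<in> carrier k" "part x 0 = a \<odot> \<one>" for x a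
    using inj_onD[OF bij_betw_imp_inj_on[OF bij], of "q x" a] q[OF that(1)] that by simp
  obtain \<Phi> where \<Phi>: "\<Phi> \<in> carrier B \<rightarrow> carrier K" "\<Phi> \<zero>\<^bsub>B\<^esub> = \<zero>\<^bsub>K\<^esub>"
    "\<And>c x. \<lbrakk> c \<in> carrier K; x \<in> carrier A \<rbrakk> \<Longrightarrow> \<Phi> (tens c x) = c \<otimes>\<^bsub>K\<^esub> \<iota> (q x)"
  proof (rule universal_property[OF K.is_abelian_group, of "\<lambda>c x. c \<otimes>\<^bsub>K\<^esub> \<iota> (q x)"])
    fix c c' x assume "c \<in> carrier K" "c' \<in> carrier K" "x \<in> carrier A"
    then show "c \<otimes>\<^bsub>K\<^esub> \<iota> (q x) \<in> carrier K"
      "(c \<oplus>\<^bsub>K\<^esub> c') \<otimes>\<^bsub>K\<^esub> \<iota> (q x) = c \<otimes>\<^bsub>K\<^esub> \<iota> (q x) \<oplus>\<^bsub>K\<^esub> c' \<otimes>\<^bsub>K\<^esub> \<iota> (q x)"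
      using q hom_closed by (auto simp: K.l_distr)
  next
    fix c x x' assume c: "c \<in> carrier K" "x \<in> carrier A" "x' \<in> carrier A"
    have "q (x \<oplus> x') = q x \<oplus>\<^bsub>k\<^esub> q x'"
      by (rule qI) (use c q in \<open>auto simp: part_add smult_l_distr\<close>)
    then show "c \<otimes>\<^bsub>K\<^esub> \<iota> (q (x \<oplus> x')) = c \<otimes>\<^bsub>K\<^esub> \<iota> (q x) \<oplus>\<^bsub>K\<^esub> c \<otimes>\<^bsub>K\<^esub> \<iota> (q x')"
      using c q hom_closed ring_hom_add[OF hom] by (simp add: K.r_distr)
  next
    fix c a x assume c: "c \<in> carrier K" "a \<in> carrier k" "x \<in> carrier A"
    have "part (a \<odot> x) 0 = (a \<otimes>\<^bsub>k\<^esub> q x) \<odot> \<one>"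
      using part_mult_homogeneous[OF scalar_in_G0[OF c(2)] c(3), of 0] c q[OF c(3)]
        smult_eq_mult[OF c(2,3)] smult_eq_mult[OF c(2) part_carrier[OF c(3)], of 0]
        smult_assoc1[OF c(2) q(1)[OF c(3)] A.one_closed] by simp
    then have "q (a \<odot> x) = a \<otimes>\<^bsub>k\<^esub> q x" by (intro qI) (use c q in auto)
    then show "c \<otimes>\<^bsub>K\<^esub> \<iota> a \<otimes>\<^bsub>K\<^esub> \<iota> (q x) = c \<otimes>\<^bsub>K\<^esub> \<iota> (q (a \<odot> x))"
      using c q hom_closed ring_hom_mult[OF hom] by (simp add: K.m_assoc)
  qed (use that in blast)
  have "part \<one> 0 = \<one>\<^bsub>k\<^esub> \<odot> \<one>" using part_homogeneous[OF one_degree, of 0] by simp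
  then have "q \<one> = \<one>\<^bsub>k\<^esub>" by (intro qI) auto
  then have "\<Phi> (tens a \<one>) = a" using \<Phi>(3) assms(1) ring_hom_one[OF hom] by simp
  then show ?thesis using assms(2) \<Phi>(2) by simp
qed

lemma base_change_connected_noetherian: "connected_noetherian_algebra K B GB"
proof (intro connected_noetherian_algebra.intro connected_noetherian_algebra_axioms.intro)
  show "graded_commutative_algebra K B GB" by (rule base_change_graded)
  show "bij_betw (\<lambda>a. a \<odot>\<^bsub>B\<^esub> \<one>\<^bsub>B\<^esub>) (carrier K) (GB 0)"
    unfolding bij_betw_def
  proof
    show "inj_on (\<lambda>a. a \<odot>\<^bsub>B\<^esub> \<one>\<^bsub>B\<^esub>) (carrier K)"
    proof (rule inj_onI)
      fix a b assume ab: "a \<in> carrier K" "b \<in> carrier K" "a \<odot>\<^bsub>B\<^esub> \<one>\<^bsub>B\<^esub> = b \<odot>\<^bsub>B\<^esub> \<one>\<^bsub>B\<^esub>"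
      then have "tens (a \<oplus>\<^bsub>K\<^esub> \<ominus>\<^bsub>K\<^esub> b) \<one> = \<zero>\<^bsub>B\<^esub>"
        by (simp add: scalar_eq_tens tens_add_left tens_minus B.r_neg)
      then have "a \<oplus>\<^bsub>K\<^esub> \<ominus>\<^bsub>K\<^esub> b = \<zero>\<^bsub>K\<^esub>" using ab by (intro base_change_unit_injective) auto
      then show "a = b" using ab K.minus_equality[of a "\<ominus>\<^bsub>K\<^esub> b"] by simp
    qed
    show "(\<lambda>a. a \<odot>\<^bsub>B\<^esub> \<one>\<^bsub>B\<^esub>) ` carrier K = GB 0"
    proof (intro equalityI subsetI)
      fix U assume "U \<in> (\<lambda>a. a \<odot>\<^bsub>B\<^esub> \<one>\<^bsub>B\<^esub>) ` carrier K"
      then show "U \<in> GB 0" using GB_tens[OF _ one_degree] by (auto simp: scalar_eq_tens)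
    next
      fix U assume "U \<in> GB 0"
      then have "\<exists>a \<in> carrier K. U = tens a \<one>"
      proof (induction U rule: graded_tensor_induct)
        case zero then show ?case using tens_zero(2)[OF A.one_closed] by (intro bexI[of _ "\<zero>\<^bsub>K\<^esub>"]) auto
      next
        case (tens c x)
        then obtain a where "a \<in> carrier k" "x = a \<odot> \<one>" using G0_eq by auto
        then show ?case using tens tens_balanced[of c a \<one>] hom_closed[of a]
          by (intro bexI[of _ "c \<otimes>\<^bsub>K\<^esub> \<iota> a"]) auto
      next
        case (add U V)
        then obtain a b where "a \<in> carrier K" "U = tens a \<one>" "b \<in> carrier K" "V = tens b \<one>" by blast
        then show ?case by (intro bexI[of _ "a \<oplus>\<^bsub>K\<^esub> b"]) (auto simp: tens_add_left)
      qed
      then show "U \<in> (\<lambda>a. a \<odot>\<^bsub>B\<^esub> \<one>\<^bsub>B\<^esub>) ` carrier K" by (auto simp: scalar_eq_tens)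
    qed
  qed
  obtain S where S: "finite S" "S \<subseteq> carrier A" "generated_subalgebra k A S = carrier A"
    using noetherian unfolding finitely_generated_algebra_def by auto
  let ?S = "tens \<one>\<^bsub>K\<^esub> ` S"
  have S': "?S \<subseteq> carrier B" using S(2) by auto
  have KS: "(\<lambda>a. a \<odot>\<^bsub>B\<^esub> \<one>\<^bsub>B\<^esub>) ` carrier K \<union> ?S \<subseteq> carrier B" using S' by (auto simp: scalar_eq_tens)
  have "U \<in> generated_subalgebra K B ?S" if "U \<in> carrier B" for U
    using that
  proof (induction U rule: tensor_induct)
    case zero show ?case unfolding generated_subalgebra_def by (rule B.zero_in_generate)
  next
    case (tens c x)
    have "tens \<one>\<^bsub>K\<^esub> x \<in> generated_subalgebra K B ?S"
      by (rule generated_image[OF S(2) S']) (use S(3) tens in auto)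
    moreover have "tens c \<one> \<in> generated_subalgebra K B ?S"
      unfolding generated_subalgebra_def using tens scalar_eq_tens[of c] by (intro generate_ring.incl) force
    ultimately show ?case
      unfolding tens_factor[OF tens] generated_subalgebra_def by (intro generate_ring.eng_mult)
  next
    case (add U V)
    then show ?case unfolding generated_subalgebra_def by (intro generate_ring.eng_add)
  qed
  moreover have "generated_subalgebra K B ?S \<subseteq> carrier B"
    unfolding generated_subalgebra_def by (rule B.generate_ring_incl[OF KS])
  ultimately have "generated_subalgebra K B ?S = carrier B" by blast
  then show "finitely_generated_algebra K B"
    unfolding finitely_generated_algebra_def using S' S(1) by (intro exI[of _ ?S]) auto
qed

lemma base_change_finite:
  assumes "finitely_generated_over A (generated_subalgebra k A (G d))"
  shows "finitely_generated_over B (generated_subalgebra K B (GB d))"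
proof -
  interpret BG: graded_algebra K B GB by (rule graded_algebra.intro[OF base_change_graded])
  let ?R = "generated_subalgebra k A (G d)" and ?R' = "generated_subalgebra K B (GB d)"
  have sR: "subring ?R A" by (rule generated_subalgebra_subring[OF G_subset])
  have sR': "subring ?R' B" by (rule BG.generated_subalgebra_subring[OF BG.G_subset])
  note Rc = subringE(1)[OF sR] and Rc' = subringE(1)[OF sR']
  obtain F where F: "finite F" "F \<subseteq> carrier A" "carrier A \<subseteq> lspan A ?R F"
    using assms A.finitely_generated_over_iff_lspan[OF sR] by auto
  let ?F = "tens \<one>\<^bsub>K\<^esub> ` F"
  have F': "?F \<subseteq> carrier B" using F(2) by auto
  have im: "tens \<one>\<^bsub>K\<^esub> x \<in> lspan B ?R' ?F" if "x \<in> lspan A ?R F" for x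
    using that
  proof induction
    case zero then show ?case using tens_zero(1)[OF K.one_closed] lspan.zero[of B] by simp
  next
    case (step b f t)
    then have c: "b \<in> carrier A" "f \<in> carrier A" "t \<in> carrier A"
      using Rc F(2) A.lspan_subset_carrier[OF Rc F(2)] by auto
    have "tens \<one>\<^bsub>K\<^esub> b \<in> ?R'"
      by (rule generated_image[OF G_subset BG.G_subset GB_tens[OF K.one_closed] step(1)])
    moreover have "tens \<one>\<^bsub>K\<^esub> (b \<otimes> f \<oplus> t) = tens \<one>\<^bsub>K\<^esub> b \<otimes>\<^bsub>B\<^esub> tens \<one>\<^bsub>K\<^esub> f \<oplus>\<^bsub>B\<^esub> tens \<one>\<^bsub>K\<^esub> t"
      using c by (simp add: tens_add_right tens_mult)
    ultimately show ?case using step lspan.step[of "tens \<one>\<^bsub>K\<^esub> b" ?R' "tens \<one>\<^bsub>K\<^esub> f" ?F _ B] by auto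
  qed
  have "U \<in> lspan B ?R' ?F" if "U \<in> carrier B" for U
    using that
  proof (induction U rule: tensor_induct)
    case zero show ?case by (rule lspan.zero)
  next
    case (tens c x)
    have c1: "tens c \<one> \<in> ?R'"
      unfolding generated_subalgebra_def using tens scalar_eq_tens[of c] by (intro generate_ring.incl) force
    show ?case
      unfolding tens_factor[OF tens]
      by (rule B.lspan_smult[OF Rc' F' im]) (use F(3) tens c1 Rc' subringE(6)[OF sR' c1] in auto)
  next
    case (add U V) then show ?case by (intro B.lspan_add[OF Rc' F'])
  qed
  then show ?thesis using B.finitely_generated_over_iff_lspan[OF sR'] F(1) F' by blast
qed

end

section \<open>Retractions onto a subfield\<close>

text \<open>
  By Zorn's lemma choose a \<open>C\<close>-subspace \<open>H\<close> that is maximal among those without \<open>1\<close>. It is a complement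
  of \<open>C\<close>: if \<open>x \<notin> H\<close>, then \<open>1 = h + cx\<close> with \<open>c \<noteq> 0\<close> by maximality, so \<open>x \<in> C + H\<close>. Project along \<open>H\<close>.
\<close>

lemma (in field) exists_linear_retraction:
  assumes C: "subfield C R"
  obtains \<phi> where "\<And>x. x \<in> carrier R \<Longrightarrow> \<phi> x \<in> C"
    "\<And>x y. \<lbrakk> x \<in> carrier R; y \<in> carrier R \<rbrakk> \<Longrightarrow> \<phi> (x \<oplus> y) = \<phi> x \<oplus> \<phi> y"
    "\<And>c x. \<lbrakk> c \<in> C; x \<in> carrier R \<rbrakk> \<Longrightarrow> \<phi> (c \<otimes> x) = c \<otimes> \<phi> x"
    "\<phi> \<one> = \<one>"
proof -
  note sC = subringE[OF subfieldE(1)[OF C]]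
  have Cc: "c \<in> carrier R" if "c \<in> C" for c using sC(1) that by auto
  have Cinv: "inv c \<in> C" "inv c \<otimes> c = \<one>" if "c \<in> C" "c \<noteq> \<zero>" for c
    using subfield_m_inv[OF C, of c] that by auto
  define closed where "closed H \<longleftrightarrow> H \<subseteq> carrier R \<and> \<zero> \<in> H \<and>
    (\<forall>x \<in> H. \<forall>y \<in> H. x \<oplus> y \<in> H) \<and> (\<forall>c \<in> C. \<forall>x \<in> H. c \<otimes> x \<in> H)" for H
  \<comment> \<open>The predicate describes the \<open>C\<close>-subspaces of the field.\<close>
  let ?S = "{H. closed H \<and> \<one> \<notin> H}"
  have "\<exists>H \<in> ?S. \<forall>M \<in> ?S. H \<subseteq> M \<longrightarrow> M = H"
  proof (rule subset_Zorn_nonempty)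
    have "{\<zero>} \<in> ?S" using Cc unfolding closed_def by auto
    then show "?S \<noteq> {}" by blast
  next
    fix \<C> assume ne: "\<C> \<noteq> {}" and ch: "subset.chain ?S \<C>"
    have S: "H \<in> ?S" if "H \<in> \<C>" for H using ch that unfolding subset.chain_def by blast
    have tot: "H \<subseteq> H' \<or> H' \<subseteq> H" if "H \<in> \<C>" "H' \<in> \<C>" for H H'
      using ch that unfolding subset.chain_def by blast
    have "closed (\<Union>\<C>)"
      unfolding closed_def
    proof (intro conjI ballI)
      show "\<Union>\<C> \<subseteq> carrier R" using S unfolding closed_def by blast
      show "\<zero> \<in> \<Union>\<C>" using S ne unfolding closed_def by blast
      show "c \<otimes> x \<in> \<Union>\<C>" if "c \<in> C" "x \<in> \<Union>\<C>" for c x using S that unfolding closed_def by blast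
      fix x y assume "x \<in> \<Union>\<C>" "y \<in> \<Union>\<C>"
      then obtain H H' where H: "x \<in> H" "H \<in> \<C>" "y \<in> H'" "H' \<in> \<C>" by blast
      then have "\<exists>H \<in> \<C>. x \<in> H \<and> y \<in> H" using tot[OF H(2,4)] by blast
      then show "x \<oplus> y \<in> \<Union>\<C>" using S unfolding closed_def by blast
    qed
    moreover have "\<one> \<notin> \<Union>\<C>" using S by blast
    ultimately show "\<Union>\<C> \<in> ?S" by simp
  qed
  then obtain H where H: "closed H" "\<one> \<notin> H" and max: "\<And>M. \<lbrakk> closed M; \<one> \<notin> M; H \<subseteq> M \<rbrakk> \<Longrightarrow> M = H"
    by blast
  have Hc: "h \<in> carrier R" if "h \<in> H" for h using H(1) that unfolding closed_def by blast
  have Hadd: "x \<oplus> y \<in> H" if "x \<in> H" "y \<in> H" for x y using H(1) that unfolding closed_def by blast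
  have Hsm: "c \<otimes> x \<in> H" if "c \<in> C" "x \<in> H" for c x using H(1) that unfolding closed_def by blast
  have H0: "\<zero> \<in> H" using H(1) unfolding closed_def by blast
  have Hneg: "\<ominus> h \<in> H" if "h \<in> H" for h
    using Hsm[OF sC(5)[OF sC(3)] that] Hc[OF that] by (simp add: l_minus)
  have uniq: "c = c'" if "c \<in> C" "c' \<in> C" "h \<in> H" "h' \<in> H" "c \<oplus> h = c' \<oplus> h'" for c c' h h'
  proof (rule ccontr)
    assume ne: "c \<noteq> c'"
    note cc = Cc[OF that(1)] Cc[OF that(2)] Hc[OF that(3)] Hc[OF that(4)]
    have "c \<oplus> \<ominus> c' = (c \<oplus> h) \<oplus> \<ominus> h \<oplus> \<ominus> c'" using cc by (simp add: a_assoc r_neg)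
    also have "\<dots> = (c' \<oplus> h') \<oplus> \<ominus> h \<oplus> \<ominus> c'" using that(5) by simp
    also have "\<dots> = c' \<oplus> (\<ominus> c' \<oplus> (h' \<oplus> \<ominus> h))" using cc by (simp add: a_ac)
    also have "\<dots> = h' \<oplus> \<ominus> h" using cc by (simp add: r_neg2)
    finally have inH: "c \<oplus> \<ominus> c' \<in> H" using Hadd[OF that(4) Hneg[OF that(3)]] by simp
    have inC: "c \<oplus> \<ominus> c' \<in> C" by (rule sC(7)[OF that(1) sC(5)[OF that(2)]])
    have "c \<oplus> \<ominus> c' \<noteq> \<zero>" using ne cc minus_equality[of c "\<ominus> c'"] by auto
    then have "inv (c \<oplus> \<ominus> c') \<otimes> (c \<oplus> \<ominus> c') = \<one>" "inv (c \<oplus> \<ominus> c') \<in> C" using Cinv inC by auto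
    then show False using Hsm[OF _ inH, of "inv (c \<oplus> \<ominus> c')"] H(2) by simp
  qed
  have ex: "\<exists>c \<in> C. \<exists>h \<in> H. x = c \<oplus> h" if x: "x \<in> carrier R" for x
  proof (cases "x \<in> H")
    case True then show ?thesis using x by (intro bexI[of _ \<zero>] bexI[of _ x] sC(2)) auto
  next
    case False
    let ?M = "{h \<oplus> c \<otimes> x | h c. h \<in> H \<and> c \<in> C}"
    have MI: "h \<oplus> c \<otimes> x \<in> ?M" if "h \<in> H" "c \<in> C" for h c using that by blast
    have "closed ?M"
      unfolding closed_def
    proof (intro conjI ballI)
      show "?M \<subseteq> carrier R" using Hc Cc x by auto
      show "\<zero> \<in> ?M" using MI[OF H0 sC(2)] x by simp
      fix u assume "u \<in> ?M"
      then obtain h c where u: "u = h \<oplus> c \<otimes> x" "h \<in> H" "c \<in> C" by blast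
      note uc = Hc[OF u(2)] Cc[OF u(3)]
      show "e \<otimes> u \<in> ?M" if e: "e \<in> C" for e
      proof -
        have "e \<otimes> u = e \<otimes> h \<oplus> (e \<otimes> c) \<otimes> x" using u uc Cc[OF e] x by (simp add: r_distr m_assoc)
        then show ?thesis using MI[OF Hsm[OF e u(2)] sC(6)[OF e u(3)]] by simp
      qed
      fix v assume "v \<in> ?M"
      then obtain h' c' where v: "v = h' \<oplus> c' \<otimes> x" "h' \<in> H" "c' \<in> C" by blast
      note vc = Hc[OF v(2)] Cc[OF v(3)]
      have "u \<oplus> v = (h \<oplus> h') \<oplus> (c \<oplus> c') \<otimes> x" using u v uc vc x by (simp add: l_distr a_ac)
      then show "u \<oplus> v \<in> ?M" using MI[OF Hadd[OF u(2) v(2)] sC(7)[OF u(3) v(3)]] by simp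
    qed
    moreover have HM: "H \<subseteq> ?M"
    proof
      fix h assume "h \<in> H" then show "h \<in> ?M" using MI[OF _ sC(2), of h] Hc x by simp
    qed
    moreover have "x \<in> ?M" using MI[OF H0 sC(3)] x by simp
    ultimately have "\<one> \<in> ?M" using max False by blast
    then obtain h c where hc: "\<one> = h \<oplus> c \<otimes> x" "h \<in> H" "c \<in> C" by blast
    note cc = Hc[OF hc(2)] Cc[OF hc(3)]
    have "c \<noteq> \<zero>" using hc H(2) cc x by auto
    note i = Cinv[OF hc(3) this]
    have "c \<otimes> x = \<one> \<oplus> \<ominus> h" using hc(1) cc x by (simp add: a_ac r_neg r_neg1 r_neg2 l_neg)
    then have "inv c \<otimes> (c \<otimes> x) = inv c \<oplus> \<ominus> (inv c \<otimes> h)"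
      using cc Cc[OF i(1)] by (simp add: r_distr r_minus)
    moreover have "inv c \<otimes> (c \<otimes> x) = x" using i cc Cc[OF i(1)] x by (simp add: m_assoc[symmetric])
    ultimately have "x = inv c \<oplus> \<ominus> (inv c \<otimes> h)" by simp
    then show ?thesis using i(1) Hneg[OF Hsm[OF i(1) hc(2)]] by blast
  qed
  define \<phi> where "\<phi> x = (SOME c. c \<in> C \<and> (\<exists>h \<in> H. x = c \<oplus> h))" for x
  have \<phi>: "\<phi> x \<in> C \<and> (\<exists>h \<in> H. x = \<phi> x \<oplus> h)" if "x \<in> carrier R" for x
    unfolding \<phi>_def by (rule someI_ex) (use ex[OF that] in blast)
  have \<phi>I: "\<phi> x = c" if "x \<in> carrier R" "c \<in> C" "h \<in> H" "x = c \<oplus> h" for x c h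
  proof -
    from \<phi>[OF that(1)] obtain g where g: "\<phi> x \<in> C" "g \<in> H" "x = \<phi> x \<oplus> g" by blast
    have "\<phi> x \<oplus> g = c \<oplus> h" using g(3) that(4) by simp
    then show ?thesis by (rule uniq[OF g(1) that(2) g(2) that(3)])
  qed
  show thesis
  proof (rule that)
    show "\<phi> x \<in> C" if "x \<in> carrier R" for x using \<phi>[OF that] by simp
    show "\<phi> \<one> = \<one>" by (rule \<phi>I[OF _ sC(3) H0]) auto
    show "\<phi> (x \<oplus> y) = \<phi> x \<oplus> \<phi> y" if x: "x \<in> carrier R" and y: "y \<in> carrier R" for x y
    proof -
      obtain h where h: "h \<in> H" "x = \<phi> x \<oplus> h" "\<phi> x \<in> C" using \<phi>[OF x] by blast
      obtain g where g: "g \<in> H" "y = \<phi> y \<oplus> g" "\<phi> y \<in> C" using \<phi>[OF y] by blast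
      note cc = Hc[OF h(1)] Cc[OF h(3)] Hc[OF g(1)] Cc[OF g(3)]
      have "x \<oplus> y = (\<phi> x \<oplus> h) \<oplus> (\<phi> y \<oplus> g)" using h(2) g(2) by simp
      also have "\<dots> = (\<phi> x \<oplus> \<phi> y) \<oplus> (h \<oplus> g)" using cc by (simp add: a_ac)
      finally show ?thesis by (rule \<phi>I[OF _ sC(7)[OF h(3) g(3)] Hadd[OF h(1) g(1)], rotated]) (use x y in simp)
    qed
    show "\<phi> (c \<otimes> x) = c \<otimes> \<phi> x" if c: "c \<in> C" and x: "x \<in> carrier R" for c x
    proof -
      obtain h where h: "h \<in> H" "x = \<phi> x \<oplus> h" "\<phi> x \<in> C" using \<phi>[OF x] by blast
      have "c \<otimes> x = c \<otimes> (\<phi> x \<oplus> h)" using h(2) by simp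
      also have "\<dots> = c \<otimes> \<phi> x \<oplus> c \<otimes> h" using Cc[OF c] Hc[OF h(1)] Cc[OF h(3)] by (simp add: r_distr)
      finally show ?thesis
        by (rule \<phi>I[OF _ sC(6)[OF c h(3)] Hsm[OF c h(1)], rotated]) (use Cc[OF c] x in simp)
    qed
  qed
qed

text \<open>
  In a finite field with \<open>u\<close> units, \<open>a\<^bsup>u+1\<^esup> = a\<close> for all \<open>a\<close>, so the polynomial \<open>X\<^bsup>u+1\<^esup> - X + 1\<close> has no
  root.
\<close>

lemma (in algebraically_closed) infinite_carrier: "infinite (carrier L)"
proof
  assume fin: "finite (carrier L)"
  then have finU: "finite (Units L)" using finite_subset[of "Units L" "carrier L"] by (auto simp: Units_def)
  define u where "u = card (Units L)"
  have u: "u > 0" using finU Units_one_closed unfolding u_def by (auto simp: card_gt_0_iff)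
  \<comment> \<open>Coefficient lists start with the leading coefficient: the polynomial is \<open>X\<^bsup>u+1\<^esup> - X + 1\<close>.\<close>
  let ?q = "[\<ominus> \<one>, \<one>]"
  let ?p = "\<one> # replicate (u - 1) \<zero> @ ?q"
  have pc: "?p \<in> carrier (poly_ring L)" by (auto simp: univ_poly_carrier[symmetric] polynomial_def)
  have "splitted ?p" by (rule roots_over_carrier[OF pc])
  then have "size (roots ?p) \<noteq> 0" unfolding splitted_def by simp
  then have "roots ?p \<noteq> {#}" by simp
  then obtain a where "a \<in># roots ?p" by blast
  then have a: "a \<in> carrier L" "eval ?p a = \<zero>"
    using roots_mem_iff_is_root[OF pc] unfolding is_root_def by auto
  have d: "length (replicate (u - 1) \<zero> @ ?q) = Suc u" using u by simp
  have "eval ?p a = a [^] Suc u \<oplus> eval (replicate (u - 1) \<zero> @ ?q) a"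
    using a(1) d by simp
  also have "eval (replicate (u - 1) \<zero> @ ?q) a = eval ?q a"
    by (rule eval_replicate) (use a(1) in auto)
  also have "eval ?q a = \<ominus> a \<oplus> \<one>" using a(1) by (simp add: l_minus)
  also have "a [^] Suc u = a"
  proof (cases "a = \<zero>")
    case False
    then have "a [^] u = \<one>" using units_power_order_eq_one[OF finU] a(1) unfolding u_def by (simp add: field_Units)
    then show ?thesis using a(1) by simp
  qed (simp add: nat_pow_zero)
  finally have "eval ?p a = \<one>" using a(1) by (simp add: r_neg2)
  then show False using a(2) one_not_zero by simp
qed

section \<open>Descent of parameter sequences\<close>

text \<open>
  The algebra \<open>B'\<close> plays the role of a scalar extension of \<open>B\<close>, of which the descent uses a \<open>B\<close>-linear
  retraction \<open>\<rho>\<close> of \<open>f\<close> and that the image of \<open>B\<close> spans \<open>B'\<close> over the scalars.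
\<close>

locale graded_descent = S: finite_over_degree K B G d + T: finite_over_degree L B' G' d
  for K :: "('c, 'l) ring_scheme" and B :: "('c, 'b, 'n) module_scheme" and G :: "nat \<Rightarrow> 'b set" and d :: nat
    and L :: "('e, 'k) ring_scheme" and B' :: "('e, 'f, 'o) module_scheme" and G' :: "nat \<Rightarrow> 'f set" +
  fixes f :: "'b \<Rightarrow> 'f" and \<rho> :: "'f \<Rightarrow> 'b"
  assumes f_hom: "f \<in> ring_hom B B'" and f_degree: "x \<in> G n \<Longrightarrow> f x \<in> G' n"
    and spanned: "G' n \<subseteq> lspan B' (G' 0) (f ` G n)"
    and \<rho>_closed: "y \<in> carrier B' \<Longrightarrow> \<rho> y \<in> carrier B"
    and \<rho>_add: "\<lbrakk> y \<in> carrier B'; z \<in> carrier B' \<rbrakk> \<Longrightarrow> \<rho> (y \<oplus>\<^bsub>B'\<^esub> z) = \<rho> y \<oplus>\<^bsub>B\<^esub> \<rho> z"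
    and \<rho>_mult: "\<lbrakk> x \<in> carrier B; y \<in> carrier B' \<rbrakk> \<Longrightarrow> \<rho> (f x \<otimes>\<^bsub>B'\<^esub> y) = x \<otimes>\<^bsub>B\<^esub> \<rho> y"
    and \<rho>_one: "\<rho> \<one>\<^bsub>B'\<^esub> = \<one>\<^bsub>B\<^esub>"
begin

lemma f_closed: "x \<in> carrier B \<Longrightarrow> f x \<in> carrier B'"
  using f_hom by (rule ring_hom_closed)

lemma retraction: "x \<in> carrier B \<Longrightarrow> \<rho> (f x) = x"
  using \<rho>_mult[of x "\<one>\<^bsub>B'\<^esub>"] f_closed[of x] by (simp add: \<rho>_one)

lemma \<rho>_zero: "\<rho> \<zero>\<^bsub>B'\<^esub> = \<zero>\<^bsub>B\<^esub>"
proof -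
  have "f \<zero>\<^bsub>B\<^esub> = \<zero>\<^bsub>B'\<^esub>" by (rule ring_hom_zero[OF f_hom S.A.ring_axioms T.A.ring_axioms])
  then show ?thesis using retraction[of "\<zero>\<^bsub>B\<^esub>"] by simp
qed

lemma f_Idl:
  assumes zs: "set zs \<subseteq> carrier B" and x: "x \<in> Idl\<^bsub>B\<^esub> (set zs)"
  shows "f x \<in> Idl\<^bsub>B'\<^esub> (set (map f zs))"
proof -
  interpret F: ring_hom_ring B B' f
    by (rule ring_hom_ringI2[OF S.A.ring_axioms T.A.ring_axioms f_hom])
  have zs': "set (map f zs) \<subseteq> carrier B'" using zs f_closed by auto
  have "ideal {r \<in> carrier B. f r \<in> Idl\<^bsub>B'\<^esub> (set (map f zs))} B"
    by (rule F.ideal_vimage[OF T.A.genideal_ideal[OF zs']])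
  moreover have "set zs \<subseteq> {r \<in> carrier B. f r \<in> Idl\<^bsub>B'\<^esub> (set (map f zs))}"
    using zs T.A.genideal_self[OF zs'] by auto
  ultimately have "Idl\<^bsub>B\<^esub> (set zs) \<subseteq> {r \<in> carrier B. f r \<in> Idl\<^bsub>B'\<^esub> (set (map f zs))}"
    by (rule S.A.genideal_minimal)
  then show ?thesis using x by blast
qed

text \<open>
  By \<open>B\<close>-linearity, \<open>\<rho>\<close> maps a combination of the elements \<open>f z\<close> to a combination of the elements \<open>z\<close>.
\<close>

lemma \<rho>_Idl:
  assumes zs: "set zs \<subseteq> carrier B"
    and central: "\<And>z y. \<lbrakk> z \<in> set zs; y \<in> carrier B' \<rbrakk> \<Longrightarrow> f z \<otimes>\<^bsub>B'\<^esub> y = y \<otimes>\<^bsub>B'\<^esub> f z"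
    and y: "y \<in> Idl\<^bsub>B'\<^esub> (set (map f zs))"
  shows "\<rho> y \<in> Idl\<^bsub>B\<^esub> (set zs)"
  using assms
proof (induction zs arbitrary: y)
  case Nil
  then have "y = \<zero>\<^bsub>B'\<^esub>" by (simp add: T.A.Idl_empty)
  then show ?case by (simp add: \<rho>_zero S.A.Idl_empty)
next
  case (Cons z zs)
  have zc: "z \<in> carrier B" and zsc: "set zs \<subseteq> carrier B" and zc': "set (z # zs) \<subseteq> carrier B" using Cons(2) by auto
  have zsc': "set (map f zs) \<subseteq> carrier B'" using zsc f_closed by auto
  have yin: "y \<in> Idl\<^bsub>B'\<^esub> (insert (f z) (set (map f zs)))" using Cons(4) by simp
  obtain a s where as: "a \<in> carrier B'" "s \<in> Idl\<^bsub>B'\<^esub> (set (map f zs))" "y = f z \<otimes>\<^bsub>B'\<^esub> a \<oplus>\<^bsub>B'\<^esub> s"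
    by (rule T.A.Idl_insert_central[OF f_closed[OF zc] zsc' _ yin]) (use Cons(3) in auto)
  interpret I': ideal "Idl\<^bsub>B'\<^esub> (set (map f zs))" B' by (rule T.A.genideal_ideal[OF zsc'])
  interpret I: ideal "Idl\<^bsub>B\<^esub> (set (z # zs))" B by (rule S.A.genideal_ideal[OF zc'])
  have self: "set (z # zs) \<subseteq> Idl\<^bsub>B\<^esub> (set (z # zs))" by (rule S.A.genideal_self[OF zc'])
  have "Idl\<^bsub>B\<^esub> (set zs) \<subseteq> Idl\<^bsub>B\<^esub> (set (z # zs))"
    by (rule S.A.genideal_minimal[OF I.is_ideal]) (use self in auto)
  moreover have "\<rho> s \<in> Idl\<^bsub>B\<^esub> (set zs)" by (rule Cons(1)[OF zsc Cons(3) as(2)]) auto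
  ultimately have s: "\<rho> s \<in> Idl\<^bsub>B\<^esub> (set (z # zs))" by blast
  have za: "z \<otimes>\<^bsub>B\<^esub> \<rho> a \<in> Idl\<^bsub>B\<^esub> (set (z # zs))"
    by (rule I.I_r_closed) (use self \<rho>_closed[OF as(1)] in auto)
  have "\<rho> y = z \<otimes>\<^bsub>B\<^esub> \<rho> a \<oplus>\<^bsub>B\<^esub> \<rho> s"
    using as(1) I'.Icarr[OF as(2)] f_closed[OF zc] by (simp add: as(3) \<rho>_add \<rho>_mult[OF zc])
  then show ?case using I.a_closed[OF za s] by simp
qed

text \<open>
  The retraction shows that an element of \<open>B\<close> lies in an ideal generated by parameters as soon as its
  image lies in the extended ideal. So regularity and boundedness descend. Unboundedness descends because
  an ideal that contains a component of \<open>B\<close> extends to one that contains the whole component of \<open>B'\<close>.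
\<close>

lemma parameter_sequence_descends:
  assumes xs: "set xs \<subseteq> G d" and ps: "T.parameter_sequence d (map f xs)"
    and cof: "T.cofinite_ideal (T.graded_idl (map f xs))"
  shows "S.parameter_sequence d xs" "S.cofinite_ideal (S.graded_idl xs)"
proof -
  have xc: "set xs \<subseteq> carrier B" using xs S.G_subset by blast
  have central: "f z \<otimes>\<^bsub>B'\<^esub> y = y \<otimes>\<^bsub>B'\<^esub> f z" if "z \<in> set xs" "y \<in> carrier B'" for z y
    by (rule T.parameters_central[OF ps]) (use that in auto)
  have pull: "x \<in> Idl\<^bsub>B\<^esub> (set zs)"
    if zs: "set zs \<subseteq> set xs" and x: "x \<in> carrier B" "f x \<in> Idl\<^bsub>B'\<^esub> (set (map f zs))" for zs x
  proof -
    have "set zs \<subseteq> carrier B" using zs xc by blast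
    then have "\<rho> (f x) \<in> Idl\<^bsub>B\<^esub> (set zs)" by (rule \<rho>_Idl[OF _ _ x(2)]) (use zs central in blast)
    then show ?thesis using retraction[OF x(1)] by simp
  qed
  show "S.cofinite_ideal (S.graded_idl xs)"
  proof -
    obtain N where N: "\<And>n. n > N \<Longrightarrow> G' n \<subseteq> T.graded_idl (map f xs) n"
      using cof unfolding T.cofinite_ideal_def by blast
    have "x \<in> S.graded_idl xs n" if n: "n > N" and x: "x \<in> G n" for n x
    proof -
      have "f x \<in> Idl\<^bsub>B'\<^esub> (set (map f xs))" using N[OF n] f_degree[OF x] by (auto simp: T.graded_idl_def)
      then show ?thesis using pull[OF subset_refl] x by (simp add: S.graded_idl_def)
    qed
    then show ?thesis unfolding S.cofinite_ideal_def by blast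
  qed
  show "S.parameter_sequence d xs"
    unfolding S.parameter_sequence_def
  proof (intro conjI allI impI)
    show "set xs \<subseteq> G d" by (rule xs)
    fix i assume i: "i < length xs"
    have ti: "set (take i xs) \<subseteq> set xs" by (rule set_take_subset)
    have tic: "set (take i xs) \<subseteq> carrier B" using ti xc by blast
    have xi: "xs ! i \<in> carrier B" "xs ! i \<in> G d" using i xc xs nth_mem by blast+
    from ps have "i < length (map f xs) \<longrightarrow> T.eventually_regular d (map f xs ! i) (T.graded_idl (take i (map f xs))) \<and>
      \<not> T.cofinite_ideal (T.graded_idl (take i (map f xs)))"
      unfolding T.parameter_sequence_def by blast
    then have reg: "T.eventually_regular d (f (xs ! i)) (T.graded_idl (map f (take i xs)))"
      and ncof: "\<not> T.cofinite_ideal (T.graded_idl (map f (take i xs)))" using i by (simp_all add: take_map)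
    obtain N where N: "\<And>n u. \<lbrakk> n > N; u \<in> G' n; f (xs ! i) \<otimes>\<^bsub>B'\<^esub> u \<in> T.graded_idl (map f (take i xs)) (d + n) \<rbrakk>
        \<Longrightarrow> u \<in> T.graded_idl (map f (take i xs)) n"
      using reg unfolding T.eventually_regular_def by blast
    have "u \<in> S.graded_idl (take i xs) n"
      if n: "n > N" and u: "u \<in> G n" and xu: "xs ! i \<otimes>\<^bsub>B\<^esub> u \<in> S.graded_idl (take i xs) (d + n)" for n u
    proof -
      have "f (xs ! i \<otimes>\<^bsub>B\<^esub> u) \<in> Idl\<^bsub>B'\<^esub> (set (map f (take i xs)))"
        by (rule f_Idl[OF tic]) (use xu in \<open>simp add: S.graded_idl_def\<close>)
      then have "f (xs ! i) \<otimes>\<^bsub>B'\<^esub> f u \<in> T.graded_idl (map f (take i xs)) (d + n)"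
        using ring_hom_mult[OF f_hom xi(1) S.G_carrier[OF u]]
          T.mult_degree[OF f_degree[OF xi(2)] f_degree[OF u]] by (simp add: T.graded_idl_def)
      then have "f u \<in> Idl\<^bsub>B'\<^esub> (set (map f (take i xs)))"
        using N[OF n f_degree[OF u]] by (simp add: T.graded_idl_def)
      then show ?thesis using pull[OF ti S.G_carrier[OF u]] u by (simp add: S.graded_idl_def)
    qed
    then show "S.eventually_regular d (xs ! i) (S.graded_idl (take i xs))"
      unfolding S.eventually_regular_def by blast
    show "\<not> S.cofinite_ideal (S.graded_idl (take i xs))"
    proof
      assume "S.cofinite_ideal (S.graded_idl (take i xs))"
      then obtain M where M: "\<And>n. n > M \<Longrightarrow> G n \<subseteq> S.graded_idl (take i xs) n"
        unfolding S.cofinite_ideal_def by blast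
      have tc': "set (map f (take i xs)) \<subseteq> carrier B'" using tic f_closed by auto
      interpret J: ideal "Idl\<^bsub>B'\<^esub> (set (map f (take i xs)))" B' by (rule T.A.genideal_ideal[OF tc'])
      have "G' n \<subseteq> T.graded_idl (map f (take i xs)) n" if n: "n > M" for n
      proof -
        have fG: "f x \<in> Idl\<^bsub>B'\<^esub> (set (map f (take i xs)))" if "x \<in> G n" for x
          by (rule f_Idl[OF tic]) (use M[OF n] that in \<open>auto simp: S.graded_idl_def\<close>)
        have "lspan B' (G' 0) (f ` G n) \<subseteq> Idl\<^bsub>B'\<^esub> (set (map f (take i xs)))"
        proof (rule T.A.lspan_least)
          show "b \<otimes>\<^bsub>B'\<^esub> g \<in> Idl\<^bsub>B'\<^esub> (set (map f (take i xs)))" if "b \<in> G' 0" "g \<in> f ` G n" for b g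
            by (rule J.I_l_closed) (use that fG in auto)
        qed (rule J.zero_closed, rule J.a_closed)
        then show ?thesis using spanned[of n] by (auto simp: T.graded_idl_def)
      qed
      then have "T.cofinite_ideal (T.graded_idl (map f (take i xs)))"
        unfolding T.cofinite_ideal_def by blast
      then show False using ncof by simp
    qed
  qed
qed

end

section \<open>Existence over a finite extension\<close>

text \<open>
  A basis inside \<open>C\<close> spans the same set in the smaller ring.
\<close>

lemma (in ring) finite_dimension_consistent:
  assumes C: "subring C R" and F: "subfield F R" "F \<subseteq> C" and fin: "finite_dimension F C"
  shows "ring.finite_dimension (R\<lparr>carrier := C\<rparr>) F C"
proof -
  interpret S: ring "R\<lparr>carrier := C\<rparr>" by (rule subring_is_ring[OF C])
  obtain n where n: "dimension n F C" using fin unfolding finite_dimension_def by blast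
  obtain Us where Us: "set Us \<subseteq> carrier R" "Span F Us = C"
    using exists_base[OF F(1) n] by blast
  have sub: "set Us \<subseteq> C" using Span_base_incl[OF F(1) Us(1)] Us(2) by simp
  have "field (R\<lparr>carrier := F\<rparr>)" by (rule subfield_iff(2)[OF F(1)])
  then have "subfield F (R\<lparr>carrier := C\<rparr>)" by (intro S.subfield_iff(1)) (use F(2) in simp_all)
  then have "S.finite_dimension F (S.Span F Us)" by (rule S.Span_finite_dimension) (use sub in simp)
  then show ?thesis unfolding Span_consistent[OF C] Us(2) .
qed

lemma connected_scalar_extensionI:
  assumes "connected_noetherian_algebra k A G" "field K" "\<iota> \<in> ring_hom k K"
  shows "connected_scalar_extension k A G K \<iota>"
  using assms connected_noetherian_algebra.axioms(1)
  by (intro connected_scalar_extension.intro scalar_extension.intro scalar_extension_axioms.intro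
      graded_algebra.intro noetherian_graded_algebra.intro)

text \<open>
  The map \<open>f\<close> is induced by the inclusion \<open>C \<subseteq> L\<close> and \<open>\<rho>\<close> by a \<open>C\<close>-linear retraction of it. An element of \<open>A\<^sub>L\<close> whose
  scalars lie in \<open>C\<close> comes from \<open>A\<^sub>K\<close>.
\<close>

lemma exists_descent_maps:
  fixes k :: "('a, 'm) ring_scheme" and A :: "('a, 'b, 'n) module_scheme" and L :: "('c, 'l) ring_scheme"
  assumes A: "connected_noetherian_algebra k A G" and L: "field L" and C: "subfield C L"
    and \<iota>: "\<iota> \<in> ring_hom k L" and \<iota>C: "\<iota> ` carrier k \<subseteq> C"
    and fin: "finitely_generated_over A (generated_subalgebra k A (G d))" and d: "d \<ge> 1"
  defines "K \<equiv> L\<lparr>carrier := C\<rparr>"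
  obtains f \<rho> where
    "graded_descent K (base_change k \<iota> K A) (base_change_grading k \<iota> K A G) d
      L (base_change k \<iota> L A) (base_change_grading k \<iota> L A G) f \<rho>"
    "\<And>u. Poly_Mapping.keys u \<subseteq> C \<times> G d \<Longrightarrow>
      \<exists>x \<in> base_change_grading k \<iota> K A G d. f x = tensor_class k \<iota> L A u"
proof -
  interpret L: field L by (rule L)
  note Cs = subfieldE(3)[OF C]
  have K: "field K" unfolding K_def by (rule L.subfield_iff(2)[OF C])
  have \<iota>K: "\<iota> \<in> ring_hom k K"
    using \<iota> \<iota>C unfolding ring_hom_def K_def by auto
  interpret EK: connected_scalar_extension k A G K \<iota> by (rule connected_scalar_extensionI[OF A K \<iota>K])
  interpret EL: connected_scalar_extension k A G L \<iota> by (rule connected_scalar_extensionI[OF A L \<iota>])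
  have Kc: "carrier K = C" and Kadd: "add K = add L" and Kmult: "monoid.mult K = monoid.mult L"
    and Kone: "\<one>\<^bsub>K\<^esub> = \<one>\<^bsub>L\<^esub>" unfolding K_def by simp_all
  have KL: "c \<in> carrier L" if "c \<in> carrier K" for c using that Cs Kc by auto
  obtain f where fc: "f \<in> carrier EK.B \<rightarrow> carrier EL.B"
    and fadd: "\<And>U V. \<lbrakk> U \<in> carrier EK.B; V \<in> carrier EK.B \<rbrakk> \<Longrightarrow> f (U \<oplus>\<^bsub>EK.B\<^esub> V) = f U \<oplus>\<^bsub>EL.B\<^esub> f V"
    and f0: "f \<zero>\<^bsub>EK.B\<^esub> = \<zero>\<^bsub>EL.B\<^esub>"
    and ft: "\<And>c x. \<lbrakk> c \<in> carrier K; x \<in> carrier A \<rbrakk> \<Longrightarrow> f (EK.tens c x) = EL.tens c x"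
  proof (rule EK.universal_property[OF EL.B.is_abelian_group, of "\<lambda>c x. EL.tens c x"])
    fix c c' x assume "c \<in> carrier K" "c' \<in> carrier K" "x \<in> carrier A"
    then show "EL.tens (c \<oplus>\<^bsub>K\<^esub> c') x = EL.tens c x \<oplus>\<^bsub>EL.B\<^esub> EL.tens c' x"
      using EL.tens_add_left KL by (simp add: Kadd)
  next
    fix c a x assume "c \<in> carrier K" "a \<in> carrier k" "x \<in> carrier A"
    then show "EL.tens (c \<otimes>\<^bsub>K\<^esub> \<iota> a) x = EL.tens c (a \<odot>\<^bsub>A\<^esub> x)"
      using EL.tens_balanced KL by (simp add: Kmult)
  qed (use that KL EL.tens_add_right in simp_all)
  obtain \<phi> where \<phi>: "\<And>x. x \<in> carrier L \<Longrightarrow> \<phi> x \<in> C"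
    "\<And>x y. \<lbrakk> x \<in> carrier L; y \<in> carrier L \<rbrakk> \<Longrightarrow> \<phi> (x \<oplus>\<^bsub>L\<^esub> y) = \<phi> x \<oplus>\<^bsub>L\<^esub> \<phi> y"
    "\<And>c x. \<lbrakk> c \<in> C; x \<in> carrier L \<rbrakk> \<Longrightarrow> \<phi> (c \<otimes>\<^bsub>L\<^esub> x) = c \<otimes>\<^bsub>L\<^esub> \<phi> x"
    "\<phi> \<one>\<^bsub>L\<^esub> = \<one>\<^bsub>L\<^esub>"
    using L.exists_linear_retraction[OF C] by metis
  have \<phi>K: "\<phi> c \<in> carrier K" if "c \<in> carrier L" for c using \<phi>(1) that Kc by simp
  have \<phi>\<iota>: "\<phi> (c \<otimes>\<^bsub>L\<^esub> \<iota> a) = \<phi> c \<otimes>\<^bsub>K\<^esub> \<iota> a" if "c \<in> carrier L" "a \<in> carrier k" for c a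
  proof -
    have a: "\<iota> a \<in> C" "\<iota> a \<in> carrier L" using \<iota>C that(2) Cs by auto
    have c: "\<phi> c \<in> carrier L" using \<phi>(1)[OF that(1)] Cs by auto
    show ?thesis using \<phi>(3)[OF a(1) that(1)] L.m_comm[OF that(1) a(2)] L.m_comm[OF c a(2)] by (simp add: Kmult)
  qed
  obtain \<rho> where \<rho>c: "\<rho> \<in> carrier EL.B \<rightarrow> carrier EK.B"
    and \<rho>add: "\<And>U V. \<lbrakk> U \<in> carrier EL.B; V \<in> carrier EL.B \<rbrakk> \<Longrightarrow> \<rho> (U \<oplus>\<^bsub>EL.B\<^esub> V) = \<rho> U \<oplus>\<^bsub>EK.B\<^esub> \<rho> V"
    and \<rho>0: "\<rho> \<zero>\<^bsub>EL.B\<^esub> = \<zero>\<^bsub>EK.B\<^esub>"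
    and \<rho>t: "\<And>c x. \<lbrakk> c \<in> carrier L; x \<in> carrier A \<rbrakk> \<Longrightarrow> \<rho> (EL.tens c x) = EK.tens (\<phi> c) x"
  proof (rule EL.universal_property[OF EK.B.is_abelian_group, of "\<lambda>c x. EK.tens (\<phi> c) x"])
    fix c c' x assume "c \<in> carrier L" "c' \<in> carrier L" "x \<in> carrier A"
    then show "EK.tens (\<phi> (c \<oplus>\<^bsub>L\<^esub> c')) x = EK.tens (\<phi> c) x \<oplus>\<^bsub>EK.B\<^esub> EK.tens (\<phi> c') x"
      using EK.tens_add_left[OF \<phi>K \<phi>K] \<phi>(2) by (simp add: Kadd)
  next
    fix c a x assume "c \<in> carrier L" "a \<in> carrier k" "x \<in> carrier A"
    then show "EK.tens (\<phi> (c \<otimes>\<^bsub>L\<^esub> \<iota> a)) x = EK.tens (\<phi> c) (a \<odot>\<^bsub>A\<^esub> x)"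
      using EK.tens_balanced[OF \<phi>K] by (simp add: \<phi>\<iota>)
  qed (use that \<phi>K EK.tens_add_right in simp_all)
  have fcl: "f U \<in> carrier EL.B" if "U \<in> carrier EK.B" for U using fc that by auto
  have \<rho>cl: "\<rho> U \<in> carrier EK.B" if "U \<in> carrier EL.B" for U using \<rho>c that by auto
  have fmult: "f (U \<otimes>\<^bsub>EK.B\<^esub> V) = f U \<otimes>\<^bsub>EL.B\<^esub> f V" if U: "U \<in> carrier EK.B" and V: "V \<in> carrier EK.B" for U V
    using U
  proof (induction U rule: EK.tensor_induct)
    case zero then show ?case using V fcl[OF V] by (simp add: f0)
  next
    case cx: (tens c x)
    show ?case
      using V
    proof (induction V rule: EK.tensor_induct)
      case zero then show ?case using cx fcl[of "EK.tens c x"] by (simp add: f0)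
    next
      case (tens c' y)
      have "c \<otimes>\<^bsub>K\<^esub> c' \<in> carrier K" using cx tens by simp
      then show ?case using cx tens KL EK.tens_mult[of c c' x y] EL.tens_mult[of c c' x y] ft by (simp add: Kmult)
    next
      case (add V W)
      then show ?case using cx fcl by (simp add: EK.B.r_distr EL.B.r_distr fadd)
    qed
  next
    case (add U W)
    then show ?case using V fcl by (simp add: EK.B.l_distr EL.B.l_distr fadd)
  qed
  have fone: "f \<one>\<^bsub>EK.B\<^esub> = \<one>\<^bsub>EL.B\<^esub>"
    using ft[OF EK.K.one_closed EK.A.one_closed] EK.tens_one EL.tens_one by (simp add: Kone)
  have fhom: "f \<in> ring_hom EK.B EL.B" by (rule ring_hom_memI) (auto simp: fcl fmult fadd fone)
  have fdeg: "f U \<in> EL.GB n" if "U \<in> EK.GB n" for U n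
    using that
  proof (induction U rule: EK.graded_tensor_induct)
    case (tens c x) then show ?case using ft EL.GB_tens KL by simp
  next
    case (add U V) then show ?case using fadd EL.GB_add by simp
  qed (simp add: f0 EL.GB_zero)
  have \<rho>mult: "\<rho> (f U \<otimes>\<^bsub>EL.B\<^esub> V) = U \<otimes>\<^bsub>EK.B\<^esub> \<rho> V" if U: "U \<in> carrier EK.B" and V: "V \<in> carrier EL.B" for U V
    using U
  proof (induction U rule: EK.tensor_induct)
    case zero then show ?case using V \<rho>cl[OF V] by (simp add: f0 \<rho>0)
  next
    case cx: (tens c x)
    note fcx = EL.tens_closed[OF KL[OF cx(1)] cx(2)]
    show ?case
      using V
    proof (induction V rule: EL.tensor_induct)
      case zero then show ?case using cx fcx by (simp add: ft \<rho>0)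
    next
      case (tens c' y)
      have "\<phi> (c \<otimes>\<^bsub>L\<^esub> c') = c \<otimes>\<^bsub>K\<^esub> \<phi> c'" using \<phi>(3)[of c c'] cx tens Kc by (simp add: Kmult)
      then show ?case
        using cx tens KL[OF cx(1)] \<phi>K[OF tens(1)] by (simp add: ft \<rho>t EK.tens_mult EL.tens_mult)
    next
      case (add V W)
      then show ?case using cx fcx \<rho>cl by (simp add: EK.B.r_distr EL.B.r_distr \<rho>add ft)
    qed
  next
    case (add U W)
    then show ?case using V fcl \<rho>cl by (simp add: EK.B.l_distr EL.B.l_distr fadd \<rho>add)
  qed
  have \<rho>one: "\<rho> \<one>\<^bsub>EL.B\<^esub> = \<one>\<^bsub>EK.B\<^esub>"
    using \<rho>t[OF L.one_closed EK.A.one_closed] EK.tens_one EL.tens_one by (simp add: Kone \<phi>(4))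
  have G0: "EL.GB 0 \<subseteq> carrier EL.B" and fG: "f ` EK.GB n \<subseteq> carrier EL.B" for n
    using EL.GB_subset EK.GB_subset fcl by blast+
  have span: "EL.GB n \<subseteq> lspan EL.B (EL.GB 0) (f ` EK.GB n)" for n
  proof
    fix U assume "U \<in> EL.GB n"
    then show "U \<in> lspan EL.B (EL.GB 0) (f ` EK.GB n)"
    proof (induction U rule: EL.graded_tensor_induct)
      case zero then show ?case by (rule lspan.zero)
    next
      case (tens c x)
      have xc: "x \<in> carrier A" using EK.G_subset tens(2) by blast
      have "EL.tens \<one>\<^bsub>L\<^esub> x = f (EK.tens \<one>\<^bsub>K\<^esub> x)" using ft[OF EK.K.one_closed xc] by (simp add: Kone)
      moreover have "EK.tens \<one>\<^bsub>K\<^esub> x \<in> EK.GB n" by (rule EK.GB_tens[OF EK.K.one_closed tens(2)])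
      ultimately have "EL.tens \<one>\<^bsub>L\<^esub> x \<in> f ` EK.GB n" by blast
      moreover have "EL.tens c \<one>\<^bsub>A\<^esub> \<in> EL.GB 0" by (rule EL.GB_tens[OF tens(1) EK.one_degree])
      ultimately show ?case unfolding EL.tens_factor[OF tens(1) xc] by (intro EL.B.lspan_mult_in[OF G0 fG])
    next
      case (add U V) then show ?case by (intro EL.B.lspan_add[OF G0 fG])
    qed
  qed
  have finK: "finite_over_degree K EK.B EK.GB d" and finL: "finite_over_degree L EL.B EL.GB d"
    using EK.base_change_connected_noetherian EL.base_change_connected_noetherian
      EK.base_change_finite[OF fin] EL.base_change_finite[OF fin] d
    by (auto intro!: finite_over_degree.intro noetherian_graded_algebra.intro finite_over_degree_axioms.intro)
  have desc: "graded_descent K EK.B EK.GB d L EL.B EL.GB f \<rho>"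
    by (intro graded_descent.intro graded_descent_axioms.intro finK finL fhom fdeg span \<rho>cl \<rho>add \<rho>mult \<rho>one)
  have lift: "\<exists>x \<in> EK.GB d. f x = EL.cls u" if "Poly_Mapping.keys u \<subseteq> C \<times> G d" for u
  proof (rule EL.cls_induct[OF that Cs EK.G_subset EK.G_minus])
    show "\<exists>x \<in> EK.GB d. f x = \<zero>\<^bsub>EL.B\<^esub>" using EK.GB_zero f0 by blast
    show "\<exists>x \<in> EK.GB d. f x = EL.tens c y" if "c \<in> C" "y \<in> G d" for c y
      using EK.GB_tens[of c y d] ft[of c y] that Kc EK.G_subset by blast
    show "\<exists>x \<in> EK.GB d. f x = U \<oplus>\<^bsub>EL.B\<^esub> V"
      if "\<exists>x \<in> EK.GB d. f x = U" "\<exists>x \<in> EK.GB d. f x = V" for U V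
    proof -
      from that obtain x y where "x \<in> EK.GB d" "f x = U" "y \<in> EK.GB d" "f y = V" by blast
      then show ?thesis using EK.GB_add[of x d y] fadd[of x y] EK.GB_subset by blast
    qed
  qed
  show thesis by (rule that[OF desc lift])
qed

theorem proposition3p2:
  fixes k :: "('a, 'm) ring_scheme" and A :: "('a, 'b, 'n) module_scheme"
    and G :: "nat \<Rightarrow> 'b set" and p d :: nat
  assumes "connected_noetherian_algebra k A G"
    and "characteristic k = p" and "p > 0"
    and "d \<ge> 1"
    and "finitely_generated_over A (generated_subalgebra k A (G d))"
  shows "\<exists>(K :: 'a closure_carrier ring) \<iota> xs.
    finite_field_extension k \<iota> K \<and>
    system_of_parameters K (base_change k \<iota> K A) (base_change_grading k \<iota> K A G) xs \<and>
    filter_regular (base_change k \<iota> K A) (base_change_grading k \<iota> K A G) xs \<and>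
    (\<forall>x \<in> set xs. x \<in> base_change_grading k \<iota> K A G d)"
proof -
  interpret A: connected_noetherian_algebra k A G by fact
  have k: "field k" by (rule A.k.field_axioms)
  define L where "L = field.alg_closure k"
  define \<iota> where "\<iota> = (ring.indexed_const k :: 'a \<Rightarrow> 'a closure_carrier)"
  have closure: "algebraic_closure L (\<iota> ` carrier k)" and \<iota>: "\<iota> \<in> ring_hom k L"
    using field.alg_closureE[OF k] unfolding L_def \<iota>_def by auto
  interpret L: algebraic_closure L "\<iota> ` carrier k" by (rule closure)
  have L: "field L" by (rule L.field_axioms)
  have F: "subfield (\<iota> ` carrier k) L" by (rule L.subfield_axioms)
  interpret EL: connected_scalar_extension k A G L \<iota> by (rule connected_scalar_extensionI[OF assms(1) L \<iota>])
  interpret T: finite_over_degree L "base_change k \<iota> L A" "base_change_grading k \<iota> L A G" d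
    using EL.base_change_connected_noetherian EL.base_change_finite[OF assms(5)] assms(4)
    by (auto intro!: finite_over_degree.intro noetherian_graded_algebra.intro finite_over_degree_axioms.intro)
  obtain ys where ys: "T.parameter_sequence d ys" "T.cofinite_ideal (T.graded_idl ys)"
    using T.exists_parameter_sequence[OF L.infinite_carrier] by blast
  have "\<exists>u. Poly_Mapping.keys u \<subseteq> carrier L \<times> G d \<and> y = EL.cls u" if "y \<in> set ys" for y
  proof -
    have "y \<in> base_change_grading k \<iota> L A G d" using ys(1) that unfolding T.parameter_sequence_def by blast
    then obtain u where "u \<in> carrier (free_Abelian_group (carrier L \<times> G d))" "y = EL.cls u"
      unfolding base_change_grading_def by blast
    then show ?thesis by (intro exI[of _ u]) simp
  qed
  then obtain u where u: "\<And>y. y \<in> set ys \<Longrightarrow> Poly_Mapping.keys (u y) \<subseteq> carrier L \<times> G d"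
    "\<And>y. y \<in> set ys \<Longrightarrow> y = EL.cls (u y)" by metis
  \<comment> \<open>The scalars that occur in chosen representatives of the parameters generate the extension.\<close>
  have "finite (\<Union>y \<in> set ys. fst ` Poly_Mapping.keys (u y))" by simp
  from finite_list[OF this] obtain cs where cs: "set cs = (\<Union>y \<in> set ys. fst ` Poly_Mapping.keys (u y))" ..
  have csc: "set cs \<subseteq> carrier L" unfolding cs using u(1) by fastforce
  define C where "C = L.finite_extension (\<iota> ` carrier k) cs"
  have alg: "(L.algebraic over \<iota> ` carrier k) c" if "c \<in> set cs" for c
    using L.algebraic_extension csc that by blast
  have C: "subfield C L" unfolding C_def by (rule L.finite_extension_is_subfield[OF F csc alg])
  have FC: "\<iota> ` carrier k \<subseteq> C" unfolding C_def by (rule L.finite_extension_incl[OF subfieldE(3)[OF F] csc])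
  have csC: "set cs \<subseteq> C" unfolding C_def by (rule L.finite_extension_mem[OF subfieldE(1)[OF F] csc])
  define K where "K = L\<lparr>carrier := C\<rparr>"
  obtain f \<rho> where desc: "graded_descent K (base_change k \<iota> K A) (base_change_grading k \<iota> K A G) d
      L (base_change k \<iota> L A) (base_change_grading k \<iota> L A G) f \<rho>"
    and lift: "\<And>u. Poly_Mapping.keys u \<subseteq> C \<times> G d \<Longrightarrow>
      \<exists>x \<in> base_change_grading k \<iota> K A G d. f x = EL.cls u"
    using exists_descent_maps[OF assms(1) L C \<iota> FC assms(5,4)] unfolding K_def by blast
  interpret D: graded_descent K "base_change k \<iota> K A" "base_change_grading k \<iota> K A G" d
      L "base_change k \<iota> L A" "base_change_grading k \<iota> L A G" f \<rho> by (rule desc)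
  have "\<exists>x \<in> base_change_grading k \<iota> K A G d. f x = y" if y: "y \<in> set ys" for y
  proof -
    have "Poly_Mapping.keys (u y) \<subseteq> C \<times> G d"
    proof
      fix q assume q: "q \<in> Poly_Mapping.keys (u y)"
      then have "fst q \<in> C" using csC y unfolding cs by blast
      moreover have "snd q \<in> G d" using u(1)[OF y] q by auto
      ultimately show "q \<in> C \<times> G d" by (simp add: mem_Times_iff)
    qed
    from lift[OF this] show ?thesis using u(2)[OF y] by simp
  qed
  then obtain g where g: "\<And>y. y \<in> set ys \<Longrightarrow> g y \<in> base_change_grading k \<iota> K A G d"
    "\<And>y. y \<in> set ys \<Longrightarrow> f (g y) = y" by metis
  let ?xs = "map g ys"
  have xs: "set ?xs \<subseteq> base_change_grading k \<iota> K A G d" using g(1) by auto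
  have fxs: "map f ?xs = ys" using g(2) by (simp add: map_idI)
  have ps: "D.S.parameter_sequence d ?xs" "D.S.cofinite_ideal (D.S.graded_idl ?xs)"
    using D.parameter_sequence_descends[OF xs] ys unfolding fxs by auto
  have "L.finite_dimension (\<iota> ` carrier k) C"
    unfolding C_def by (rule L.finite_extension_finite_dimension(1)[OF F csc alg])
  then have "ring.finite_dimension K (\<iota> ` carrier k) C"
    unfolding K_def by (rule L.finite_dimension_consistent[OF subfieldE(1)[OF C] F FC])
  moreover have "field K" unfolding K_def by (rule L.subfield_iff(2)[OF C])
  moreover have "\<iota> \<in> ring_hom k K" using \<iota> FC unfolding ring_hom_def K_def by auto
  moreover have "carrier K = C" unfolding K_def by simp
  ultimately have "finite_field_extension k \<iota> K" unfolding finite_field_extension_def using k by simp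
  then show ?thesis
    using D.S.parameters_system[OF ps] D.S.parameters_filter_regular[OF ps(1)] xs by blast
qed

end
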